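(* Let $0<H<1$, $C_H=\frac{\Gamma(1+2H)\sin(\pi H)}{2\pi}$ and $\Delta'(\gamma)=C_H|\gamma|^{1-2H}$. The outer function $h$ in the Wiener-Hopf spectral decomposition $$\frac{\Delta'(\gamma)}{1+\gamma^2}=h(\gamma)\overline{h}(\gamma)$$ that admits the reality condition $(-\gamma-i)h(-\gamma)=(\gamma+i)\overline{h}(\gamma)$ is given by $$h(\gamma)=\sqrt{C_H}\,\exp\left\{i\pi\,\frac{2H-1}{4}\,\mathrm{sign}(\gamma)\right\}\frac{i-\gamma}{1+\gamma^2}\,|\gamma|^{1/2-H}.$$
   Context: Here $\gamma\in\mathbb R$, $\overline{h}(\gamma)$ denotes the complex conjugate of $h(\gamma)$, $\mathrm{sign}(\gamma)$ is the sign of $\gamma$, and $\Gamma$ is Euler's Gamma function. $H^{2+}$ is the Hardy space of the upper half-plane, identified through boundary values with a closed subspace of $L_2(\mathbb R,d\gamma)$ (equivalently, the set of Fourier transforms $\int_0^\infty f(t)e^{i\gamma t}dt$ with $f\in L_2([0,\infty))$), and $H^{2-}$ is the analogous Hardy space of the lower half-plane (Fourier transforms of functions in $L_2((-\infty,0])$). A function $h\in H^{2+}$ is outer if the closed linear span in $L_2(d\gamma)$ of the functions $e^{i\gamma t}\overline{h}(\gamma)$, $t<0$, equals $H^{2-}$. The measure $d\Delta(\gamma)=C_H|\gamma|^{1-2H}d\gamma$ is the spectral measure of the fractional Brownian motion with Hurst parameter $H$.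
   Formalization: "The outer function h" is unique only up to a global sign: -h is also outer and satisfies the same factorization and reality condition; so the displayed h is shown to have these properties, and any such function equals h or -h almost everywhere. *)

theory Defs
  imports "HOL-Complex_Analysis.Complex_Analysis"
begin

text \<open>
  Elements of \<open>L\<^sub>2(\<real>, d\<gamma>)\<close> are represented by Borel functions; equality in \<open>L\<^sub>2\<close> is equality almost
  everywhere, and all the sets of functions below are closed under changing a function (measurably)
  on a null set.  Norms are nonnegative Lebesgue integrals, so that they are meaningful without an
  integrability proviso.
\<close>

definition L2_norm_sq :: "(real \<Rightarrow> complex) \<Rightarrow> ennreal" where
  "L2_norm_sq f = (\<integral>\<^sup>+ x. ennreal ((cmod (f x))\<^sup>2) \<partial>lborel)"

definition L2 :: "(real \<Rightarrow> complex) set" where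
  "L2 = {f \<in> borel_measurable lborel. L2_norm_sq f < \<infinity>}"

text \<open>
  The Hardy spaces of the two half-planes as sets of boundary functions: a function holomorphic in
  the half-plane whose \<open>L\<^sub>2\<close> norms on horizontal lines are bounded is identified with its boundary
  value, the \<open>L\<^sub>2\<close> limit of its restrictions to horizontal lines approaching the real axis.
\<close>

definition H2_plus :: "(real \<Rightarrow> complex) set" where
  "H2_plus = {f \<in> L2. \<exists>F. F holomorphic_on {z. Im z > 0} \<and>
     (SUP y\<in>{0<..}. L2_norm_sq (\<lambda>x. F (Complex x y))) < \<infinity> \<and>
     ((\<lambda>y. L2_norm_sq (\<lambda>x. F (Complex x y) - f x)) \<longlongrightarrow> 0) (at_right 0)}"

definition H2_minus :: "(real \<Rightarrow> complex) set" where
  "H2_minus = {f \<in> L2. \<exists>F. F holomorphic_on {z. Im z < 0} \<and>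
     (SUP y\<in>{..<0}. L2_norm_sq (\<lambda>x. F (Complex x y))) < \<infinity> \<and>
     ((\<lambda>y. L2_norm_sq (\<lambda>x. F (Complex x y) - f x)) \<longlongrightarrow> 0) (at_left 0)}"

definition L2_closed_span :: "'i set \<Rightarrow> ('i \<Rightarrow> real \<Rightarrow> complex) \<Rightarrow> (real \<Rightarrow> complex) set" where
  "L2_closed_span I e = {g \<in> L2. \<forall>\<epsilon>>0. \<exists>T c. finite T \<and> T \<subseteq> I \<and>
     L2_norm_sq (\<lambda>x. g x - (\<Sum>t\<in>T. c t * e t x)) < \<epsilon>}"

definition outer :: "(real \<Rightarrow> complex) \<Rightarrow> bool" where
  "outer h \<longleftrightarrow> h \<in> H2_plus \<and>
     L2_closed_span {t. t < 0} (\<lambda>t \<gamma>. exp (\<i> * of_real \<gamma> * of_real t) * cnj (h \<gamma>)) = H2_minus"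

definition C_H :: "real \<Rightarrow> real" where
  "C_H H = Gamma (1 + 2 * H) * sin (pi * H) / (2 * pi)"

definition fbm_density :: "real \<Rightarrow> real \<Rightarrow> real" where
  "fbm_density H \<gamma> = C_H H * \<bar>\<gamma>\<bar> powr (1 - 2 * H)"

definition wiener_hopf_factor :: "(real \<Rightarrow> real) \<Rightarrow> (real \<Rightarrow> complex) \<Rightarrow> bool" where
  "wiener_hopf_factor \<Delta>' h \<longleftrightarrow>
     (AE \<gamma> in lborel. of_real (\<Delta>' \<gamma> / (1 + \<gamma>\<^sup>2)) = h \<gamma> * cnj (h \<gamma>))"

definition reality_condition :: "(real \<Rightarrow> complex) \<Rightarrow> bool" where
  "reality_condition h \<longleftrightarrow>
     (AE \<gamma> in lborel. (- of_real \<gamma> - \<i>) * h (- \<gamma>) = (of_real \<gamma> + \<i>) * cnj (h \<gamma>))"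

end

theory Submission
  imports Defs "HOL-Probability.Sinc_Integral"
begin

text \<open>
  The function \<open>h\<close> is the boundary value of \<open>- sqrt C\<^sub>H (- \<i> z) powr (1 / 2 - H) / (z + \<i>)\<close>, which is holomorphic and
  zero-free in the upper half-plane. The factorisation and the reality condition are computations.

  Outer: after complex conjugation one has to show that the functions \<open>exp (\<i> s x) h(x)\<close>, \<open>s > 0\<close>, span a dense
  subspace of \<open>H\<^sup>2\<^sup>+\<close>. The closed span is stable under \<open>L\<^sub>1\<close>-superpositions. A Laplace transform gives
  \<open>h(x) / (x - w)\<close> with \<open>Im w < 0\<close>, Cauchy's formula then gives \<open>h \<psi>\<close> for \<open>\<psi>\<close> holomorphic and decaying in a
  slightly larger half-plane, and regularising \<open>f / h\<close> to such a \<open>\<psi>\<close> gives every \<open>f\<close> in \<open>H\<^sup>2\<^sup>+\<close>.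

  Uniqueness: if \<open>g\<close> is outer with \<open>\<bar>g\<bar> = \<bar>h\<bar>\<close>, then \<open>u = g / h\<close> is unimodular and both \<open>u\<close> and its conjugate map
  \<open>1 / (x + \<i>)\<close> into \<open>H\<^sup>2\<^sup>+\<close>. Cauchy's formula then forces \<open>u\<close> to be constant, and the reality condition makes
  the constant real.
\<close>

section \<open>Square-integrable functions on the line\<close>

text \<open>The point 0 shapes the density argument. With \<open>a = 1 / 2 - H\<close> the function
  \<open>h\<close> behaves there like \<open>\<bar>x\<bar> powr a\<close>, so for
  \<open>a < 0\<close> it is \<open>h\<close>, and for \<open>a > 0\<close> its reciprocal, that is
  singular; a quotient \<open>f / h\<close> need be neither bounded nor square integrable, and must
  be regularised before Cauchy's formula applies to it. The range \<open>0 < H < 1\<close> is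
  \<open>\<bar>a\<bar> < 1 / 2\<close>, the range in which
  \<open>\<bar>x\<bar> powr (2 * a) / (1 + x\<^sup>2)\<close> is integrable. Hardy functions are
  given by bounds on horizontal lines and an \<open>L2\<close> boundary limit. The main tool drawn
  from this is Cauchy's formula with boundary data, together with the vanishing of the Cauchy
  integral in the lower half-plane; no Fourier description of the space enters. The two halves
  combine to the Poisson integral, whose contractivity makes \<open>H2_plus\<close> closed. In the
  uniqueness part \<open>u\<close> lives on the line only. Outerness of both \<open>g\<close> and
  \<open>h\<close> is what replaces an analytic continuation of \<open>u\<close>: it turns
  multiplication by \<open>u\<close> and by its conjugate into maps of the Hardy space.\<close>

definition l2_norm :: "(real \<Rightarrow> complex) \<Rightarrow> real" where
  "l2_norm f = sqrt (\<integral>x. (cmod (f x))\<^sup>2 \<partial>lborel)"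

lemma L2_iff:
  "f \<in> L2 \<longleftrightarrow> f \<in> borel_measurable lborel \<and> integrable lborel (\<lambda>x. (cmod (f x))\<^sup>2)"
  unfolding L2_def L2_norm_sq_def integrable_iff_bounded by auto

lemma L2_integrable_sq: "f \<in> L2 \<Longrightarrow> integrable lborel (\<lambda>x. (cmod (f x))\<^sup>2)"
  by (simp add: L2_iff)

lemma l2_norm_nonneg [simp]: "0 \<le> l2_norm f"
  by (simp add: l2_norm_def)

lemma l2_norm_power2: "(l2_norm f)\<^sup>2 = (\<integral>x. (cmod (f x))\<^sup>2 \<partial>lborel)"
  by (simp add: l2_norm_def)

lemma L2_norm_sq_eq: "f \<in> L2 \<Longrightarrow> L2_norm_sq f = ennreal ((l2_norm f)\<^sup>2)"
  unfolding L2_norm_sq_def l2_norm_power2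
  by (rule nn_integral_eq_integral) (auto simp: L2_iff)

lemma L2_norm_sq_le_iff:
  assumes "f \<in> L2" "0 \<le> c"
  shows "L2_norm_sq f \<le> ennreal (c\<^sup>2) \<longleftrightarrow> l2_norm f \<le> c"
  using assms by (simp add: L2_norm_sq_eq)

lemma L2I_le:
  assumes "f \<in> borel_measurable lborel" "L2_norm_sq f \<le> ennreal M"
  shows "f \<in> L2"
  using assms unfolding L2_def by (auto simp: le_less_trans)

lemma L2_dominated:
  assumes "k \<in> L2" "f \<in> borel_measurable lborel" "AE x in lborel. cmod (f x) \<le> cmod (k x)"
  shows "f \<in> L2" "l2_norm f \<le> l2_norm k"
proof -
  have ae: "AE x in lborel. (cmod (f x))\<^sup>2 \<le> (cmod (k x))\<^sup>2"
    using assms(3) by eventually_elim (simp add: power_mono)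
  have "integrable lborel (\<lambda>x. (cmod (f x))\<^sup>2)"
    by (rule Bochner_Integration.integrable_bound[OF L2_integrable_sq[OF assms(1)]])
       (use assms(2) ae in auto)
  then show "f \<in> L2" using assms(2) by (simp add: L2_iff)
  then show "l2_norm f \<le> l2_norm k"
    unfolding l2_norm_def using ae assms(1)
    by (auto intro!: integral_mono_AE L2_integrable_sq)
qed

lemma L2_scale:
  assumes "f \<in> L2"
  shows "(\<lambda>x. c * f x) \<in> L2" "l2_norm (\<lambda>x. c * f x) = cmod c * l2_norm f"
proof -
  have [measurable]: "f \<in> borel_measurable lborel" using assms by (simp add: L2_iff)
  show "(\<lambda>x. c * f x) \<in> L2"
    using L2_integrable_sq[OF assms] by (auto simp: L2_iff norm_mult power_mult_distrib)
  show "l2_norm (\<lambda>x. c * f x) = cmod c * l2_norm f"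
    unfolding l2_norm_def by (simp add: norm_mult power_mult_distrib real_sqrt_mult)
qed

lemma borel_measurable_cnj:
  assumes "f \<in> borel_measurable M"
  shows "(\<lambda>x. cnj (f x)) \<in> borel_measurable M"
  using measurable_compose[OF assms borel_measurable_continuous_onI[OF continuous_on_cnj[OF continuous_on_id]]]
  by simp

lemma L2_cnj: "(\<lambda>x. cnj (f x)) \<in> L2 \<longleftrightarrow> f \<in> L2"
proof -
  have "(\<lambda>x. cnj (f x)) \<in> borel_measurable lborel \<longleftrightarrow> f \<in> borel_measurable lborel"
  proof
    assume "(\<lambda>x. cnj (f x)) \<in> borel_measurable lborel"
    from borel_measurable_cnj[OF this] show "f \<in> borel_measurable lborel"
      unfolding complex_cnj_cnj .
  qed (rule borel_measurable_cnj)
  then show ?thesis by (simp only: L2_iff complex_mod_cnj)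
qed

lemma L2_norm_sq_cnj: "L2_norm_sq (\<lambda>x. cnj (f x)) = L2_norm_sq f"
  by (simp add: L2_norm_sq_def)

lemma L2_add:
  assumes "f \<in> L2" "g \<in> L2"
  shows "(\<lambda>x. f x + g x) \<in> L2"
proof -
  have [measurable]: "f \<in> borel_measurable lborel" "g \<in> borel_measurable lborel"
    using assms by (auto simp: L2_iff)
  have "(cmod (f x + g x))\<^sup>2 \<le> 2 * (cmod (f x))\<^sup>2 + 2 * (cmod (g x))\<^sup>2" for x
  proof -
    have "(cmod (f x + g x))\<^sup>2 \<le> (cmod (f x) + cmod (g x))\<^sup>2"
      by (simp add: norm_triangle_ineq power_mono)
    also have "\<dots> \<le> 2 * (cmod (f x))\<^sup>2 + 2 * (cmod (g x))\<^sup>2"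
      using zero_le_power2[of "cmod (f x) - cmod (g x)"] by (simp add: power2_eq_square algebra_simps)
    finally show ?thesis .
  qed
  then have "integrable lborel (\<lambda>x. (cmod (f x + g x))\<^sup>2)"
    by (intro Bochner_Integration.integrable_bound[where g = "\<lambda>x. (cmod (f x + g x))\<^sup>2"
          and f = "\<lambda>x. 2 * (cmod (f x))\<^sup>2 + 2 * (cmod (g x))\<^sup>2"])
       (auto intro!: L2_integrable_sq assms)
  then show ?thesis by (simp add: L2_iff)
qed

lemma L2_diff:
  assumes "f \<in> L2" "g \<in> L2"
  shows "(\<lambda>x. f x - g x) \<in> L2"
  using L2_add[OF assms(1) L2_scale(1)[OF assms(2), of "-1"]] by simp

lemma L2_zero: "(\<lambda>x. 0) \<in> L2"
  by (simp add: L2_iff)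

lemma L2_sum: "(\<And>i. i \<in> T \<Longrightarrow> f i \<in> L2) \<Longrightarrow> (\<lambda>x. \<Sum>i\<in>T. f i x) \<in> L2"
  by (induction T rule: infinite_finite_induct) (auto simp: L2_zero L2_add)

section \<open>Inner products: the Cauchy-Schwarz and triangle inequalities\<close>

lemma mult_le_sum_squares:
  fixes a b :: real
  assumes "0 \<le> a" "0 \<le> b"
  shows "a * b \<le> a\<^sup>2 + b\<^sup>2"
  using sum_squares_bound[of a b] mult_nonneg_nonneg[OF assms] by linarith

lemma L2_mult_integrable:
  assumes "f \<in> L2" "g \<in> L2"
  shows "integrable lborel (\<lambda>x. f x * g x)"
proof -
  have [measurable]: "f \<in> borel_measurable lborel" "g \<in> borel_measurable lborel"
    using assms by (auto simp: L2_iff)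
  have "cmod (f x * g x) \<le> (cmod (f x))\<^sup>2 + (cmod (g x))\<^sup>2" for x
    by (simp add: norm_mult mult_le_sum_squares)
  then show ?thesis
    by (intro Bochner_Integration.integrable_bound[where g = "\<lambda>x. f x * g x"
          and f = "\<lambda>x. (cmod (f x))\<^sup>2 + (cmod (g x))\<^sup>2"])
       (auto intro!: L2_integrable_sq assms)
qed

lemma L2_cauchy_schwarz:
  assumes "f \<in> L2" "g \<in> L2"
  shows "(\<integral>x. cmod (f x) * cmod (g x) \<partial>lborel) \<le> l2_norm f * l2_norm g"
    and "cmod (\<integral>x. f x * g x \<partial>lborel) \<le> l2_norm f * l2_norm g"
proof -
  have i: "integrable lborel (\<lambda>x. cmod (f x) * cmod (g x))"
    using L2_mult_integrable[OF assms, THEN integrable_norm] by (simp add: norm_mult)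
  let ?I = "\<integral>x. cmod (f x) * cmod (g x) \<partial>lborel"
  \<comment> \<open>Expanding the nonnegative integral of
    \<open>(cmod (f x) * s - cmod (g x))\<^sup>2\<close> gives a quadratic in \<open>s\<close>; its
    value at the minimum \<open>s = ?I / (l2_norm f)\<^sup>2\<close> is the inequality.\<close>
  have q: "0 \<le> (l2_norm f)\<^sup>2 * s\<^sup>2 - 2 * ?I * s + (l2_norm g)\<^sup>2" for s :: real
  proof -
    have "0 \<le> (\<integral>x. (cmod (f x) * s - cmod (g x))\<^sup>2 \<partial>lborel)" by simp
    also have "(\<lambda>x. (cmod (f x) * s - cmod (g x))\<^sup>2) =
       (\<lambda>x. s\<^sup>2 * (cmod (f x))\<^sup>2 - 2 * s * (cmod (f x) * cmod (g x)) + (cmod (g x))\<^sup>2)"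
      by (auto simp: power2_eq_square algebra_simps)
    also have "(\<integral>x. s\<^sup>2 * (cmod (f x))\<^sup>2 - 2 * s * (cmod (f x) * cmod (g x)) + (cmod (g x))\<^sup>2 \<partial>lborel)
       = s\<^sup>2 * (l2_norm f)\<^sup>2 - 2 * s * ?I + (l2_norm g)\<^sup>2"
      using i assms by (simp add: l2_norm_power2 L2_integrable_sq)
    finally show ?thesis by (simp add: algebra_simps)
  qed
  have I0: "0 \<le> ?I" by simp
  show 1: "?I \<le> l2_norm f * l2_norm g"
  proof (cases "l2_norm f = 0")
    case True
    \<comment> \<open>Here the quadratic degenerates to an affine function of \<open>s\<close> with
      slope \<open>- 2 * ?I\<close>; a positive \<open>?I\<close> would make it negative for large
      \<open>s\<close>.\<close>
    have "?I \<le> 0"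
    proof (rule ccontr)
      assume "\<not> ?I \<le> 0"
      then have "2 * ?I * (((l2_norm g)\<^sup>2 + 1) / ?I) = 2 * ((l2_norm g)\<^sup>2 + 1)"
        by (simp add: field_simps)
      then have "0 \<le> - 2 * ((l2_norm g)\<^sup>2 + 1) + (l2_norm g)\<^sup>2"
        using q[of "((l2_norm g)\<^sup>2 + 1) / ?I"] True by simp
      then show False by (smt (verit) zero_le_power2)
    qed
    then show ?thesis by (simp add: True)
  next
    case False
    then have "l2_norm f > 0" using l2_norm_nonneg[of f] by linarith
    have "?I\<^sup>2 \<le> (l2_norm f * l2_norm g)\<^sup>2"
      using q[of "?I / (l2_norm f)\<^sup>2"] \<open>l2_norm f > 0\<close>
      by (simp add: field_simps power2_eq_square power4_eq_xxxx)
    then show ?thesis by (rule power2_le_imp_le) simp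
  qed
  have "cmod (\<integral>x. f x * g x \<partial>lborel) \<le> (\<integral>x. cmod (f x * g x) \<partial>lborel)"
    by (rule integral_norm_bound)
  then show "cmod (\<integral>x. f x * g x \<partial>lborel) \<le> l2_norm f * l2_norm g"
    using 1 by (simp add: norm_mult)
qed

lemma l2_norm_triangle:
  assumes "f \<in> L2" "g \<in> L2"
  shows "l2_norm (\<lambda>x. f x + g x) \<le> l2_norm f + l2_norm g"
proof (rule power2_le_imp_le)
  have i: "integrable lborel (\<lambda>x. cmod (f x) * cmod (g x))"
    using L2_mult_integrable[OF assms, THEN integrable_norm] by (simp add: norm_mult)
  have "(l2_norm (\<lambda>x. f x + g x))\<^sup>2 \<le>
     (\<integral>x. (cmod (f x))\<^sup>2 + 2 * (cmod (f x) * cmod (g x)) + (cmod (g x))\<^sup>2 \<partial>lborel)"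
    unfolding l2_norm_power2
  proof (rule integral_mono)
    fix x
    have "(cmod (f x + g x))\<^sup>2 \<le> (cmod (f x) + cmod (g x))\<^sup>2"
      by (simp add: norm_triangle_ineq power_mono)
    then show "(cmod (f x + g x))\<^sup>2 \<le> (cmod (f x))\<^sup>2 + 2 * (cmod (f x) * cmod (g x)) + (cmod (g x))\<^sup>2"
      by (simp add: power2_eq_square algebra_simps)
  qed (use i assms L2_add[OF assms] in \<open>auto simp: L2_integrable_sq\<close>)
  also have "\<dots> = (l2_norm f)\<^sup>2 + 2 * (\<integral>x. cmod (f x) * cmod (g x) \<partial>lborel) + (l2_norm g)\<^sup>2"
    using i assms by (simp add: l2_norm_power2 L2_integrable_sq)
  also have "\<dots> \<le> (l2_norm f + l2_norm g)\<^sup>2"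
    using L2_cauchy_schwarz(1)[OF assms] by (simp add: power2_eq_square algebra_simps)
  finally show "(l2_norm (\<lambda>x. f x + g x))\<^sup>2 \<le> (l2_norm f + l2_norm g)\<^sup>2" .
qed simp

lemma l2_norm_minus: "l2_norm (\<lambda>x. f x - g x) = l2_norm (\<lambda>x. g x - f x)"
  by (simp add: l2_norm_def norm_minus_commute)

lemma l2_norm_triangle_diff:
  assumes "f \<in> L2" "g \<in> L2" "k \<in> L2"
  shows "l2_norm (\<lambda>x. f x - k x) \<le> l2_norm (\<lambda>x. f x - g x) + l2_norm (\<lambda>x. g x - k x)"
  using l2_norm_triangle[OF L2_diff[OF assms(1,2)] L2_diff[OF assms(2,3)]] by simp

lemma l2_norm_triangle_le:
  assumes "f \<in> L2" "g \<in> L2"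
  shows "l2_norm f \<le> l2_norm g + l2_norm (\<lambda>x. f x - g x)"
  using l2_norm_triangle[OF assms(2) L2_diff[OF assms(1,2)]] by simp

lemma l2_norm_eq_0_AE:
  assumes "f \<in> L2" "l2_norm f = 0"
  shows "AE x in lborel. f x = 0"
proof -
  have "(\<integral>x. (cmod (f x))\<^sup>2 \<partial>lborel) = 0" using assms(2) l2_norm_power2[of f] by simp
  then show ?thesis
    using integral_nonneg_eq_0_iff_AE[OF L2_integrable_sq[OF assms(1)]] by simp
qed

lemma l2_norm_cong_AE:
  assumes "AE x in lborel. cmod (f x) = cmod (g x)" 
    "f \<in> borel_measurable lborel" "g \<in> borel_measurable lborel"
  shows "l2_norm f = l2_norm g"
  unfolding l2_norm_def using assms
  by (intro arg_cong[where f = sqrt] integral_cong_AE) (auto elim: eventually_mono)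

text \<open>Eventual membership in \<open>L2\<close> matters: the Bochner integral defaults to 0, so
  off \<open>L2\<close> the real norm can be 0 while the extended one is infinite.\<close>

lemma L2_norm_sq_tendsto_0_iff:
  assumes "\<forall>\<^sub>F y in F. f y \<in> L2"
  shows "((\<lambda>y. L2_norm_sq (f y)) \<longlongrightarrow> 0) F \<longleftrightarrow> ((\<lambda>y. l2_norm (f y)) \<longlongrightarrow> 0) F"
proof -
  have "((\<lambda>y. L2_norm_sq (f y)) \<longlongrightarrow> 0) F \<longleftrightarrow> ((\<lambda>y. ennreal ((l2_norm (f y))\<^sup>2)) \<longlongrightarrow> ennreal 0) F"
    using assms by (auto intro!: tendsto_cong elim: eventually_mono simp: L2_norm_sq_eq)
  also have "\<dots> \<longleftrightarrow> ((\<lambda>y. (l2_norm (f y))\<^sup>2) \<longlongrightarrow> 0) F"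
    by (subst tendsto_ennreal_iff) auto
  also have "\<dots> \<longleftrightarrow> ((\<lambda>y. l2_norm (f y)) \<longlongrightarrow> 0) F"
    using tendsto_real_sqrt[of "\<lambda>y. (l2_norm (f y))\<^sup>2" 0 F] tendsto_power[of "\<lambda>y. l2_norm (f y)" 0 F 2]
    by auto
  finally show ?thesis .
qed

text \<open>Quantifying over \<open>y\<close> inside the almost-everywhere bound gives one
  exceptional set for all \<open>y\<close>, so the limit \<open>g\<close> inherits the majorant
  \<open>K\<close>.\<close>

lemma L2_dominated_convergence:
  fixes f :: "real \<Rightarrow> real \<Rightarrow> complex"
  assumes g: "g \<in> borel_measurable lborel" and K: "K \<in> L2"
    and f: "\<And>y. 0 < y \<Longrightarrow> y < b \<Longrightarrow> f y \<in> borel_measurable lborel" and "0 < b"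
    and lim: "AE x in lborel. ((\<lambda>y. f y x) \<longlongrightarrow> g x) (at_right 0)"
    and bd: "AE x in lborel. \<forall>y. 0 < y \<longrightarrow> y < b \<longrightarrow> cmod (f y x) \<le> cmod (K x)"
  shows "g \<in> L2" "((\<lambda>y. l2_norm (\<lambda>x. f y x - g x)) \<longlongrightarrow> 0) (at_right 0)"
    "((\<lambda>y. L2_norm_sq (\<lambda>x. f y x - g x)) \<longlongrightarrow> 0) (at_right 0)"
proof -
  have [measurable]: "g \<in> borel_measurable lborel" "K \<in> borel_measurable lborel"
    using g K by (auto simp: L2_iff)
  have gK: "AE x in lborel. cmod (g x) \<le> cmod (K x)"
    using lim bd
  proof eventually_elim
    case (elim x)
    have "\<forall>\<^sub>F y in at_right 0. cmod (f y x) \<le> cmod (K x)"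
      unfolding eventually_at_right_field using elim(2) \<open>0 < b\<close> by blast
    then show ?case
      using tendsto_upperbound[OF tendsto_norm[OF elim(1)]] by (simp add: trivial_limit_at_right_real)
  qed
  show gL: "g \<in> L2" using L2_dominated(1)[OF K g gK] .
  have fL: "f y \<in> L2" if "0 < y" "y < b" for y
    by (rule L2_dominated(1)[OF K f[OF that]]) (use bd that in \<open>auto elim: eventually_mono\<close>)
  have "((\<lambda>y. (l2_norm (\<lambda>x. f y x - g x))\<^sup>2) \<longlongrightarrow> 0) (at_right 0)"
    unfolding l2_norm_power2
  \<comment> \<open>Dominated convergence concerns sequences; for a limit at 0 from the right it
    suffices to test sequences in the interval from 0 to \<open>b\<close>.\<close>
  proof (rule tendsto_at_right_sequentially[OF \<open>0 < b\<close>])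
    fix S :: "nat \<Rightarrow> real"
    assume S: "\<And>n. 0 < S n" "\<And>n. S n < b" "S \<longlonglongrightarrow> 0"
    have Sr: "filterlim S (at_right 0) sequentially"
      using S by (auto simp: filterlim_at less_imp_neq[symmetric] intro!: eventuallyI)
    have [measurable]: "f (S n) \<in> borel_measurable lborel" for n using f S by auto
    have "(\<lambda>n. \<integral>x. (cmod (f (S n) x - g x))\<^sup>2 \<partial>lborel) \<longlonglongrightarrow> (\<integral>x. 0 \<partial>(lborel :: real measure))"
    proof (rule integral_dominated_convergence[where w = "\<lambda>x. 4 * (cmod (K x))\<^sup>2"])
      show "AE x in lborel. (\<lambda>n. (cmod (f (S n) x - g x))\<^sup>2) \<longlonglongrightarrow> 0"
        using lim
      proof eventually_elim
        case (elim x)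
        have "(\<lambda>n. f (S n) x) \<longlonglongrightarrow> g x" by (rule filterlim_compose[OF elim Sr])
        then have "(\<lambda>n. (cmod (f (S n) x - g x))\<^sup>2) \<longlonglongrightarrow> (cmod (g x - g x))\<^sup>2"
          by (intro tendsto_intros)
        then show ?case by simp
      qed
      show "AE x in lborel. norm ((cmod (f (S n) x - g x))\<^sup>2) \<le> 4 * (cmod (K x))\<^sup>2" for n
        using gK bd
      proof eventually_elim
        case (elim x)
        then have "cmod (f (S n) x) \<le> cmod (K x)" using S by blast
        then have "cmod (f (S n) x - g x) \<le> 2 * cmod (K x)"
          using norm_triangle_ineq4[of "f (S n) x" "g x"] elim(1) by linarith
        then have "(cmod (f (S n) x - g x))\<^sup>2 \<le> (2 * cmod (K x))\<^sup>2"
          by (intro power_mono) auto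
        then show ?case by simp
      qed
    qed (use L2_integrable_sq[OF K] in auto)
    then show "(\<lambda>n. \<integral>x. (cmod (f (S n) x - g x))\<^sup>2 \<partial>lborel) \<longlonglongrightarrow> 0" by simp
  qed
  from tendsto_real_sqrt[OF this]
  show *: "((\<lambda>y. l2_norm (\<lambda>x. f y x - g x)) \<longlongrightarrow> 0) (at_right 0)" by simp
  have "\<forall>\<^sub>F y in at_right 0. (\<lambda>x. f y x - g x) \<in> L2"
    unfolding eventually_at_right_field using fL gL L2_diff \<open>0 < b\<close> by blast
  then show "((\<lambda>y. L2_norm_sq (\<lambda>x. f y x - g x)) \<longlongrightarrow> 0) (at_right 0)"
    using * by (simp add: L2_norm_sq_tendsto_0_iff)
qed

section \<open>The Cauchy and Poisson kernels on the line\<close>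

lemma nn_integral_inverse_1_plus_square:
  "(\<integral>\<^sup>+x. ennreal (inverse (1 + x\<^sup>2)) \<partial>lborel) = ennreal pi"
proof -
  have i: "integrable lborel (\<lambda>x::real. inverse (1 + x\<^sup>2))"
    using integrable_inverse_1_plus_square by (simp add: set_integrable_def)
  have "(\<integral>x. inverse (1 + x\<^sup>2) \<partial>lborel) = pi"
    using LBINT_inverse_1_plus_square
    by (simp add: interval_lebesgue_integral_def set_lebesgue_integral_def)
  then show ?thesis using nn_integral_eq_integral[OF i] by simp
qed

text \<open>The substitution \<open>x = Re w + Im w * s\<close> reduces the kernel to a multiple of
  \<open>1 / (1 + s\<^sup>2)\<close>; the absolute value admits poles on either side of the
  line.\<close>

lemma has_bochner_integral_poisson_kernel:
  assumes "Im w \<noteq> 0"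
  shows "has_bochner_integral lborel (\<lambda>x. 1 / (cmod (of_real x - w))\<^sup>2) (pi / \<bar>Im w\<bar>)"
proof (rule has_bochner_integral_nn_integral)
  have "(\<integral>\<^sup>+x. ennreal (1 / (cmod (of_real x - w))\<^sup>2) \<partial>lborel) =
    ennreal \<bar>Im w\<bar> * (\<integral>\<^sup>+x. ennreal (1 / (cmod (of_real (Re w + Im w * x) - w))\<^sup>2) \<partial>lborel)"
    using assms by (intro nn_integral_real_affine) auto
  also have "(\<lambda>x. 1 / (cmod (of_real (Re w + Im w * x) - w))\<^sup>2) = (\<lambda>x. inverse ((Im w)\<^sup>2) * inverse (1 + x\<^sup>2))"
  proof
    fix x :: real
    have "(cmod (of_real (Re w + Im w * x) - w))\<^sup>2 = (Im w)\<^sup>2 * (1 + x\<^sup>2)"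
      by (simp add: cmod_power2 power_mult_distrib algebra_simps)
    then show "1 / (cmod (of_real (Re w + Im w * x) - w))\<^sup>2 = inverse ((Im w)\<^sup>2) * inverse (1 + x\<^sup>2)"
      by (simp add: divide_inverse)
  qed
  also have "(\<integral>\<^sup>+x. ennreal (inverse ((Im w)\<^sup>2) * inverse (1 + x\<^sup>2)) \<partial>lborel) = ennreal (inverse ((Im w)\<^sup>2)) * ennreal pi"
    by (simp add: ennreal_mult nn_integral_cmult nn_integral_inverse_1_plus_square)
  also have "ennreal \<bar>Im w\<bar> * (ennreal (inverse ((Im w)\<^sup>2)) * ennreal pi) = ennreal (pi / \<bar>Im w\<bar>)"
    using assms by (simp add: ennreal_mult[symmetric] divide_simps power2_eq_square abs_mult_self_eq)
  finally show "(\<integral>\<^sup>+x. ennreal (1 / (cmod (of_real x - w))\<^sup>2) \<partial>lborel) = ennreal (pi / \<bar>Im w\<bar>)" .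
qed auto

lemma L2_cauchy_kernel:
  assumes "Im w \<noteq> 0"
  shows "(\<lambda>x. 1 / (of_real x - w)) \<in> L2" "(l2_norm (\<lambda>x. 1 / (of_real x - w)))\<^sup>2 = pi / \<bar>Im w\<bar>"
  using has_bochner_integral_poisson_kernel[OF assms]
  by (auto simp: L2_iff l2_norm_power2 norm_divide power_divide has_bochner_integral_iff)

section \<open>Cauchy's formula in the upper half-plane\<close>

lemma has_contour_integral_linepath_same_Im_iff:
  assumes "a < b"
  shows "(f has_contour_integral I) (linepath (Complex a c) (Complex b c)) \<longleftrightarrow>
    ((\<lambda>x. f (Complex x c)) has_integral I) {a..b}"
proof -
  have "(f has_contour_integral I) (linepath (Complex a c) (Complex b c)) \<longleftrightarrow>
      ((\<lambda>x. f (linepath (Complex a c) (Complex b c) x) * (Complex b c - Complex a c)) has_integral I) {0..1}"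
    by (subst has_contour_integral_linepath) simp_all
  also have "\<dots> \<longleftrightarrow> ((\<lambda>x. f (Complex (a + (b - a) * x) c) * of_real (b - a)) has_integral I) {0..1}"
    by (intro has_integral_cong arg_cong2[of _ _ _ _ "(*)"] arg_cong[of _ _ f])
       (auto simp: linepath_def complex_eq_iff algebra_simps)
  also have "{0..1} = (\<lambda>x. x / (b - a)) ` {0..b-a}"
    using assms by simp
  also have "((\<lambda>x. f (Complex (a + (b - a) * x) c) * of_real (b - a)) has_integral I) \<dots> \<longleftrightarrow>
      ((\<lambda>x. f (Complex (a + x) c) * of_real (b - a)) has_integral ((b - a) *\<^sub>R I)) {0..b-a}"
    by (subst has_integral_stretch_real_iff) (use assms in simp_all)
  also have "\<dots> \<longleftrightarrow> ((\<lambda>x. of_real (b - a) * f (Complex x c)) has_integral (b - a) *\<^sub>R I) {a..b}"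
    by (subst has_integral_shift_real_ivl_iff[where c = "-a"])
       (simp_all add: scaleR_conv_of_real mult_ac)
  also have "\<dots> \<longleftrightarrow> ((\<lambda>x. f (Complex x c)) has_integral I) {a..b}"
    by (subst has_integral_mult_right_iff) (use assms in \<open>auto simp: scaleR_conv_of_real\<close>)
  finally show ?thesis .
qed

lemma has_contour_integral_rectpath_eq:
  assumes c: "(f has_contour_integral c) (rectpath (Complex a y1) (Complex b y2))" and "a < b" "y1 < y2"
  shows "c = integral {a..b} (\<lambda>x. f (Complex x y1)) + \<i> * integral {y1..y2} (\<lambda>y. f (Complex b y))
    - integral {a..b} (\<lambda>x. f (Complex x y2)) - \<i> * integral {y1..y2} (\<lambda>y. f (Complex a y))"
proof -
  let ?a1 = "Complex a y1" and ?a2 = "Complex b y1" and ?a3 = "Complex b y2" and ?a4 = "Complex a y2"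
  have "f contour_integrable_on (linepath ?a1 ?a2 +++ linepath ?a2 ?a3 +++ linepath ?a3 ?a4 +++ linepath ?a4 ?a1)"
    using c by (auto simp: contour_integrable_on_def rectpath_def Let_def)
  then have i: "f contour_integrable_on linepath ?a1 ?a2" "f contour_integrable_on linepath ?a2 ?a3"
     "f contour_integrable_on linepath ?a3 ?a4" "f contour_integrable_on linepath ?a4 ?a1"
    by simp_all
  have c: "c = contour_integral (linepath ?a1 ?a2) f + (contour_integral (linepath ?a2 ?a3) f +
     (contour_integral (linepath ?a3 ?a4) f + contour_integral (linepath ?a4 ?a1) f))"
    using contour_integral_unique[OF c] i by (simp add: rectpath_def Let_def)
  have "(f has_contour_integral contour_integral (linepath ?a1 ?a2) f) (linepath ?a1 ?a2)"
    using i(1) by (rule has_contour_integral_integral)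
  then have 1: "contour_integral (linepath ?a1 ?a2) f = integral {a..b} (\<lambda>x. f (Complex x y1))"
    using \<open>a < b\<close> by (simp add: has_contour_integral_linepath_same_Im_iff integral_unique)
  \<comment> \<open>\<open>rectpath\<close> runs along the upper side from right to left, so it is
    the reversed segment that has the increasing parametrisation; the left side below is treated
    alike.\<close>
  have "(f has_contour_integral - contour_integral (linepath ?a3 ?a4) f) (linepath ?a4 ?a3)"
    using i(3) by (intro has_contour_integral_reverse_linepath has_contour_integral_integral)
  then have 3: "- contour_integral (linepath ?a3 ?a4) f = integral {a..b} (\<lambda>x. f (Complex x y2))"
    using \<open>a < b\<close> by (simp add: has_contour_integral_linepath_same_Im_iff integral_unique)
  have 2: "contour_integral (linepath ?a2 ?a3) f = \<i> * integral {y1..y2} (\<lambda>y. f (Complex b y))"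
    using \<open>y1 < y2\<close> by (intro contour_integral_linepath_same_Re) auto
  have "(f has_contour_integral - contour_integral (linepath ?a4 ?a1) f) (linepath ?a1 ?a4)"
    using i(4) by (intro has_contour_integral_reverse_linepath has_contour_integral_integral)
  then have "((\<lambda>y. f (Complex a y)) has_integral (- \<i> * - contour_integral (linepath ?a4 ?a1) f)) {y1..y2}"
    using \<open>y1 < y2\<close> by (subst (asm) has_contour_integral_linepath_same_Re_iff) auto
  then have 4: "contour_integral (linepath ?a4 ?a1) f = - \<i> * integral {y1..y2} (\<lambda>y. f (Complex a y))"
    by (simp add: integral_unique)
  show ?thesis unfolding c 1 2 4 3[symmetric] by (simp add: algebra_simps)
qed

lemma tendsto_integral_symmetric_interval:
  fixes f :: "real \<Rightarrow> complex"
  assumes "integrable lborel f"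
  shows "((\<lambda>R. integral {-R..R} f) \<longlongrightarrow> (\<integral>x. f x \<partial>lborel)) at_top"
proof -
  have [measurable]: "f \<in> borel_measurable lborel" using assms by auto
  have "integral {-R..R} f = (\<integral>x. indicator {-R..R} x *\<^sub>R f x \<partial>lborel)" for R
    using set_borel_integral_eq_integral(2)[of "{-R..R}" f] integrable_mult_indicator[OF _ assms, of "{-R..R}"]
    by (simp add: set_integrable_def set_lebesgue_integral_def)
  moreover have "((\<lambda>R. \<integral>x. indicator {-R..R} x *\<^sub>R f x \<partial>lborel) \<longlongrightarrow> (\<integral>x. f x \<partial>lborel)) at_top"
  proof (rule integral_dominated_convergence_at_top[where w = "\<lambda>x. norm (f x)"])
    show "AE x in lborel. ((\<lambda>R. indicator {-R..R} x *\<^sub>R f x) \<longlongrightarrow> f x) at_top"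
    proof (rule AE_I2, rule tendsto_eventually)
      fix x :: real
      show "\<forall>\<^sub>F R in at_top. indicator {-R..R} x *\<^sub>R f x = f x"
        using eventually_ge_at_top[of "\<bar>x\<bar>"] by eventually_elim (auto simp: indicator_def)
    qed
  qed (use assms in \<open>auto simp: indicator_def intro!: always_eventually AE_I2\<close>)
  ultimately show ?thesis by simp
qed

text \<open>
  The vertical sides contribute nothing in the limit: otherwise their contribution would be bounded
  below for all large \<open>R\<close>, although by Tonelli it is integrable over \<open>R\<close>.
\<close>

lemma rectangle_limit:
  fixes \<Phi> :: "complex \<Rightarrow> complex"
  assumes "y1 < y2" "0 < r"
    and cont: "continuous_on {z. r \<le> \<bar>Re z\<bar> \<and> y1 \<le> Im z \<and> Im z \<le> y2} \<Phi>"
    and int: "integrable lborel (\<lambda>x. \<Phi> (Complex x y1))" "integrable lborel (\<lambda>x. \<Phi> (Complex x y2))"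
    and side: "\<And>y. y1 \<le> y \<Longrightarrow> y \<le> y2 \<Longrightarrow>
      (\<integral>\<^sup>+x. ennreal (cmod (\<Phi> (Complex x y))) * indicator {x. r \<le> \<bar>x\<bar>} x \<partial>lborel) \<le> ennreal B"
    and contour: "\<And>R. r \<le> R \<Longrightarrow>
      (\<Phi> has_contour_integral c) (rectpath (Complex (-R) y1) (Complex R y2))"
  shows "(\<integral>x. \<Phi> (Complex x y1) \<partial>lborel) - (\<integral>x. \<Phi> (Complex x y2) \<partial>lborel) = c"
proof (rule ccontr)
  let ?D = "{p :: real \<times> real. r \<le> \<bar>fst p\<bar> \<and> y1 \<le> snd p \<and> snd p \<le> y2}"
  define L where "L = (\<integral>x. \<Phi> (Complex x y1) \<partial>lborel) - (\<integral>x. \<Phi> (Complex x y2) \<partial>lborel) - c"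
  assume "(\<integral>x. \<Phi> (Complex x y1) \<partial>lborel) - (\<integral>x. \<Phi> (Complex x y2) \<partial>lborel) \<noteq> c"
  then have L: "0 < cmod L" by (simp add: L_def)
  \<comment> \<open>Extension by zero outside the closed set \<open>?D\<close> makes the integrand
    Borel measurable on the whole plane, as Tonelli requires.\<close>
  define N where "N = (\<lambda>p. ennreal (cmod (indicator ?D p *\<^sub>R \<Phi> (Complex (fst p) (snd p)))))"
  have "closed ?D"
    by (intro closed_Collect_conj closed_Collect_le continuous_intros)
  then have D: "?D \<in> sets borel" by auto
  have "continuous_on ?D (\<lambda>p. \<Phi> (Complex (fst p) (snd p)))"
    by (rule continuous_on_compose2[OF cont]) (auto intro!: continuous_intros)
  then have "(\<lambda>p. indicator ?D p *\<^sub>R \<Phi> (Complex (fst p) (snd p))) \<in> borel_measurable borel"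
    by (rule borel_measurable_continuous_on_indicator[OF D])
  then have N1: "N \<in> borel_measurable borel"
    unfolding N_def by measurable
  then have [measurable]: "N \<in> borel_measurable (lborel \<Otimes>\<^sub>M lborel)"
    unfolding measurable_lborel1 lborel_prod by simp
  define s where "s x = (\<integral>\<^sup>+y. N (x, y) \<partial>lborel)" for x
  have [measurable]: "s \<in> borel_measurable lborel" unfolding s_def by measurable
  have "(\<integral>\<^sup>+x. s x \<partial>lborel) = (\<integral>\<^sup>+y. (\<integral>\<^sup>+x. N (x, y) \<partial>lborel) \<partial>lborel)"
    unfolding s_def by (rule lborel_pair.Fubini'[symmetric]) measurable
  also have "\<dots> \<le> (\<integral>\<^sup>+y. ennreal B * indicator {y1..y2} y \<partial>lborel)"
  proof (rule nn_integral_mono)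
    fix y :: real
    show "(\<integral>\<^sup>+x. N (x, y) \<partial>lborel) \<le> ennreal B * indicator {y1..y2} y"
    proof (cases "y \<in> {y1..y2}")
      case True
      have "(\<integral>\<^sup>+x. N (x, y) \<partial>lborel) = (\<integral>\<^sup>+x. ennreal (cmod (\<Phi> (Complex x y))) * indicator {x. r \<le> \<bar>x\<bar>} x \<partial>lborel)"
        using True by (intro nn_integral_cong) (auto simp: N_def indicator_def)
      then show ?thesis using side[of y] True by simp
    next
      case False
      then have "N (x, y) = 0" for x by (auto simp: N_def indicator_def)
      then show ?thesis by simp
    qed
  qed
  also have "\<dots> = ennreal B * ennreal (y2 - y1)"
    using \<open>y1 < y2\<close> by (simp add: nn_integral_cmult)
  also have "\<dots> < \<infinity>" by (simp add: ennreal_mult_less_top)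
  finally have fin: "(\<integral>\<^sup>+x. s x \<partial>lborel) < \<infinity>" .
  \<comment> \<open>Left and right sides occur together, so \<open>s x + s (- x)\<close> is the
    quantity to control.\<close>
  have fin': "(\<integral>\<^sup>+x. s x + s (- x) \<partial>lborel) < \<infinity>"
  proof -
    have "(\<integral>\<^sup>+x. s (- x) \<partial>lborel) = (\<integral>\<^sup>+x. s x \<partial>lborel)"
      using nn_integral_real_affine[of s "-1" 0] by simp
    then show ?thesis using fin by (simp add: nn_integral_add)
  qed
  have vert: "ennreal (cmod (integral {y1..y2} (\<lambda>y. \<Phi> (Complex x y)))) \<le> s x" if "r \<le> \<bar>x\<bar>" for x
  proof -
    have cy: "continuous_on {y1..y2} (\<lambda>y. \<Phi> (Complex x y))"
      using that by (intro continuous_on_compose2[OF cont]) (auto intro!: continuous_intros)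
    have si: "set_integrable lborel {y1..y2} (\<lambda>y. \<Phi> (Complex x y))"
      by (rule borel_integrable_atLeastAtMost'[OF cy])
    have "integral {y1..y2} (\<lambda>y. \<Phi> (Complex x y)) = (\<integral>y. indicator {y1..y2} y *\<^sub>R \<Phi> (Complex x y) \<partial>lborel)"
      using set_borel_integral_eq_integral(2)[OF si] by (simp add: set_lebesgue_integral_def)
    then have "ennreal (cmod (integral {y1..y2} (\<lambda>y. \<Phi> (Complex x y))))
        \<le> ennreal (\<integral>y. cmod (indicator {y1..y2} y *\<^sub>R \<Phi> (Complex x y)) \<partial>lborel)"
      by (simp only:) (intro ennreal_leI integral_norm_bound)
    also have "\<dots> = (\<integral>\<^sup>+y. ennreal (cmod (indicator {y1..y2} y *\<^sub>R \<Phi> (Complex x y))) \<partial>lborel)"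
      using si unfolding set_integrable_def
      by (intro nn_integral_eq_integral[symmetric] integrable_norm) auto
    also have "\<dots> = s x"
      unfolding s_def N_def using that by (intro nn_integral_cong) (auto simp: indicator_def)
    finally show ?thesis .
  qed
  have lim: "((\<lambda>R. integral {-R..R} (\<lambda>x. \<Phi> (Complex x y1)) - integral {-R..R} (\<lambda>x. \<Phi> (Complex x y2)) - c) \<longlongrightarrow> L) at_top"
    unfolding L_def by (intro tendsto_intros tendsto_integral_symmetric_interval int)
  have "\<forall>\<^sub>F R in at_top. cmod L / 2 < cmod (integral {-R..R} (\<lambda>x. \<Phi> (Complex x y1)) - integral {-R..R} (\<lambda>x. \<Phi> (Complex x y2)) - c)"
    using order_tendstoD(1)[OF tendsto_norm[OF lim], of "cmod L / 2"] L by simp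
  then obtain R1 where R1: "\<And>R. R1 \<le> R \<Longrightarrow> cmod L / 2 < cmod (integral {-R..R} (\<lambda>x. \<Phi> (Complex x y1)) - integral {-R..R} (\<lambda>x. \<Phi> (Complex x y2)) - c)"
    by (auto simp: eventually_at_top_linorder)
  define R2 where "R2 = max r R1"
  have low: "ennreal (cmod L / 2) \<le> s R + s (- R)" if "R2 \<le> R" for R
  proof -
    let ?v = "\<lambda>x. integral {y1..y2} (\<lambda>y. \<Phi> (Complex x y))"
    have R: "r \<le> R" "R1 \<le> R" "0 < R" using that \<open>0 < r\<close> by (auto simp: R2_def)
    have "integral {-R..R} (\<lambda>x. \<Phi> (Complex x y1)) - integral {-R..R} (\<lambda>x. \<Phi> (Complex x y2)) - c
       = \<i> * ?v (-R) - \<i> * ?v R"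
      using has_contour_integral_rectpath_eq[OF contour[OF R(1)]] R \<open>y1 < y2\<close> by (simp add: algebra_simps)
    then have "cmod L / 2 \<le> cmod (\<i> * ?v (-R) - \<i> * ?v R)"
      using R1[OF R(2)] by simp
    also have "\<dots> \<le> cmod (?v R) + cmod (?v (-R))"
      using norm_triangle_ineq4[of "\<i> * ?v (-R)" "\<i> * ?v R"] by (simp add: norm_mult)
    finally have "ennreal (cmod L / 2) \<le> ennreal (cmod (?v R)) + ennreal (cmod (?v (-R)))"
      by (simp add: ennreal_plus[symmetric] ennreal_leI del: ennreal_plus)
    also have "\<dots> \<le> s R + s (-R)"
      using R by (intro add_mono vert) auto
    finally show ?thesis .
  qed
  \<comment> \<open>A positive constant has infinite integral over a half-line, which contradicts
    \<open>fin'\<close>.\<close>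
  have "(\<integral>\<^sup>+x. ennreal (cmod L / 2) * indicator {R2..} x \<partial>lborel) \<le> (\<integral>\<^sup>+x. s x + s (- x) \<partial>lborel)"
    using low by (intro nn_integral_mono) (auto simp: indicator_def)
  moreover have "(\<integral>\<^sup>+x. ennreal (cmod L / 2) * indicator {R2..} x \<partial>lborel) = \<infinity>"
  proof -
    have "emeasure lborel {R2..} = \<infinity>"
    proof (rule ccontr)
      assume "emeasure lborel {R2..} \<noteq> \<infinity>"
      then obtain m where m: "emeasure lborel {R2..} = ennreal m" "0 \<le> m"
        by (cases "emeasure lborel {R2..}") auto
      have "emeasure lborel {R2..R2 + m + 1} \<le> emeasure lborel {R2..}"
        by (rule emeasure_mono) auto
      then show False using m by simp
    qed
    then show ?thesis using L by (simp add: nn_integral_cmult_indicator ennreal_mult_eq_top_iff)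
  qed
  ultimately show False using fin' by (simp add: top_unique)
qed

lemma holomorphic_upper_measurable:
  assumes "G holomorphic_on {z. 0 < Im z}" "0 < y"
  shows "continuous_on UNIV (\<lambda>x. G (Complex x y))" "(\<lambda>x. G (Complex x y)) \<in> borel_measurable lborel"
proof -
  show "continuous_on UNIV (\<lambda>x. G (Complex x y))"
    by (rule continuous_on_compose2[OF holomorphic_on_imp_continuous_on[OF assms(1)]])
       (use assms(2) in \<open>auto intro!: continuous_intros\<close>)
  then show "(\<lambda>x. G (Complex x y)) \<in> borel_measurable lborel"
    using borel_measurable_continuous_onI by simp
qed

lemma L2_cauchy_kernel_shift:
  assumes "Im w \<noteq> y"
  shows "(\<lambda>x. 1 / (Complex x y - w)) \<in> L2" "(l2_norm (\<lambda>x. 1 / (Complex x y - w)))\<^sup>2 = pi / \<bar>y - Im w\<bar>"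
proof -
  have *: "(\<lambda>x. 1 / (Complex x y - w)) = (\<lambda>x. 1 / (of_real x - (w - Complex 0 y)))"
    by (intro ext arg_cong[of _ _ "\<lambda>z. 1 / z"]) (simp add: complex_eq_iff)
  have "Im (w - Complex 0 y) \<noteq> 0" "\<bar>Im (w - Complex 0 y)\<bar> = \<bar>y - Im w\<bar>"
    using assms by auto
  then show "(\<lambda>x. 1 / (Complex x y - w)) \<in> L2" "(l2_norm (\<lambda>x. 1 / (Complex x y - w)))\<^sup>2 = pi / \<bar>y - Im w\<bar>"
    unfolding * using L2_cauchy_kernel[of "w - Complex 0 y"] by simp_all
qed

text \<open>Inside the rectangle \<open>w\<close> has winding number 1. If it lies below, the
  half-plane above the height of \<open>w\<close>, intersected with the upper half-plane, is a
  convex set on which the quotient is holomorphic, and Cauchy's theorem applies.\<close>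

lemma rectangle_contour:
  assumes G: "G holomorphic_on {z. 0 < Im z}" and "0 < y1" "y1 < y2" "Im w \<noteq> y1" "Im w < y2"
    and "\<bar>Re w\<bar> < R"
  shows "((\<lambda>z. G z / (z - w)) has_contour_integral (if y1 < Im w then 2 * pi * \<i> * G w else 0))
     (rectpath (Complex (-R) y1) (Complex R y2))"
proof -
  let ?S = "{z. 0 < Im z}"
  have conv: "convex ?S" "open ?S"
    using convex_halfspace_Im_gt[of 0] open_halfspace_Im_gt[of 0] by simp_all
  have sub: "path_image (rectpath (Complex (-R) y1) (Complex R y2)) = 
     cbox (Complex (-R) y1) (Complex R y2) - box (Complex (-R) y1) (Complex R y2)"
    using assms by (intro path_image_rectpath_cbox_minus_box) auto
  have S: "path_image (rectpath (Complex (-R) y1) (Complex R y2)) \<subseteq> ?S"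
    using \<open>0 < y1\<close> unfolding sub by (auto simp: in_cbox_complex_iff)
  show ?thesis
  proof (cases "y1 < Im w")
    case True
    then have b: "w \<in> box (Complex (-R) y1) (Complex R y2)"
      using assms by (auto simp: in_box_complex_iff)
    have "((\<lambda>z. G z / (z - w)) has_contour_integral
        (2*pi * \<i> * winding_number (rectpath (Complex (-R) y1) (Complex R y2)) w * G w)) (rectpath (Complex (-R) y1) (Complex R y2))"
      by (rule Cauchy_integral_formula_convex_simple[OF conv(1) G])
         (use True assms S b sub interior_open[OF conv(2)] in auto)
    then show ?thesis using True winding_number_rectpath[OF b] by simp
  next
    case False
    let ?T = "{z. Im w < Im z} \<inter> ?S"
    have "((\<lambda>z. G z / (z - w)) has_contour_integral 0) (rectpath (Complex (-R) y1) (Complex R y2))"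
    proof (rule Cauchy_theorem_convex_simple[where S = ?T])
      show "(\<lambda>z. G z / (z - w)) holomorphic_on ?T"
        by (intro holomorphic_intros holomorphic_on_subset[OF G]) auto
      show "convex ?T"
        by (intro convex_Int convex_halfspace_Im_gt)
      show "path_image (rectpath (Complex (-R) y1) (Complex R y2)) \<subseteq> ?T"
        using False assms S unfolding sub by (auto simp: in_cbox_complex_iff)
    qed auto
    then show ?thesis using False by simp
  qed
qed

text \<open>Rectangles standing on the line \<open>Im z = y0\<close> grow sideways and then upwards.
  The position of \<open>w\<close> is measured relative to that line, so the pole sits at height
  \<open>Im w + y0\<close> and is enclosed precisely when \<open>Im w > 0\<close>.\<close>

lemma cauchy_formula_line:
  assumes G: "G holomorphic_on {z. 0 < Im z}" and "0 < y0" "0 \<le> M"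
    and M: "\<And>y. y0 \<le> y \<Longrightarrow> L2_norm_sq (\<lambda>x. G (Complex x y)) \<le> ennreal M"
    and w: "Im w \<noteq> 0"
  shows "(\<integral>x. G (Complex x y0) / (of_real x - w) \<partial>lborel) =
    (if 0 < Im w then 2 * pi * \<i> * G (w + \<i> * of_real y0) else 0)"
proof -
  define w' where "w' = w + \<i> * of_real y0"
  have w': "Re w' = Re w" "Im w' = Im w + y0" by (auto simp: w'_def)
  define c where "c = (if 0 < Im w then 2 * pi * \<i> * G w' else 0)"
  define \<Phi> where "\<Phi> = (\<lambda>z. G z / (z - w'))"
  have GL: "(\<lambda>x. G (Complex x y)) \<in> L2" "l2_norm (\<lambda>x. G (Complex x y)) \<le> sqrt M" if "y0 \<le> y" for y
  proof -
    show *: "(\<lambda>x. G (Complex x y)) \<in> L2"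
      by (rule L2I_le[OF holomorphic_upper_measurable(2)[OF G] M]) (use that \<open>0 < y0\<close> in auto)
    show "l2_norm (\<lambda>x. G (Complex x y)) \<le> sqrt M"
      using L2_norm_sq_le_iff[OF *, of "sqrt M"] M[OF that] \<open>0 \<le> M\<close> by simp
  qed
  have int: "integrable lborel (\<lambda>x. \<Phi> (Complex x y))" if "y0 \<le> y" "y \<noteq> Im w'" for y
    using L2_mult_integrable[OF GL(1) L2_cauchy_kernel_shift(1)] that by (auto simp: \<Phi>_def)
  have top: "cmod (\<integral>x. \<Phi> (Complex x y) \<partial>lborel) \<le> sqrt M * sqrt (pi / \<bar>y - Im w'\<bar>)"
    if "y0 \<le> y" "y \<noteq> Im w'" for y
  proof -
    have "cmod (\<integral>x. \<Phi> (Complex x y) \<partial>lborel) \<le> l2_norm (\<lambda>x. G (Complex x y)) * l2_norm (\<lambda>x. 1 / (Complex x y - w'))"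
      using L2_cauchy_schwarz(2)[OF GL(1) L2_cauchy_kernel_shift(1)] that by (auto simp: \<Phi>_def)
    also have "l2_norm (\<lambda>x. 1 / (Complex x y - w')) = sqrt (pi / \<bar>y - Im w'\<bar>)"
      using L2_cauchy_kernel_shift(2)[of w' y] that
      by (intro real_sqrt_unique[symmetric]) auto
    also have "l2_norm (\<lambda>x. G (Complex x y)) * sqrt (pi / \<bar>y - Im w'\<bar>) \<le> sqrt M * sqrt (pi / \<bar>y - Im w'\<bar>)"
      using GL(2) that by (intro mult_right_mono) auto
    finally show ?thesis .
  qed
  have eq: "(\<integral>x. \<Phi> (Complex x y0) \<partial>lborel) - (\<integral>x. \<Phi> (Complex x y2) \<partial>lborel) = c"
    if y2: "y0 < y2" "Im w' < y2" for y2
  \<comment> \<open>\<open>r\<close> keeps \<open>x\<close> at distance at least 1 from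
    \<open>Re w\<close>. There the squared Cauchy kernel is at most
    \<open>2 / ((x - Re w)\<^sup>2 + 1)\<close> at every height, with integral
    \<open>2 * pi\<close>; \<open>M\<close> accounts for the squared norm of
    \<open>G\<close>.\<close>
  proof (rule rectangle_limit[where r = "\<bar>Re w\<bar> + 1" and B = "M + 2 * pi"])
    have "continuous_on {z. \<bar>Re w\<bar> + 1 \<le> \<bar>Re z\<bar> \<and> y0 \<le> Im z \<and> Im z \<le> y2} G"
      using \<open>0 < y0\<close> by (intro continuous_on_subset[OF holomorphic_on_imp_continuous_on[OF G]]) auto
    then show "continuous_on {z. \<bar>Re w\<bar> + 1 \<le> \<bar>Re z\<bar> \<and> y0 \<le> Im z \<and> Im z \<le> y2} \<Phi>"
      unfolding \<Phi>_def by (intro continuous_intros) (auto simp: w')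
    show "integrable lborel (\<lambda>x. \<Phi> (Complex x y0))" using int[of y0] w w' by auto
    show "integrable lborel (\<lambda>x. \<Phi> (Complex x y2))" using int[of y2] y2 by auto
    show "(\<Phi> has_contour_integral c) (rectpath (Complex (-R) y0) (Complex R y2))"
      if "\<bar>Re w\<bar> + 1 \<le> R" for R
      using rectangle_contour[OF G, of y0 y2 w' R] that y2 \<open>0 < y0\<close> w w'
      by (auto simp: \<Phi>_def c_def)
    show "(\<integral>\<^sup>+x. ennreal (cmod (\<Phi> (Complex x y))) * indicator {x. \<bar>Re w\<bar> + 1 \<le> \<bar>x\<bar>} x \<partial>lborel)
        \<le> ennreal (M + 2 * pi)" if y: "y0 \<le> y" "y \<le> y2" for y
    proof -
      have [measurable]: "(\<lambda>x. G (Complex x y)) \<in> borel_measurable lborel"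
        using GL(1)[OF y(1)] by (simp add: L2_iff)
      let ?w = "Complex (Re w) 1"
      have "(\<integral>\<^sup>+x. ennreal (cmod (\<Phi> (Complex x y))) * indicator {x. \<bar>Re w\<bar> + 1 \<le> \<bar>x\<bar>} x \<partial>lborel)
        \<le> (\<integral>\<^sup>+x. ennreal ((cmod (G (Complex x y)))\<^sup>2) + ennreal (2 * (1 / (cmod (of_real x - ?w))\<^sup>2)) \<partial>lborel)"
      proof (rule nn_integral_mono)
        fix x :: real
        show "ennreal (cmod (\<Phi> (Complex x y))) * indicator {x. \<bar>Re w\<bar> + 1 \<le> \<bar>x\<bar>} x
          \<le> ennreal ((cmod (G (Complex x y)))\<^sup>2) + ennreal (2 * (1 / (cmod (of_real x - ?w))\<^sup>2))"
        proof (cases "\<bar>Re w\<bar> + 1 \<le> \<bar>x\<bar>")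
          case True
          let ?g = "cmod (G (Complex x y))" and ?k = "1 / cmod (Complex x y - w')"
          have x1: "1 \<le> \<bar>x - Re w\<bar>" using True by linarith
          then have x2: "1 \<le> (x - Re w)\<^sup>2" using power_mono[of 1 "\<bar>x - Re w\<bar>" 2] by simp
          have "cmod (\<Phi> (Complex x y)) = ?g * ?k"
            by (simp add: \<Phi>_def norm_divide)
          also have "\<dots> \<le> ?g\<^sup>2 + ?k\<^sup>2"
            by (rule mult_le_sum_squares) auto
          also have "?k\<^sup>2 \<le> 2 * (1 / (cmod (of_real x - ?w))\<^sup>2)"
          proof -
            have 1: "(cmod (of_real x - ?w))\<^sup>2 = (x - Re w)\<^sup>2 + 1"
              by (simp add: cmod_power2)
            have 2: "(cmod (Complex x y - w'))\<^sup>2 \<ge> (x - Re w)\<^sup>2"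
              by (simp add: cmod_power2 w')
            have "(x - Re w)\<^sup>2 + 1 \<le> 2 * (cmod (Complex x y - w'))\<^sup>2"
              using x2 2 by linarith
            moreover have "0 < (x - Re w)\<^sup>2 + 1" "0 < (cmod (Complex x y - w'))\<^sup>2"
              using x2 2 by linarith+
            ultimately show ?thesis unfolding 1 power_divide
              by (simp add: field_simps del: zero_less_power2)
          qed
          finally show ?thesis using True 
            by (simp add: ennreal_plus[symmetric] ennreal_leI del: ennreal_plus)
        qed auto
      qed
      also have "\<dots> = L2_norm_sq (\<lambda>x. G (Complex x y)) + ennreal (2 * pi)"
      proof -
        have "(\<integral>\<^sup>+x. ennreal (2 * (1 / (cmod (of_real x - ?w))\<^sup>2)) \<partial>lborel) = ennreal (2 * pi)"
          using nn_integral_eq_integral[of lborel "\<lambda>x. 2 * (1 / (cmod (of_real x - ?w))\<^sup>2)"]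
            has_bochner_integral_mult_right[OF has_bochner_integral_poisson_kernel[of ?w], of 2]
          by (auto simp: has_bochner_integral_iff)
        then show ?thesis
          unfolding L2_norm_sq_def by (subst nn_integral_add) auto
      qed
      also have "\<dots> \<le> ennreal M + ennreal (2 * pi)"
        using M[OF y(1)] by (intro add_mono) auto
      finally show ?thesis using \<open>0 \<le> M\<close> by (simp add: ennreal_plus[symmetric] del: ennreal_plus)
    qed
  qed (use y2 in auto)
  \<comment> \<open>The upper side disappears by Cauchy-Schwarz: the norm of \<open>G\<close> stays
    bounded while that of the kernel, \<open>sqrt (pi / \<bar>y - Im w'\<bar>)\<close>, tends to
    0.\<close>
  have "((\<lambda>y2. \<integral>x. \<Phi> (Complex x y2) \<partial>lborel) \<longlongrightarrow> 0) at_top"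
  proof (rule Lim_null_comparison)
    show "\<forall>\<^sub>F y in at_top. cmod (\<integral>x. \<Phi> (Complex x y) \<partial>lborel) \<le> sqrt M * sqrt (pi / \<bar>y - Im w'\<bar>)"
      using eventually_ge_at_top[of y0] eventually_gt_at_top[of "Im w'"]
      by eventually_elim (rule top, auto)
    have "((\<lambda>y. pi / \<bar>y - Im w'\<bar>) \<longlongrightarrow> 0) at_top"
      by real_asymp
    from tendsto_mult[OF tendsto_const tendsto_real_sqrt[OF this]]
    show "((\<lambda>y. sqrt M * sqrt (pi / \<bar>y - Im w'\<bar>)) \<longlongrightarrow> 0) at_top" by simp
  qed
  then have "((\<lambda>y2. (\<integral>x. \<Phi> (Complex x y0) \<partial>lborel) - (\<integral>x. \<Phi> (Complex x y2) \<partial>lborel)) \<longlongrightarrow> (\<integral>x. \<Phi> (Complex x y0) \<partial>lborel) - 0) at_top"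
    by (intro tendsto_intros)
  moreover have "((\<lambda>y2. (\<integral>x. \<Phi> (Complex x y0) \<partial>lborel) - (\<integral>x. \<Phi> (Complex x y2) \<partial>lborel)) \<longlongrightarrow> c) at_top"
  proof (rule tendsto_eventually)
    show "\<forall>\<^sub>F y2 in at_top. (\<integral>x. \<Phi> (Complex x y0) \<partial>lborel) - (\<integral>x. \<Phi> (Complex x y2) \<partial>lborel) = c"
      using eventually_gt_at_top[of y0] eventually_gt_at_top[of "Im w'"]
      by eventually_elim (rule eq)
  qed
  ultimately have "(\<integral>x. \<Phi> (Complex x y0) \<partial>lborel) = c"
    using tendsto_unique[OF trivial_limit_at_top_linorder] by fastforce
  moreover have "\<Phi> (Complex x y0) = G (Complex x y0) / (of_real x - w)" for x
    by (simp add: \<Phi>_def w'_def Complex_eq)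
  ultimately show ?thesis by (simp add: c_def w'_def)
qed

section \<open>The Hardy spaces\<close>

lemma SUP_less_top_iff_bounded:
  fixes f :: "'a \<Rightarrow> ennreal"
  shows "(SUP x\<in>A. f x) < \<infinity> \<longleftrightarrow> (\<exists>M\<ge>0. \<forall>x\<in>A. f x \<le> ennreal M)"
proof
  assume "(SUP x\<in>A. f x) < \<infinity>"
  then obtain M where M: "(SUP x\<in>A. f x) = ennreal M" "0 \<le> M"
    by (cases "SUP x\<in>A. f x") auto
  then have "\<forall>x\<in>A. f x \<le> ennreal M" by (metis SUP_upper)
  then show "\<exists>M\<ge>0. \<forall>x\<in>A. f x \<le> ennreal M" using M by blast
next
  assume "\<exists>M\<ge>0. \<forall>x\<in>A. f x \<le> ennreal M"
  then obtain M where "\<forall>x\<in>A. f x \<le> ennreal M" by blast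
  then have "(SUP x\<in>A. f x) \<le> ennreal M" by (intro SUP_least) auto
  then show "(SUP x\<in>A. f x) < \<infinity>" by (simp add: le_less_trans)
qed

lemma eventually_at_right_0I:
  fixes P :: "real \<Rightarrow> bool"
  assumes "\<And>y. 0 < y \<Longrightarrow> P y"
  shows "eventually P (at_right 0)"
  using eventually_at_right_less[of "0::real"] by eventually_elim (rule assms)

text \<open>\<open>H2_plus\<close> with its witnesses exposed, so that later estimates can name the
  extension; \<open>M\<close> bounds the squared norms.\<close>

definition hardy_ext :: "(complex \<Rightarrow> complex) \<Rightarrow> real \<Rightarrow> (real \<Rightarrow> complex) \<Rightarrow> bool" where
  "hardy_ext F M f \<longleftrightarrow> f \<in> L2 \<and> F holomorphic_on {z. 0 < Im z} \<and> 0 \<le> M \<and>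
     (\<forall>y>0. L2_norm_sq (\<lambda>x. F (Complex x y)) \<le> ennreal M) \<and>
     ((\<lambda>y. L2_norm_sq (\<lambda>x. F (Complex x y) - f x)) \<longlongrightarrow> 0) (at_right 0)"

lemma H2_plus_iff: "f \<in> H2_plus \<longleftrightarrow> (\<exists>F M. hardy_ext F M f)"
  unfolding H2_plus_def hardy_ext_def SUP_less_top_iff_bounded by auto

lemma hardy_ext_L2:
  assumes "hardy_ext F M f"
  shows "f \<in> L2" "0 < y \<Longrightarrow> (\<lambda>x. F (Complex x y)) \<in> L2"
proof -
  show "(\<lambda>x. F (Complex x y)) \<in> L2" if "0 < y"
    by (rule L2I_le[OF holomorphic_upper_measurable(2)]) (use assms that in \<open>auto simp: hardy_ext_def\<close>)
qed (use assms in \<open>simp add: hardy_ext_def\<close>)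

lemma hardy_ext_tendsto:
  assumes "hardy_ext F M f"
  shows "((\<lambda>y. l2_norm (\<lambda>x. F (Complex x y) - f x)) \<longlongrightarrow> 0) (at_right 0)"
proof -
  have "\<forall>\<^sub>F y in at_right 0. (\<lambda>x. F (Complex x y) - f x) \<in> L2"
    by (intro eventually_at_right_0I L2_diff hardy_ext_L2[OF assms])
  then show ?thesis using assms by (simp add: hardy_ext_def L2_norm_sq_tendsto_0_iff)
qed

lemma l2_norm_cauchy_kernel: "Im w \<noteq> 0 \<Longrightarrow> l2_norm (\<lambda>x. 1 / (of_real x - w)) = sqrt (pi / \<bar>Im w\<bar>)"
  using L2_cauchy_kernel(2)[of w] by (metis l2_norm_nonneg real_sqrt_unique)

lemma cauchy_integrable: "f \<in> L2 \<Longrightarrow> Im w \<noteq> 0 \<Longrightarrow> integrable lborel (\<lambda>x. f x / (of_real x - w))"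
  using L2_mult_integrable[OF _ L2_cauchy_kernel(1), of f w] by simp

lemma cauchy_integral_bound:
  assumes "f \<in> L2" "Im w \<noteq> 0"
  shows "cmod (\<integral>x. f x / (of_real x - w) \<partial>lborel) \<le> l2_norm f * sqrt (pi / \<bar>Im w\<bar>)"
  using L2_cauchy_schwarz(2)[OF assms(1) L2_cauchy_kernel(1)[OF assms(2)]] l2_norm_cauchy_kernel[OF assms(2)]
  by simp

lemma cauchy_integral_diff_bound:
  assumes "f \<in> L2" "g \<in> L2" "Im w \<noteq> 0"
  shows "cmod ((\<integral>x. f x / (of_real x - w) \<partial>lborel) - (\<integral>x. g x / (of_real x - w) \<partial>lborel))
    \<le> l2_norm (\<lambda>x. f x - g x) * sqrt (pi / \<bar>Im w\<bar>)"
  using cauchy_integral_bound[OF L2_diff[OF assms(1,2)] assms(3)]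
  by (simp add: diff_divide_distrib cauchy_integrable assms)

text \<open>The formula on the line at height \<open>y\<close> is passed to the limit: the left side
  converges because the Cauchy kernel is in \<open>L2\<close>, the right side because
  \<open>F\<close> is continuous at \<open>w\<close>. The vanishing for \<open>Im w < 0\<close>
  records analyticity in terms of \<open>f\<close> alone.\<close>

lemma hardy_cauchy_formula:
  assumes F: "hardy_ext F M f" and w: "Im w \<noteq> 0"
  shows "(\<integral>x. f x / (of_real x - w) \<partial>lborel) = (if 0 < Im w then 2 * pi * \<i> * F w else 0)"
proof -
  have holF: "F holomorphic_on {z. 0 < Im z}" using F by (simp add: hardy_ext_def)
  let ?c = "\<lambda>y. if 0 < Im w then 2 * pi * \<i> * F (w + \<i> * of_real y) else 0"
  have c: "(\<integral>x. F (Complex x y) / (of_real x - w) \<partial>lborel) = ?c y" if "0 < y" for y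
  proof (rule cauchy_formula_line[OF holF that _ _ w])
    show "0 \<le> M" using F by (simp add: hardy_ext_def)
    show "L2_norm_sq (\<lambda>x. F (Complex x y')) \<le> ennreal M" if "y \<le> y'" for y'
      using F that \<open>0 < y\<close> unfolding hardy_ext_def by (meson less_le_trans)
  qed
  have "((\<lambda>y. \<integral>x. F (Complex x y) / (of_real x - w) \<partial>lborel) \<longlongrightarrow> (\<integral>x. f x / (of_real x - w) \<partial>lborel)) (at_right 0)"
  proof (rule LIM_zero_cancel, rule Lim_null_comparison)
    show "\<forall>\<^sub>F y in at_right 0. cmod ((\<integral>x. F (Complex x y) / (of_real x - w) \<partial>lborel) - (\<integral>x. f x / (of_real x - w) \<partial>lborel))
       \<le> l2_norm (\<lambda>x. F (Complex x y) - f x) * sqrt (pi / \<bar>Im w\<bar>)"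
      by (intro eventually_at_right_0I cauchy_integral_diff_bound hardy_ext_L2[OF F] w)
    show "((\<lambda>y. l2_norm (\<lambda>x. F (Complex x y) - f x) * sqrt (pi / \<bar>Im w\<bar>)) \<longlongrightarrow> 0) (at_right 0)"
      using tendsto_mult_right[OF hardy_ext_tendsto[OF F]] by simp
  qed
  then have 1: "(?c \<longlongrightarrow> (\<integral>x. f x / (of_real x - w) \<partial>lborel)) (at_right 0)"
    by (rule Lim_transform_eventually) (rule eventually_at_right_0I, rule c)
  have 2: "(?c \<longlongrightarrow> (if 0 < Im w then 2 * pi * \<i> * F w else 0)) (at_right 0)"
  proof (cases "0 < Im w")
    case True
    have cF: "isCont F w"
      using holomorphic_on_imp_continuous_on[OF holF] True open_halfspace_Im_gt[of 0]
      by (simp add: continuous_on_eq_continuous_at)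
    have "((\<lambda>y. w + \<i> * of_real y) \<longlongrightarrow> w + \<i> * of_real 0) (at_right 0)"
      by (intro tendsto_intros)
    then have "((\<lambda>y. F (w + \<i> * of_real y)) \<longlongrightarrow> F w) (at_right 0)"
      using isCont_tendsto_compose[OF cF] by simp
    from tendsto_mult[OF tendsto_const[of "2 * pi * \<i>"] this] show ?thesis using True by simp
  qed simp
  show ?thesis
    using tendsto_unique[OF _ 1 2] by (simp add: trivial_limit_at_right_real)
qed

text \<open>Cauchy's formula with Cauchy-Schwarz. The factor \<open>2 * pi\<close> is given away;
  the purpose is boundedness of \<open>F\<close> on each half-plane strictly above the real
  axis.\<close>

lemma hardy_bound:
  assumes "hardy_ext F M f" "0 < Im w"
  shows "cmod (F w) \<le> l2_norm f * sqrt (pi / Im w)"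
proof -
  have "cmod (F w) \<le> cmod (2 * pi * \<i> * F w)"
    using pi_ge_two by (simp add: norm_mult mult_le_cancel_right1)
  also have "\<dots> \<le> l2_norm f * sqrt (pi / Im w)"
    using hardy_cauchy_formula[OF assms(1), of w] cauchy_integral_bound[OF hardy_ext_L2(1)[OF assms(1)], of w] assms(2)
    by simp
  finally show ?thesis .
qed

section \<open>Poisson integrals and closedness of the Hardy space\<close>

definition poisson :: "(real \<Rightarrow> complex) \<Rightarrow> real \<Rightarrow> real \<Rightarrow> complex" where
  "poisson u y x = (\<integral>t. of_real (y / pi * (1 / (cmod (of_real t - Complex x y))\<^sup>2)) * u t \<partial>lborel)"

lemma poisson_kernel_integral:
  assumes "0 < y"
  shows "(\<integral>\<^sup>+x. ennreal (y / pi * (1 / (cmod (of_real t - Complex x y))\<^sup>2)) \<partial>lborel) = 1" (is ?A)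
    and "has_bochner_integral lborel (\<lambda>t. y / pi * (1 / (cmod (of_real t - Complex x y))\<^sup>2)) 1" (is ?B)
proof -
  have B: "has_bochner_integral lborel (\<lambda>t. y / pi * (1 / (cmod (of_real t - Complex x y))\<^sup>2)) 1" for x
    using has_bochner_integral_mult_right[OF has_bochner_integral_poisson_kernel[of "Complex x y"], of "y / pi"] assms
    by simp
  show ?B by (rule B)
  have "(\<integral>\<^sup>+x. ennreal (y / pi * (1 / (cmod (of_real t - Complex x y))\<^sup>2)) \<partial>lborel) =
     (\<integral>\<^sup>+x. ennreal (y / pi * (1 / (cmod (of_real x - Complex t y))\<^sup>2)) \<partial>lborel)"
    by (simp add: cmod_power2 power2_commute)
  also have "\<dots> = ennreal 1"
    using nn_integral_eq_integral[of lborel "\<lambda>x. y / pi * (1 / (cmod (of_real x - Complex t y))\<^sup>2)"] B[of t] assms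
    by (auto simp: has_bochner_integral_iff)
  finally show ?A by simp
qed

text \<open>Jensen's inequality for the probability density \<open>p x\<close>, then integration
  over \<open>x\<close>, for which the symmetric kernel has mass 1 as well.\<close>

lemma poisson_contraction:
  assumes u: "u \<in> L2" and y: "0 < y"
  shows "poisson u y \<in> L2" "l2_norm (poisson u y) \<le> l2_norm u"
proof -
  have [measurable]: "u \<in> borel_measurable lborel" using u by (simp add: L2_iff)
  define p where "p = (\<lambda>x t. y / pi * (1 / (cmod (of_real t - Complex x y))\<^sup>2))"
  have p0: "0 \<le> p x t" for x t using y by (simp add: p_def)
  have pb: "p x t \<le> 1 / (pi * y)" for x t
  proof -
    have "y\<^sup>2 \<le> (cmod (of_real t - Complex x y))\<^sup>2" by (simp add: cmod_power2)
    then have "1 / (cmod (of_real t - Complex x y))\<^sup>2 \<le> 1 / y\<^sup>2"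
      using y by (intro divide_left_mono) (auto intro!: mult_pos_pos intro: order.strict_trans2[of 0 "y\<^sup>2"])
    then have "p x t \<le> y / pi * (1 / y\<^sup>2)"
      unfolding p_def using y by (intro mult_left_mono) auto
    also have "\<dots> = 1 / (pi * y)" using y by (simp add: power2_eq_square)
    finally show ?thesis .
  qed
  have p_alt: "p = (\<lambda>x t. y / pi * (1 / ((t - x)\<^sup>2 + y\<^sup>2)))"
    by (auto simp: p_def cmod_power2 fun_eq_iff)
  have [measurable]: "case_prod p \<in> borel_measurable (lborel \<Otimes>\<^sub>M lborel)"
    unfolding p_alt by measurable
  have [measurable]: "p x \<in> borel_measurable lborel" for x
    unfolding p_alt by measurable
  have P: "poisson u y = (\<lambda>x. \<integral>t. of_real (p x t) * u t \<partial>lborel)"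
    by (auto simp: poisson_def p_def fun_eq_iff)
  have meas: "poisson u y \<in> borel_measurable lborel"
    unfolding P by measurable
  have pt: "ennreal ((cmod (poisson u y x))\<^sup>2) \<le> (\<integral>\<^sup>+t. ennreal (p x t) * ennreal ((cmod (u t))\<^sup>2) \<partial>lborel)" for x
  proof -
    \<comment> \<open>Splitting \<open>p\<close> into two square roots turns Cauchy-Schwarz into
      Jensen's inequality, since \<open>?f\<close> has norm 1.\<close>
    let ?f = "\<lambda>t. complex_of_real (sqrt (p x t))" and ?g = "\<lambda>t. complex_of_real (sqrt (p x t)) * u t"
    have i1: "integrable lborel (p x)" "(\<integral>t. p x t \<partial>lborel) = 1"
      using poisson_kernel_integral(2)[OF y, of x] by (auto simp: p_def has_bochner_integral_iff)
    then have f: "?f \<in> L2" "l2_norm ?f = 1"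
      using p0 by (auto simp: L2_iff l2_norm_def)
    have i2: "integrable lborel (\<lambda>t. p x t * (cmod (u t))\<^sup>2)"
    proof (rule Bochner_Integration.integrable_bound[where f = "\<lambda>t. 1 / (pi * y) * (cmod (u t))\<^sup>2"])
      show "AE t in lborel. norm (p x t * (cmod (u t))\<^sup>2) \<le> norm (1 / (pi * y) * (cmod (u t))\<^sup>2)"
      proof (rule AE_I2)
        fix t
        have "p x t * (cmod (u t))\<^sup>2 \<le> 1 / (pi * y) * (cmod (u t))\<^sup>2"
          using pb by (rule mult_right_mono) simp
        then show "norm (p x t * (cmod (u t))\<^sup>2) \<le> norm (1 / (pi * y) * (cmod (u t))\<^sup>2)"
          using p0[of x t] y by (simp add: abs_mult)
      qed
    qed (use L2_integrable_sq[OF u] in auto)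
    then have g: "?g \<in> L2"
      using p0 by (auto simp: L2_iff norm_mult power_mult_distrib)
    have g2: "(l2_norm ?g)\<^sup>2 = (\<integral>t. p x t * (cmod (u t))\<^sup>2 \<partial>lborel)"
      using p0 by (simp add: l2_norm_power2 norm_mult power_mult_distrib)
    have fg: "?f t * ?g t = of_real (p x t) * u t" for t
      using p0[of x t] by (simp add: mult.assoc[symmetric] of_real_mult[symmetric] del: of_real_mult)
    have "cmod (poisson u y x) \<le> l2_norm ?g"
      using L2_cauchy_schwarz(2)[OF f(1) g] unfolding fg P f(2) by simp
    then have "(cmod (poisson u y x))\<^sup>2 \<le> (\<integral>t. p x t * (cmod (u t))\<^sup>2 \<partial>lborel)"
      unfolding g2[symmetric] by (rule power_mono) simp
    then have "ennreal ((cmod (poisson u y x))\<^sup>2) \<le> ennreal (\<integral>t. p x t * (cmod (u t))\<^sup>2 \<partial>lborel)"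
      by (rule ennreal_leI)
    also have "\<dots> = (\<integral>\<^sup>+t. ennreal (p x t * (cmod (u t))\<^sup>2) \<partial>lborel)"
      using p0 by (intro nn_integral_eq_integral[symmetric] i2) auto
    finally show ?thesis using p0 by (simp add: ennreal_mult)
  qed
  have "L2_norm_sq (poisson u y) \<le> (\<integral>\<^sup>+x. (\<integral>\<^sup>+t. ennreal (p x t) * ennreal ((cmod (u t))\<^sup>2) \<partial>lborel) \<partial>lborel)"
    unfolding L2_norm_sq_def by (intro nn_integral_mono pt)
  also have "\<dots> = (\<integral>\<^sup>+t. (\<integral>\<^sup>+x. ennreal (p x t) * ennreal ((cmod (u t))\<^sup>2) \<partial>lborel) \<partial>lborel)"
    by (rule lborel_pair.Fubini'[symmetric]) measurable
  also have "\<dots> = (\<integral>\<^sup>+t. (\<integral>\<^sup>+x. ennreal (p x t) \<partial>lborel) * ennreal ((cmod (u t))\<^sup>2) \<partial>lborel)"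
    by (intro nn_integral_cong nn_integral_multc) measurable
  also have "\<dots> = L2_norm_sq u"
    using poisson_kernel_integral(1)[OF y] by (simp add: p_def L2_norm_sq_def)
  also have "\<dots> = ennreal ((l2_norm u)\<^sup>2)" by (rule L2_norm_sq_eq[OF u])
  finally have le: "L2_norm_sq (poisson u y) \<le> ennreal ((l2_norm u)\<^sup>2)" .
  show PL: "poisson u y \<in> L2" by (rule L2I_le[OF meas le])
  show "l2_norm (poisson u y) \<le> l2_norm u" using le L2_norm_sq_le_iff[OF PL] by simp
qed

lemma divide_diff_divide_cnj:
  assumes "z \<noteq> 0"
  shows "v / z - v / cnj z = v * ((cnj z - z) / (of_real (cmod z))\<^sup>2)"
proof -
  have "cnj z \<noteq> 0" using assms by simp
  from diff_frac_eq[OF assms this, of v v] show ?thesis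
    unfolding of_real_power[symmetric] complex_norm_square
    by (simp add: right_diff_distrib)
qed

text \<open>The Poisson kernel is the difference of the Cauchy kernels at a point and at its
  conjugate, divided by \<open>2 * pi * \<i>\<close>. For a Hardy function the second Cauchy
  integral vanishes, so its Cauchy and Poisson integrals coincide.\<close>

lemma poisson_integrable:
  assumes "u \<in> L2" "0 < y"
  shows "integrable lborel (\<lambda>t. of_real (y / pi * (1 / (cmod (of_real t - Complex x y))\<^sup>2)) * u t)"
    and "poisson u y x = 1 / (2 * pi * \<i>) * ((\<integral>t. u t / (of_real t - Complex x y) \<partial>lborel)
      - (\<integral>t. u t / (of_real t - Complex x (- y)) \<partial>lborel))"
proof -
  have i: "integrable lborel (\<lambda>t. u t / (of_real t - Complex x y))"
     "integrable lborel (\<lambda>t. u t / (of_real t - Complex x (- y)))"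
    using assms by (auto intro!: cauchy_integrable)
  have eq: "of_real (y / pi * (1 / (cmod (of_real t - Complex x y))\<^sup>2)) * u t =
     1 / (2 * pi * \<i>) * (u t / (of_real t - Complex x y) - u t / (of_real t - Complex x (- y)))" for t
  proof -
    let ?a = "complex_of_real t - Complex x y"
    have b: "complex_of_real t - Complex x (- y) = cnj ?a" by (simp add: complex_eq_iff)
    have a: "?a \<noteq> 0" using assms(2) by (auto simp: complex_eq_iff)
    have "cnj ?a - ?a = 2 * \<i> * y" by (simp add: complex_eq_iff)
    then show ?thesis unfolding b divide_diff_divide_cnj[OF a]
      by (simp add: complex_norm_square[symmetric])
  qed
  show "integrable lborel (\<lambda>t. of_real (y / pi * (1 / (cmod (of_real t - Complex x y))\<^sup>2)) * u t)"
    unfolding eq using i by auto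
  show "poisson u y x = 1 / (2 * pi * \<i>) * ((\<integral>t. u t / (of_real t - Complex x y) \<partial>lborel)
      - (\<integral>t. u t / (of_real t - Complex x (- y)) \<partial>lborel))"
    unfolding poisson_def eq using i by simp
qed

lemma poisson_diff:
  assumes "u \<in> L2" "v \<in> L2" "0 < y"
  shows "poisson (\<lambda>t. u t - v t) y x = poisson u y x - poisson v y x"
  unfolding poisson_def right_diff_distrib
  by (intro Bochner_Integration.integral_diff poisson_integrable assms)

lemma hardy_poisson:
  assumes "hardy_ext F M f" "0 < y"
  shows "F (Complex x y) = poisson f y x"
  using poisson_integrable(2)[OF hardy_ext_L2(1)[OF assms(1)] assms(2), of x]
    hardy_cauchy_formula[OF assms(1), of "Complex x y"] hardy_cauchy_formula[OF assms(1), of "Complex x (-y)"] assms(2)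
  by simp

text \<open>The extension of the limit is its Cauchy integral \<open>E\<close>. Holomorphy comes
  from locally uniform convergence of the \<open>F n\<close>. The vanishing of the Cauchy integral
  below the line survives the limit and makes \<open>E\<close> the Poisson integral of
  \<open>f\<close>, whose contractivity controls all horizontal lines at once.\<close>

lemma H2_plus_closed:
  assumes f: "f \<in> L2" and app: "\<And>\<epsilon>. 0 < \<epsilon> \<Longrightarrow> \<exists>g\<in>H2_plus. l2_norm (\<lambda>x. f x - g x) < \<epsilon>"
  shows "f \<in> H2_plus"
proof -
  have "\<exists>g F M. hardy_ext F M g \<and> l2_norm (\<lambda>x. f x - g x) < 1 / (real n + 1)" for n
    using app[of "1 / (real n + 1)"] by (auto simp: H2_plus_iff)
  then obtain g F M where F: "\<And>n. hardy_ext (F n) (M n) (g n)"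
    and fg: "\<And>n. l2_norm (\<lambda>x. f x - g n x) < 1 / (real n + 1)"
    by metis
  have gL: "g n \<in> L2" for n using hardy_ext_L2(1)[OF F] .
  have lim0: "(\<lambda>n. l2_norm (\<lambda>x. f x - g n x)) \<longlonglongrightarrow> 0"
  proof (rule tendsto_sandwich[OF _ _ tendsto_const])
    show "(\<lambda>n. 1 / (real n + 1)) \<longlonglongrightarrow> 0" by real_asymp
  qed (use fg in \<open>auto intro!: always_eventually less_imp_le\<close>)
  define E where "E = (\<lambda>w. 1 / (2 * pi * \<i>) * (\<integral>x. f x / (of_real x - w) \<partial>lborel))"
  have diffb: "cmod ((\<integral>x. g n x / (of_real x - w) \<partial>lborel) - (\<integral>x. f x / (of_real x - w) \<partial>lborel))
    \<le> l2_norm (\<lambda>x. f x - g n x) * sqrt (pi / \<bar>Im w\<bar>)" if "Im w \<noteq> 0" for n w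
    using cauchy_integral_diff_bound[OF gL f that] by (simp add: l2_norm_minus)
  have zero: "(\<integral>x. f x / (of_real x - w) \<partial>lborel) = 0" if "Im w < 0" for w
  proof -
    have "(\<lambda>n. l2_norm (\<lambda>x. f x - g n x) * sqrt (pi / \<bar>Im w\<bar>)) \<longlonglongrightarrow> 0"
      using tendsto_mult_right[OF lim0] by simp
    moreover have "cmod (\<integral>x. f x / (of_real x - w) \<partial>lborel) \<le> l2_norm (\<lambda>x. f x - g n x) * sqrt (pi / \<bar>Im w\<bar>)" for n
      using diffb[of w n] hardy_cauchy_formula[OF F, of w n] that by simp
    ultimately have "cmod (\<integral>x. f x / (of_real x - w) \<partial>lborel) \<le> 0"
      by (intro tendsto_lowerbound) auto
    then show ?thesis by simp
  qed
  have EP: "E (Complex x y) = poisson f y x" if "0 < y" for x y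
    using poisson_integrable(2)[OF f that, of x] zero[of "Complex x (-y)"] that by (simp add: E_def)
  have FE: "cmod (F n w - E w) \<le> l2_norm (\<lambda>x. f x - g n x) * sqrt (pi / Im w)" if "0 < Im w" for n w
  proof -
    have "F n w - E w = 1 / (2 * pi * \<i>) * ((\<integral>x. g n x / (of_real x - w) \<partial>lborel) - (\<integral>x. f x / (of_real x - w) \<partial>lborel))"
      using hardy_cauchy_formula[OF F, of w n] that by (simp add: E_def algebra_simps)
    then have "cmod (F n w - E w) = 1 / (2 * pi) * cmod ((\<integral>x. g n x / (of_real x - w) \<partial>lborel) - (\<integral>x. f x / (of_real x - w) \<partial>lborel))"
      by (simp add: norm_mult norm_divide)
    also have "\<dots> \<le> 1 * cmod ((\<integral>x. g n x / (of_real x - w) \<partial>lborel) - (\<integral>x. f x / (of_real x - w) \<partial>lborel))"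
      using pi_ge_two by (intro mult_right_mono) auto
    also have "\<dots> \<le> l2_norm (\<lambda>x. f x - g n x) * sqrt (pi / Im w)"
      using diffb[of w n] that by simp
    finally show ?thesis .
  qed
  have hol: "E holomorphic_on {z. 0 < Im z}"
  proof (rule holomorphic_uniform_sequence[where f = F])
    show "open {z. 0 < Im z}" by (rule open_halfspace_Im_gt)
    show "F n holomorphic_on {z. 0 < Im z}" for n using F by (simp add: hardy_ext_def)
    fix z assume "z \<in> {z. 0 < Im z}"
    then have z: "0 < Im z" by simp
    \<comment> \<open>On the disc of radius \<open>Im z / 2\<close> the height stays at least
      \<open>Im z / 2\<close>, so the bound \<open>FE\<close> is uniform there.\<close>
    have im: "Im z / 2 \<le> Im w" if "w \<in> cball z (Im z / 2)" for w
      using that abs_Im_le_cmod[of "z - w"] by (auto simp: dist_norm) 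
    have "uniform_limit (cball z (Im z / 2)) F E sequentially"
    proof (rule uniform_limitI)
      fix e :: real assume "0 < e"
      have "(\<lambda>n. l2_norm (\<lambda>x. f x - g n x) * sqrt (pi / (Im z / 2))) \<longlonglongrightarrow> 0"
        using tendsto_mult_right[OF lim0] by simp
      then have "\<forall>\<^sub>F n in sequentially. l2_norm (\<lambda>x. f x - g n x) * sqrt (pi / (Im z / 2)) < e"
        using \<open>0 < e\<close> by (rule order_tendstoD(2))
      then show "\<forall>\<^sub>F n in sequentially. \<forall>w\<in>cball z (Im z / 2). dist (F n w) (E w) < e"
      proof eventually_elim
        case (elim n)
        show ?case
        proof
          fix w assume w: "w \<in> cball z (Im z / 2)"
          have "dist (F n w) (E w) \<le> l2_norm (\<lambda>x. f x - g n x) * sqrt (pi / Im w)"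
            using FE[of w n] im[OF w] z by (simp add: dist_norm)
          also have "\<dots> \<le> l2_norm (\<lambda>x. f x - g n x) * sqrt (pi / (Im z / 2))"
            using im[OF w] z by (intro mult_left_mono real_sqrt_le_mono divide_left_mono) auto
          finally show "dist (F n w) (E w) < e" using elim by linarith
        qed
      qed
    qed
    moreover have "cball z (Im z / 2) \<subseteq> {z. 0 < Im z}"
      using im z by fastforce
    ultimately show "\<exists>d. 0 < d \<and> cball z d \<subseteq> {z. 0 < Im z} \<and> uniform_limit (cball z d) F E sequentially"
      using z by (intro exI[of _ "Im z / 2"]) auto
  qed
  have EL: "(\<lambda>x. E (Complex x y)) \<in> L2" and Eb: "l2_norm (\<lambda>x. E (Complex x y)) \<le> l2_norm f" if "0 < y" for y
    using poisson_contraction[OF f that] EP[OF that] by auto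
  have conv: "((\<lambda>y. l2_norm (\<lambda>x. E (Complex x y) - f x)) \<longlongrightarrow> 0) (at_right 0)"
  proof (rule tendstoI)
    fix e :: real assume "0 < e"
    obtain n where n: "l2_norm (\<lambda>x. f x - g n x) < e / 3"
      using order_tendstoD(2)[OF lim0, of "e / 3"] \<open>0 < e\<close> by (auto simp: eventually_sequentially)
    have "\<forall>\<^sub>F y in at_right 0. l2_norm (\<lambda>x. F n (Complex x y) - g n x) < e / 3"
      using order_tendstoD(2)[OF hardy_ext_tendsto[OF F[of n]], of "e / 3"] \<open>0 < e\<close> by simp
    moreover have "\<forall>\<^sub>F y in at_right 0. (0::real) < y"
      by (simp add: eventually_at_right_less)
    ultimately show "\<forall>\<^sub>F y in at_right 0. dist (l2_norm (\<lambda>x. E (Complex x y) - f x)) 0 < e"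
    proof eventually_elim
      case (elim y)
      have FL: "(\<lambda>x. F n (Complex x y)) \<in> L2" using hardy_ext_L2(2)[OF F elim(2)] .
      \<comment> \<open>Linearity and contractivity keep \<open>E\<close> and \<open>F n\<close>
        within \<open>e / 3\<close> on every line, so that \<open>n\<close> can be fixed before
        \<open>y\<close> tends to 0.\<close>
      have "(\<lambda>x. E (Complex x y) - F n (Complex x y)) = poisson (\<lambda>t. f t - g n t) y"
        using EP[OF elim(2)] hardy_poisson[OF F elim(2)] poisson_diff[OF f gL elim(2)] by auto
      then have 1: "l2_norm (\<lambda>x. E (Complex x y) - F n (Complex x y)) < e / 3"
        using poisson_contraction(2)[OF L2_diff[OF f gL] elim(2), of n] n by simp
      have "l2_norm (\<lambda>x. E (Complex x y) - f x) \<le> l2_norm (\<lambda>x. E (Complex x y) - F n (Complex x y)) + l2_norm (\<lambda>x. F n (Complex x y) - f x)"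
        by (rule l2_norm_triangle_diff[OF EL[OF elim(2)] FL f])
      also have "l2_norm (\<lambda>x. F n (Complex x y) - f x) \<le> l2_norm (\<lambda>x. F n (Complex x y) - g n x) + l2_norm (\<lambda>x. g n x - f x)"
        by (rule l2_norm_triangle_diff[OF FL gL f])
      finally have "l2_norm (\<lambda>x. E (Complex x y) - f x) < e"
        using 1 elim(1) n l2_norm_minus[of f "g n"] by linarith
      then show ?case by simp
    qed
  qed
  have "\<forall>\<^sub>F y in at_right 0. (\<lambda>x. E (Complex x y) - f x) \<in> L2"
    by (intro eventually_at_right_0I L2_diff EL f)
  then have "hardy_ext E ((l2_norm f)\<^sup>2) f"
    using f hol conv EL Eb by (auto simp: hardy_ext_def L2_norm_sq_tendsto_0_iff L2_norm_sq_le_iff)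
  then show ?thesis by (auto simp: H2_plus_iff)
qed

text \<open>A majorant common to all lines supplies both requirements of the space: the uniform
  bound and, by dominated convergence, the \<open>L2\<close> boundary limit.\<close>

lemma H2_plus_dominated:
  assumes hol: "F holomorphic_on {z. 0 < Im z}" and K: "K \<in> L2" and f: "f \<in> borel_measurable lborel"
    and bd: "AE x in lborel. \<forall>y>0. cmod (F (Complex x y)) \<le> cmod (K x)"
    and lim: "AE x in lborel. ((\<lambda>y. F (Complex x y)) \<longlongrightarrow> f x) (at_right 0)"
  shows "f \<in> H2_plus"
proof -
  have meas: "(\<lambda>x. F (Complex x y)) \<in> borel_measurable lborel" if "0 < y" for y
    by (rule holomorphic_upper_measurable(2)[OF hol that])
  have fl: "f \<in> L2" "((\<lambda>y. L2_norm_sq (\<lambda>x. F (Complex x y) - f x)) \<longlongrightarrow> 0) (at_right 0)"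
    by (rule L2_dominated_convergence[OF f K, where b = 1 and f = "\<lambda>y x. F (Complex x y)"];
        use meas bd lim in \<open>auto elim: eventually_mono\<close>)+
  have "L2_norm_sq (\<lambda>x. F (Complex x y)) \<le> ennreal ((l2_norm K)\<^sup>2)" if "0 < y" for y
  proof -
    note * = L2_dominated[OF K meas[OF that]]
    have "AE x in lborel. cmod (F (Complex x y)) \<le> cmod (K x)"
      using bd that by (auto elim: eventually_mono)
    with * show ?thesis by (simp add: L2_norm_sq_le_iff)
  qed
  then have "hardy_ext F ((l2_norm K)\<^sup>2) f"
    using fl hol by (auto simp: hardy_ext_def)
  then show ?thesis by (auto simp: H2_plus_iff)
qed

text \<open>The reflection \<open>cnj \<circ> F \<circ> cnj\<close> exchanges the half-planes and
  preserves holomorphy; the analysis can therefore be done in the upper one.\<close>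

lemma H2_minus_iff: "f \<in> H2_minus \<longleftrightarrow> (\<lambda>x. cnj (f x)) \<in> H2_plus"
proof -
  have img: "cnj ` {z. Im z < 0} = {z. 0 < Im z}" "cnj ` {z. 0 < Im z} = {z. Im z < 0}"
    by (auto simp: image_iff intro!: exI[of _ "cnj _"])
  have op: "open {z. Im z < 0}" "open {z. 0 < Im z}"
    by (rule open_halfspace_Im_lt open_halfspace_Im_gt)+
  have refl: "Complex x (- y) = cnj (Complex x y)" for x y
    by (simp add: complex_eq_iff)
  have SUP: "(SUP y\<in>{..<0}. P y) = (SUP y\<in>{0<..}. P (- y))" for P :: "real \<Rightarrow> ennreal"
  proof -
    have "{..<0::real} = uminus ` {0<..}" by simp
    then show ?thesis by (simp only: image_image)
  qed
  have conv: "L2_norm_sq (\<lambda>x. cnj (u x) - cnj (v x)) = L2_norm_sq (\<lambda>x. u x - v x)" for u v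
    using L2_norm_sq_cnj[of "\<lambda>x. u x - v x"] by simp
  have conv': "L2_norm_sq (\<lambda>x. cnj (u x) - v x) = L2_norm_sq (\<lambda>x. u x - cnj (v x))" for u v
    using conv[of u "\<lambda>x. cnj (v x)"] by simp
  show ?thesis
  proof
    assume "f \<in> H2_minus"
    then obtain F where F: "f \<in> L2" "F holomorphic_on {z. Im z < 0}"
      "(SUP y\<in>{..<0}. L2_norm_sq (\<lambda>x. F (Complex x y))) < \<infinity>"
      "((\<lambda>y. L2_norm_sq (\<lambda>x. F (Complex x y) - f x)) \<longlongrightarrow> 0) (at_left 0)"
      by (auto simp: H2_minus_def)
    have "(cnj \<circ> F \<circ> cnj) holomorphic_on {z. 0 < Im z}"
      using holomorphic_on_compose_cnj_cnj[of F "{z. 0 < Im z}"] F(2) op by (simp add: img)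
    moreover have "(SUP y\<in>{0<..}. L2_norm_sq (\<lambda>x. (cnj \<circ> F \<circ> cnj) (Complex x y))) < \<infinity>"
      using F(3) by (simp add: SUP L2_norm_sq_cnj refl)
    moreover have "((\<lambda>y. L2_norm_sq (\<lambda>x. (cnj \<circ> F \<circ> cnj) (Complex x y) - cnj (f x))) \<longlongrightarrow> 0) (at_right 0)"
      using F(4) unfolding filterlim_at_left_to_right by (simp add: conv refl)
    ultimately show "(\<lambda>x. cnj (f x)) \<in> H2_plus"
      using F(1) by (auto simp: H2_plus_def L2_cnj)
  next
    assume "(\<lambda>x. cnj (f x)) \<in> H2_plus"
    then obtain F where F: "f \<in> L2" "F holomorphic_on {z. 0 < Im z}"
      "(SUP y\<in>{0<..}. L2_norm_sq (\<lambda>x. F (Complex x y))) < \<infinity>"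
      "((\<lambda>y. L2_norm_sq (\<lambda>x. F (Complex x y) - cnj (f x))) \<longlongrightarrow> 0) (at_right 0)"
      by (auto simp: H2_plus_def L2_cnj)
    have "(cnj \<circ> F \<circ> cnj) holomorphic_on {z. Im z < 0}"
      using holomorphic_on_compose_cnj_cnj[of F "{z. Im z < 0}"] F(2) op by (simp add: img)
    moreover have "(SUP y\<in>{..<0}. L2_norm_sq (\<lambda>x. (cnj \<circ> F \<circ> cnj) (Complex x y))) < \<infinity>"
      using F(3) by (simp add: SUP L2_norm_sq_cnj refl)
    moreover have "((\<lambda>y. L2_norm_sq (\<lambda>x. (cnj \<circ> F \<circ> cnj) (Complex x y) - f x)) \<longlongrightarrow> 0) (at_left 0)"
      using F(4) unfolding filterlim_at_left_to_right by (simp add: conv' refl)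
    ultimately show "f \<in> H2_minus"
      using F(1) by (auto simp: H2_minus_def)
  qed
qed

section \<open>Closed subspaces\<close>

text \<open>Closedness is phrased by approximation in \<open>l2_norm\<close>; in particular such a
  set contains every \<open>L2\<close> function that agrees almost everywhere with a member.\<close>

definition closed_subspace :: "(real \<Rightarrow> complex) set \<Rightarrow> bool" where
  "closed_subspace S \<longleftrightarrow> S \<subseteq> L2 \<and>
     (\<forall>f\<in>S. \<forall>g\<in>S. (\<lambda>x. f x + g x) \<in> S) \<and> (\<forall>f\<in>S. \<forall>c. (\<lambda>x. c * f x) \<in> S) \<and> (\<lambda>x. 0) \<in> S \<and>
     (\<forall>f\<in>L2. (\<forall>\<epsilon>>0. \<exists>g\<in>S. l2_norm (\<lambda>x. f x - g x) < \<epsilon>) \<longrightarrow> f \<in> S)"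

lemma closed_subspaceD:
  assumes "closed_subspace S"
  shows "f \<in> S \<Longrightarrow> f \<in> L2"
    and "f \<in> S \<Longrightarrow> g \<in> S \<Longrightarrow> (\<lambda>x. f x + g x) \<in> S"
    and "f \<in> S \<Longrightarrow> (\<lambda>x. c * f x) \<in> S"
    and "f \<in> L2 \<Longrightarrow> (\<And>\<epsilon>. 0 < \<epsilon> \<Longrightarrow> \<exists>g\<in>S. l2_norm (\<lambda>x. f x - g x) < \<epsilon>) \<Longrightarrow> f \<in> S"
  using assms unfolding closed_subspace_def by blast+

lemma closed_subspace_limit:
  assumes S: "closed_subspace S" and f: "f \<in> L2"
    and lim: "((\<lambda>y. l2_norm (\<lambda>x. F y x - f x)) \<longlongrightarrow> 0) (at_right (0::real))"
    and F: "\<And>y. 0 < y \<Longrightarrow> y < b \<Longrightarrow> F y \<in> S" and "0 < b"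
  shows "f \<in> S"
proof (rule closed_subspaceD(4)[OF S f])
  fix \<epsilon> :: real assume "0 < \<epsilon>"
  have "\<forall>\<^sub>F y in at_right 0. l2_norm (\<lambda>x. F y x - f x) < \<epsilon>"
    using lim \<open>0 < \<epsilon>\<close> by (rule order_tendstoD(2))
  moreover have "\<forall>\<^sub>F y in at_right 0. F y \<in> S"
    using F \<open>0 < b\<close> unfolding eventually_at_right_field by blast
  ultimately have "\<forall>\<^sub>F y in at_right (0::real). l2_norm (\<lambda>x. F y x - f x) < \<epsilon> \<and> F y \<in> S"
    by eventually_elim simp
  then obtain y where "l2_norm (\<lambda>x. F y x - f x) < \<epsilon>" "F y \<in> S"
    using eventually_happens'[OF trivial_limit_at_right_real] by blast
  then show "\<exists>g\<in>S. l2_norm (\<lambda>x. f x - g x) < \<epsilon>"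
    by (auto simp: l2_norm_minus[of f])
qed

lemma L2_closed_span_iff:
  assumes e: "\<And>t. t \<in> I \<Longrightarrow> e t \<in> L2"
  shows "g \<in> L2_closed_span I e \<longleftrightarrow> g \<in> L2 \<and>
    (\<forall>\<epsilon>>0. \<exists>T c. finite T \<and> T \<subseteq> I \<and> l2_norm (\<lambda>x. g x - (\<Sum>t\<in>T. c t * e t x)) < \<epsilon>)"
    (is "?l \<longleftrightarrow> ?r")
proof -
  have L: "(\<lambda>x. g x - (\<Sum>t\<in>T. c t * e t x)) \<in> L2" if "g \<in> L2" "T \<subseteq> I" for T c
    using that e by (intro L2_diff L2_sum L2_scale) auto
  have n: "L2_norm_sq (\<lambda>x. g x - (\<Sum>t\<in>T. c t * e t x)) = ennreal ((l2_norm (\<lambda>x. g x - (\<Sum>t\<in>T. c t * e t x)))\<^sup>2)"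
    if "g \<in> L2" "T \<subseteq> I" for T c
    by (rule L2_norm_sq_eq[OF L[OF that]])
  show ?thesis
  proof
    assume l: ?l
    then have g: "g \<in> L2" by (simp add: L2_closed_span_def)
    show ?r
    proof (intro conjI g allI impI)
      fix \<epsilon> :: real assume "0 < \<epsilon>"
      then have "0 < ennreal (\<epsilon>\<^sup>2)" by simp
      then obtain T c where T: "finite T" "T \<subseteq> I" "L2_norm_sq (\<lambda>x. g x - (\<Sum>t\<in>T. c t * e t x)) < ennreal (\<epsilon>\<^sup>2)"
        using l unfolding L2_closed_span_def by blast
      then have "(l2_norm (\<lambda>x. g x - (\<Sum>t\<in>T. c t * e t x)))\<^sup>2 < \<epsilon>\<^sup>2"
        using n[OF g T(2)] by (simp add: ennreal_less_iff)
      then have "l2_norm (\<lambda>x. g x - (\<Sum>t\<in>T. c t * e t x)) < \<epsilon>"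
        by (rule power2_less_imp_less) (use \<open>0 < \<epsilon>\<close> in auto)
      with T show "\<exists>T c. finite T \<and> T \<subseteq> I \<and> l2_norm (\<lambda>x. g x - (\<Sum>t\<in>T. c t * e t x)) < \<epsilon>" by blast
    qed
  next
    assume r: ?r
    then have g: "g \<in> L2" by simp
    show ?l unfolding L2_closed_span_def
    proof (intro CollectI conjI g allI impI)
      fix \<epsilon> :: ennreal assume "0 < \<epsilon>"
      then obtain d where d: "0 < d" "ennreal (d\<^sup>2) \<le> \<epsilon>"
      proof (cases \<epsilon>)
        case (real r)
        then have "0 < r" using \<open>0 < \<epsilon>\<close> by simp
        then show ?thesis using that[of "sqrt r"] real by simp
      next
        case top
        then show ?thesis using that[of 1] by simp
      qed
      then obtain T c where T: "finite T" "T \<subseteq> I" "l2_norm (\<lambda>x. g x - (\<Sum>t\<in>T. c t * e t x)) < d"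
        using r by blast
      then have "ennreal ((l2_norm (\<lambda>x. g x - (\<Sum>t\<in>T. c t * e t x)))\<^sup>2) < ennreal (d\<^sup>2)"
        using d(1) by (intro ennreal_lessI power_strict_mono) auto
      then have "L2_norm_sq (\<lambda>x. g x - (\<Sum>t\<in>T. c t * e t x)) < \<epsilon>"
        using n[OF g T(2)] d by (metis less_le_trans)
      with T show "\<exists>T c. finite T \<and> T \<subseteq> I \<and> L2_norm_sq (\<lambda>x. g x - (\<Sum>t\<in>T. c t * e t x)) < \<epsilon>" by blast
    qed
  qed
qed

lemma closed_subspace_span:
  assumes e: "\<And>t. t \<in> I \<Longrightarrow> e t \<in> L2"
  shows "closed_subspace (L2_closed_span I e)" "t \<in> I \<Longrightarrow> e t \<in> L2_closed_span I e"
proof -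
  have iff: "g \<in> L2_closed_span I e \<longleftrightarrow> g \<in> L2 \<and>
    (\<forall>\<epsilon>>0. \<exists>T c. finite T \<and> T \<subseteq> I \<and> l2_norm (\<lambda>x. g x - (\<Sum>t\<in>T. c t * e t x)) < \<epsilon>)" for g
    by (rule L2_closed_span_iff[OF e])
  have L: "(\<lambda>x. \<Sum>t\<in>T. c t * e t x) \<in> L2" if "T \<subseteq> I" for T c
    using that e by (intro L2_sum L2_scale) auto
  show "e t \<in> L2_closed_span I e" if "t \<in> I"
    unfolding iff
  proof (intro conjI allI impI)
    fix \<epsilon> :: real assume "0 < \<epsilon>"
    have "l2_norm (\<lambda>x. e t x - (\<Sum>t\<in>{t}. 1 * e t x)) < \<epsilon>" using \<open>0 < \<epsilon>\<close> by (simp add: l2_norm_def)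
    then show "\<exists>T c. finite T \<and> T \<subseteq> I \<and> l2_norm (\<lambda>x. e t x - (\<Sum>t\<in>T. c t * e t x)) < \<epsilon>"
      using that by (intro exI[of _ "{t}"] exI[of _ "\<lambda>_. 1"]) auto
  qed (rule e[OF that])
  show "closed_subspace (L2_closed_span I e)"
    unfolding closed_subspace_def
  proof (intro conjI ballI allI impI)
    show "L2_closed_span I e \<subseteq> L2" by (auto simp: L2_closed_span_def)
  next
    fix f g assume fg: "f \<in> L2_closed_span I e" "g \<in> L2_closed_span I e"
    then have fgL: "f \<in> L2" "g \<in> L2" by (auto simp: L2_closed_span_def)
    show "(\<lambda>x. f x + g x) \<in> L2_closed_span I e"
      unfolding iff
    proof (intro conjI allI impI)
      show "(\<lambda>x. f x + g x) \<in> L2" by (rule L2_add[OF fgL])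
      fix \<epsilon> :: real assume "0 < \<epsilon>"
      then have "0 < \<epsilon> / 2" by simp
      with fg obtain T c T' c' where T: "finite T" "T \<subseteq> I" "l2_norm (\<lambda>x. f x - (\<Sum>t\<in>T. c t * e t x)) < \<epsilon> / 2"
        and T': "finite T'" "T' \<subseteq> I" "l2_norm (\<lambda>x. g x - (\<Sum>t\<in>T'. c' t * e t x)) < \<epsilon> / 2"
        unfolding iff by meson
      \<comment> \<open>Coefficients add on the overlap of \<open>T\<close> and \<open>T'\<close>;
        each family counts as zero outside its own set.\<close>
      define b where "b t = (if t \<in> T then c t else 0) + (if t \<in> T' then c' t else 0)" for t
      have "(\<Sum>t\<in>T \<union> T'. b t * e t x) = (\<Sum>t\<in>T. c t * e t x) + (\<Sum>t\<in>T'. c' t * e t x)" for x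
      proof -
        have "(\<Sum>t\<in>T \<union> T'. b t * e t x) = (\<Sum>t\<in>T \<union> T'. (if t \<in> T then c t * e t x else 0))
           + (\<Sum>t\<in>T \<union> T'. (if t \<in> T' then c' t * e t x else 0))"
          unfolding sum.distrib[symmetric] by (intro sum.cong) (auto simp: b_def algebra_simps)
        also have "(\<Sum>t\<in>T \<union> T'. (if t \<in> T then c t * e t x else 0)) = (\<Sum>t\<in>T. c t * e t x)"
          using T T' by (intro sum.mono_neutral_cong_right) auto
        also have "(\<Sum>t\<in>T \<union> T'. (if t \<in> T' then c' t * e t x else 0)) = (\<Sum>t\<in>T'. c' t * e t x)"
          using T T' by (intro sum.mono_neutral_cong_right) auto
        finally show ?thesis .
      qed
      then have "l2_norm (\<lambda>x. f x + g x - (\<Sum>t\<in>T \<union> T'. b t * e t x)) =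
        l2_norm (\<lambda>x. (f x - (\<Sum>t\<in>T. c t * e t x)) + (g x - (\<Sum>t\<in>T'. c' t * e t x)))"
        by (simp add: algebra_simps)
      also have "\<dots> \<le> l2_norm (\<lambda>x. f x - (\<Sum>t\<in>T. c t * e t x)) + l2_norm (\<lambda>x. g x - (\<Sum>t\<in>T'. c' t * e t x))"
        by (intro l2_norm_triangle L2_diff fgL L T T')
      also have "\<dots> < \<epsilon>" using T T' by simp
      finally show "\<exists>T c. finite T \<and> T \<subseteq> I \<and> l2_norm (\<lambda>x. f x + g x - (\<Sum>t\<in>T. c t * e t x)) < \<epsilon>"
        using T T' by (intro exI[of _ "T \<union> T'"] exI[of _ b]) auto
    qed
  next
    fix f a assume f: "f \<in> L2_closed_span I e"
    then have fL: "f \<in> L2" by (auto simp: L2_closed_span_def)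
    show "(\<lambda>x. a * f x) \<in> L2_closed_span I e"
      unfolding iff
    proof (intro conjI allI impI)
      show "(\<lambda>x. a * f x) \<in> L2" by (rule L2_scale[OF fL])
      fix \<epsilon> :: real assume "0 < \<epsilon>"
      \<comment> \<open>The summand 1 avoids a division by zero when \<open>a = 0\<close>.\<close>
      then have "0 < \<epsilon> / (cmod a + 1)" by (simp add: add_nonneg_pos)
      with f obtain T c where T: "finite T" "T \<subseteq> I" "l2_norm (\<lambda>x. f x - (\<Sum>t\<in>T. c t * e t x)) < \<epsilon> / (cmod a + 1)"
        unfolding iff by meson
      have "l2_norm (\<lambda>x. a * f x - (\<Sum>t\<in>T. (a * c t) * e t x)) = l2_norm (\<lambda>x. a * (f x - (\<Sum>t\<in>T. c t * e t x)))"
        by (simp add: right_diff_distrib sum_distrib_left mult.assoc)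
      also have "\<dots> = cmod a * l2_norm (\<lambda>x. f x - (\<Sum>t\<in>T. c t * e t x))"
        by (intro L2_scale L2_diff fL L T)
      also have "\<dots> \<le> (cmod a + 1) * l2_norm (\<lambda>x. f x - (\<Sum>t\<in>T. c t * e t x))"
        by (intro mult_right_mono) auto
      also have "\<dots> < (cmod a + 1) * (\<epsilon> / (cmod a + 1))"
        using T(3) by (intro mult_strict_left_mono) (auto simp: add_nonneg_pos)
      also have "\<dots> = \<epsilon>"
      proof -
        have "cmod a + 1 \<noteq> 0" using norm_ge_zero[of a] by linarith
        then show ?thesis by simp
      qed
      finally show "\<exists>T c. finite T \<and> T \<subseteq> I \<and> l2_norm (\<lambda>x. a * f x - (\<Sum>t\<in>T. c t * e t x)) < \<epsilon>"
        using T by (intro exI[of _ T] exI[of _ "\<lambda>t. a * c t"]) auto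
    qed
  next
    show "(\<lambda>x. 0) \<in> L2_closed_span I e"
      unfolding iff by (auto simp: L2_zero l2_norm_def intro!: exI[of _ "{}"])
  next
    fix f assume f: "f \<in> L2" and app: "\<forall>\<epsilon>>0. \<exists>g\<in>L2_closed_span I e. l2_norm (\<lambda>x. f x - g x) < \<epsilon>"
    show "f \<in> L2_closed_span I e"
      unfolding iff
    proof (intro conjI f allI impI)
      fix \<epsilon> :: real assume "0 < \<epsilon>"
      then have e2: "0 < \<epsilon> / 2" by simp
      with app obtain g where g: "g \<in> L2_closed_span I e" "l2_norm (\<lambda>x. f x - g x) < \<epsilon> / 2" by blast
      with e2 obtain T c where T: "finite T" "T \<subseteq> I" "l2_norm (\<lambda>x. g x - (\<Sum>t\<in>T. c t * e t x)) < \<epsilon> / 2"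
        unfolding iff by meson
      have "g \<in> L2" using g by (auto simp: L2_closed_span_def)
      then have "l2_norm (\<lambda>x. f x - (\<Sum>t\<in>T. c t * e t x)) \<le> l2_norm (\<lambda>x. f x - g x) + l2_norm (\<lambda>x. g x - (\<Sum>t\<in>T. c t * e t x))"
        by (intro l2_norm_triangle_diff f L T)
      then show "\<exists>T c. finite T \<and> T \<subseteq> I \<and> l2_norm (\<lambda>x. f x - (\<Sum>t\<in>T. c t * e t x)) < \<epsilon>"
        using g T by (intro exI[of _ T] exI[of _ c]) auto
    qed
  qed
qed

section \<open>Almost minimal distance, and integrals of families in a closed subspace\<close>

lemma norm_diff_sq_complex: "(cmod (u - v))\<^sup>2 = (cmod u)\<^sup>2 - 2 * Re (cnj v * u) + (cmod v)\<^sup>2"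
  unfolding cmod_power2 by (simp add: power2_eq_square algebra_simps)

text \<open>A variational argument with a margin. Moving \<open>v\<close> by the best multiple of
  \<open>w\<close> lowers the squared distance by \<open>(cmod ip / n)\<^sup>2\<close>; as that
  distance exceeds the lower bound \<open>d\<close> by at most \<open>\<delta>\<^sup>2\<close>, so
  does the gain not exceed \<open>\<delta>\<^sup>2\<close>.\<close>

lemma almost_orthogonal:
  assumes S: "closed_subspace S" and g: "g \<in> L2"
    and d: "\<And>v. v \<in> S \<Longrightarrow> d \<le> (l2_norm (\<lambda>x. g x - v x))\<^sup>2"
    and v: "v \<in> S" "(l2_norm (\<lambda>x. g x - v x))\<^sup>2 \<le> d + \<delta>\<^sup>2" "0 \<le> \<delta>" and w: "w \<in> S"
  shows "cmod (\<integral>x. cnj (w x) * (g x - v x) \<partial>lborel) \<le> \<delta> * l2_norm w"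
proof -
  define r where "r = (\<lambda>x. g x - v x)"
  define ip where "ip = (\<integral>x. cnj (w x) * r x \<partial>lborel)"
  have wL: "w \<in> L2" and vL: "v \<in> L2" using closed_subspaceD(1)[OF S] w v by auto
  have rL: "r \<in> L2" unfolding r_def by (rule L2_diff[OF g vL])
  have i: "integrable lborel (\<lambda>x. cnj (w x) * r x)"
    by (rule L2_mult_integrable) (simp_all add: L2_cnj wL rL)
  have ncnj: "l2_norm (\<lambda>x. cnj (w x)) = l2_norm w" by (simp add: l2_norm_def)
  show ?thesis
  proof (cases "l2_norm w = 0")
    case True
    then show ?thesis
      using L2_cauchy_schwarz(2)[of "\<lambda>x. cnj (w x)" r] rL wL ncnj by (simp add: L2_cnj r_def)
  next
    case False
    define n where "n = l2_norm w"
    have n: "0 < n" using False l2_norm_nonneg[of w] unfolding n_def by linarith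
    \<comment> \<open>The coefficient of the orthogonal projection of \<open>r\<close> onto
      \<open>w\<close>, which minimises the norm of \<open>r - c * w\<close>.\<close>
    define c where "c = ip / of_real (n\<^sup>2)"
    have "(\<lambda>x. v x + c * w x) \<in> S"
      using closed_subspaceD(2,3)[OF S] v w by blast
    from d[OF this] have "d \<le> (l2_norm (\<lambda>x. r x - c * w x))\<^sup>2"
      by (simp add: r_def algebra_simps)
    also have "\<dots> = (\<integral>x. (cmod (r x))\<^sup>2 - 2 * Re (cnj c * (cnj (w x) * r x)) + (cmod c)\<^sup>2 * (cmod (w x))\<^sup>2 \<partial>lborel)"
      unfolding l2_norm_power2
    proof (rule Bochner_Integration.integral_cong[OF refl])
      fix x
      show "(cmod (r x - c * w x))\<^sup>2 = (cmod (r x))\<^sup>2 - 2 * Re (cnj c * (cnj (w x) * r x)) + (cmod c)\<^sup>2 * (cmod (w x))\<^sup>2"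
        using norm_diff_sq_complex[of "r x" "c * w x"]
        by (simp add: norm_mult power_mult_distrib mult_ac)
    qed
    also have "\<dots> = (l2_norm r)\<^sup>2 - 2 * (\<integral>x. Re (cnj c * (cnj (w x) * r x)) \<partial>lborel) + (cmod c)\<^sup>2 * n\<^sup>2"
    proof -
      define q where "q x = Re (cnj c * (cnj (w x) * r x))" for x
      have "integrable lborel q"
        unfolding q_def by (intro integrable_Re integrable_mult_right i)
      then show ?thesis
        using L2_integrable_sq[OF rL] L2_integrable_sq[OF wL]
        unfolding q_def[symmetric] by (simp add: l2_norm_power2 n_def)
    qed
    also have "(\<integral>x. Re (cnj c * (cnj (w x) * r x)) \<partial>lborel) = Re (cnj c * ip)"
    proof -
      have "(\<integral>x. Re (cnj c * (cnj (w x) * r x)) \<partial>lborel) = Re (\<integral>x. cnj c * (cnj (w x) * r x) \<partial>lborel)"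
        by (intro integral_Re integrable_mult_right i)
      then show ?thesis by (simp only: ip_def integral_mult_right_zero)
    qed
    also have "Re (cnj c * ip) = (cmod ip)\<^sup>2 / n\<^sup>2"
    proof -
      have "cnj c * ip = of_real ((cmod ip)\<^sup>2 / n\<^sup>2)"
        unfolding c_def of_real_divide complex_norm_square by simp
      then show ?thesis by simp
    qed
    also have "(cmod c)\<^sup>2 * n\<^sup>2 = (cmod ip)\<^sup>2 / n\<^sup>2"
    proof -
      have "cmod c = cmod ip / n\<^sup>2" by (simp add: c_def norm_divide norm_power)
      then show ?thesis using n by (simp add: power2_eq_square)
    qed
    finally have "(cmod ip)\<^sup>2 / n\<^sup>2 \<le> \<delta>\<^sup>2" using v(2) by (simp add: r_def)
    then have "(cmod ip)\<^sup>2 \<le> (\<delta> * n)\<^sup>2" using n by (simp add: field_simps power_mult_distrib)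
    then have "cmod ip \<le> \<delta> * n"
      by (rule power2_le_imp_le) (use v n in auto)
    then show ?thesis by (simp add: ip_def n_def r_def)
  qed
qed

text \<open>
  An almost minimising residual is almost orthogonal to the subspace, hence by Fubini to the integral
  itself, so the distance is zero. Neither completeness nor Riemann sums are needed.
\<close>

lemma closed_subspace_integral:
  assumes S: "closed_subspace S" and E: "\<And>t. E t \<in> S" and K: "K \<in> L2"
    and bd: "\<And>t x. cmod (E t x) \<le> cmod (K x)"
    and meas: "case_prod E \<in> borel_measurable (lborel \<Otimes>\<^sub>M lborel)"
    and c: "integrable lborel c"
  shows "(\<lambda>x. \<integral>t. c t * E t x \<partial>lborel) \<in> S"
proof -
  define g where "g = (\<lambda>x. \<integral>t. c t * E t x \<partial>lborel)"
  define C where "C = (\<integral>t. cmod (c t) \<partial>lborel)"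
  note [measurable] = meas
  have [measurable]: "c \<in> borel_measurable lborel" "K \<in> borel_measurable lborel"
    using c K by (auto simp: L2_iff)
  have EL: "E t \<in> L2" "l2_norm (E t) \<le> l2_norm K" for t
  proof -
    show "E t \<in> L2" by (rule closed_subspaceD(1)[OF S E])
    then have "E t \<in> borel_measurable lborel" by (simp add: L2_iff)
    from L2_dominated(2)[OF K this] show "l2_norm (E t) \<le> l2_norm K" using bd by simp
  qed
  have C0: "0 \<le> C" by (simp add: C_def)
  have "cmod (g x) \<le> cmod (of_real C * K x)" for x
  proof -
    have "cmod (g x) \<le> (\<integral>t. cmod (c t * E t x) \<partial>lborel)"
      unfolding g_def by (rule integral_norm_bound)
    also have "\<dots> \<le> (\<integral>t. cmod (c t) * cmod (K x) \<partial>lborel)"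
    proof (rule integral_mono')
      show "integrable lborel (\<lambda>t. cmod (c t) * cmod (K x))" using c by auto
    qed (auto simp: norm_mult intro!: mult_left_mono bd)
    finally show ?thesis using C0 by (simp add: norm_mult C_def)
  qed
  moreover have gm: "g \<in> borel_measurable lborel"
    unfolding g_def by measurable
  ultimately have g: "g \<in> L2"
    using L2_dominated(1)[OF L2_scale(1)[OF K]] by blast
  show ?thesis
    unfolding g_def[symmetric]
  proof (rule closed_subspaceD(4)[OF S g], rule ccontr)
    fix \<epsilon> :: real assume "0 < \<epsilon>" and no: "\<not> (\<exists>v\<in>S. l2_norm (\<lambda>x. g x - v x) < \<epsilon>)"
    define d where "d = (INF v\<in>S. (l2_norm (\<lambda>x. g x - v x))\<^sup>2)"
    have ne: "S \<noteq> {}" using E by auto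
    have bdd: "bdd_below ((\<lambda>v. (l2_norm (\<lambda>x. g x - v x))\<^sup>2) ` S)" by (rule bdd_belowI2[of _ 0]) simp
    have dv: "d \<le> (l2_norm (\<lambda>x. g x - v x))\<^sup>2" if "v \<in> S" for v
      unfolding d_def by (rule cINF_lower[OF bdd that])
    have "\<epsilon>\<^sup>2 \<le> d"
      unfolding d_def using no \<open>0 < \<epsilon>\<close> by (intro cINF_greatest[OF ne] power_mono) (auto simp: not_less)
    then have d0: "0 < d" using \<open>0 < \<epsilon>\<close> by (smt (verit) zero_less_power)
    \<comment> \<open>For a residual \<open>r = g - v\<close>, \<open>(l2_norm r)\<^sup>2\<close> is
      the inner product with \<open>g\<close> minus that with \<open>v\<close>. Divided by
      \<open>\<delta>\<close>, these are bounded by \<open>C * l2_norm K\<close> and by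
      \<open>l2_norm g + sqrt (d + 1)\<close>, the latter estimating
      \<open>l2_norm v\<close>.\<close>
    define Q where "Q = C * l2_norm K + l2_norm g + sqrt (d + 1)"
    have dQ: "d \<le> \<delta> * Q" if \<delta>: "0 < \<delta>" "\<delta> \<le> 1" for \<delta>
    proof -
      have "\<exists>v\<in>S. (l2_norm (\<lambda>x. g x - v x))\<^sup>2 < d + \<delta>\<^sup>2"
        using \<delta> cINF_less_iff[OF ne bdd, of "d + \<delta>\<^sup>2"] by (simp add: d_def)
      then obtain v where v: "v \<in> S" "(l2_norm (\<lambda>x. g x - v x))\<^sup>2 < d + \<delta>\<^sup>2" by blast
      define r where "r = (\<lambda>x. g x - v x)"
      have vL: "v \<in> L2" by (rule closed_subspaceD(1)[OF S v(1)])
      have rL: "r \<in> L2" unfolding r_def by (rule L2_diff[OF g vL])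
      have [measurable]: "r \<in> borel_measurable lborel" using rL by (simp add: L2_iff)
      have orth: "cmod (\<integral>x. cnj (w x) * r x \<partial>lborel) \<le> \<delta> * l2_norm w" if "w \<in> S" for w
        unfolding r_def using almost_orthogonal[OF S g dv v(1) less_imp_le[OF v(2)] _ that] \<delta> by simp
      have "(l2_norm r)\<^sup>2 \<le> d + 1" using v(2) \<delta> power_le_one[of \<delta> 2] by (simp add: r_def)
      then have rb: "l2_norm r \<le> sqrt (d + 1)" by (rule real_le_rsqrt)
      have "l2_norm v \<le> l2_norm g + l2_norm r"
        unfolding r_def using l2_norm_triangle_le[OF vL g] l2_norm_minus[of v g] by linarith
      then have 1: "cmod (\<integral>x. cnj (v x) * r x \<partial>lborel) \<le> \<delta> * (l2_norm g + sqrt (d + 1))"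
        using rb \<delta> by (intro order_trans[OF orth[OF v(1)]] mult_left_mono) auto
      have Kr: "integrable lborel (\<lambda>x. cmod (K x) * cmod (r x))"
        using integrable_norm[OF L2_mult_integrable[OF K rL]] by (simp add: norm_mult)
      have 2: "cmod (\<integral>x. cnj (g x) * r x \<partial>lborel) \<le> \<delta> * (C * l2_norm K)"
      proof -
        let ?f = "\<lambda>t x. cnj (c t) * (cnj (E t x) * r x)"
        have [measurable]: "(\<lambda>p. cnj (E (fst p) (snd p))) \<in> borel_measurable (lborel \<Otimes>\<^sub>M lborel)"
          by (rule borel_measurable_cnj) measurable
        have [measurable]: "(\<lambda>t. cnj (c t)) \<in> borel_measurable lborel"
          by (rule borel_measurable_cnj) measurable
        have fm: "(\<lambda>p. ?f (fst p) (snd p)) \<in> borel_measurable (lborel \<Otimes>\<^sub>M lborel)"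
          by measurable
        have iE: "integrable lborel (\<lambda>x. cnj (E t x) * r x)" for t
          by (rule L2_mult_integrable) (simp_all add: L2_cnj EL rL)
        have int: "integrable (lborel \<Otimes>\<^sub>M lborel) (\<lambda>p. ?f (fst p) (snd p))"
        proof (rule lborel_pair.Fubini_integrable)
          show "integrable lborel (\<lambda>t. \<integral>x. norm (?f (fst (t, x)) (snd (t, x))) \<partial>lborel)"
          proof (rule Bochner_Integration.integrable_bound[where f = "\<lambda>t. cmod (c t) * (\<integral>x. cmod (K x) * cmod (r x) \<partial>lborel)"])
            show "AE t in lborel. norm (\<integral>x. norm (?f (fst (t, x)) (snd (t, x))) \<partial>lborel)
                \<le> norm (cmod (c t) * (\<integral>x. cmod (K x) * cmod (r x) \<partial>lborel))"
            proof (rule AE_I2)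
              fix t
              have "(\<integral>x. norm (?f t x) \<partial>lborel) \<le> (\<integral>x. cmod (c t) * (cmod (K x) * cmod (r x)) \<partial>lborel)"
                using Kr bd by (intro integral_mono') (auto simp: norm_mult intro!: mult_left_mono mult_right_mono)
              then show "norm (\<integral>x. norm (?f (fst (t, x)) (snd (t, x))) \<partial>lborel)
                \<le> norm (cmod (c t) * (\<integral>x. cmod (K x) * cmod (r x) \<partial>lborel))"
                by simp
            qed
          qed (use c fm in auto)
          show "AE t in lborel. integrable lborel (\<lambda>x. ?f (fst (t, x)) (snd (t, x)))"
            using iE by auto
        qed (rule fm)
        have "cnj (g x) * r x = (\<integral>t. ?f t x \<partial>lborel)" for x
        proof -
          have "cnj (g x) = (\<integral>t. cnj (c t * E t x) \<partial>lborel)"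
            unfolding g_def by (rule Bochner_Integration.integral_cnj[symmetric])
          then show ?thesis
            by (simp add: mult.assoc[symmetric])
        qed
        then have "(\<integral>x. cnj (g x) * r x \<partial>lborel) = (\<integral>x. (\<integral>t. ?f t x \<partial>lborel) \<partial>lborel)" by simp
        also have "\<dots> = (\<integral>t. (\<integral>x. ?f t x \<partial>lborel) \<partial>lborel)"
          using lborel_pair.Fubini_integral[of ?f] int by (simp add: case_prod_beta')
        finally have eq: "(\<integral>x. cnj (g x) * r x \<partial>lborel) = (\<integral>t. cnj (c t) * (\<integral>x. cnj (E t x) * r x \<partial>lborel) \<partial>lborel)"
          by simp
        have "cmod (\<integral>x. cnj (g x) * r x \<partial>lborel) \<le> (\<integral>t. cmod (cnj (c t) * (\<integral>x. cnj (E t x) * r x \<partial>lborel)) \<partial>lborel)"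
          unfolding eq by (rule integral_norm_bound)
        also have "\<dots> \<le> (\<integral>t. cmod (c t) * (\<delta> * l2_norm K) \<partial>lborel)"
        proof (rule integral_mono')
          show "cmod (cnj (c t) * (\<integral>x. cnj (E t x) * r x \<partial>lborel)) \<le> cmod (c t) * (\<delta> * l2_norm K)" for t
            unfolding norm_mult complex_mod_cnj
            using \<delta>
            by (intro mult_left_mono[OF order_trans[OF orth[OF E] mult_left_mono[OF EL(2)]]]) auto
        qed (use c \<delta> in auto)
        finally show ?thesis by (simp add: C_def mult_ac)
      qed
      have "(l2_norm r)\<^sup>2 = cmod (of_real ((l2_norm r)\<^sup>2))" by (simp only: norm_of_real abs_power2)
      also have "complex_of_real ((l2_norm r)\<^sup>2) = (\<integral>x. cnj (g x) * r x - cnj (v x) * r x \<partial>lborel)"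
        unfolding l2_norm_power2 integral_complex_of_real[symmetric] complex_norm_square
        by (intro Bochner_Integration.integral_cong) (auto simp: r_def algebra_simps)
      also have "\<dots> = (\<integral>x. cnj (g x) * r x \<partial>lborel) - (\<integral>x. cnj (v x) * r x \<partial>lborel)"
        by (intro Bochner_Integration.integral_diff L2_mult_integrable) (simp_all add: L2_cnj g vL rL)
      finally have "(l2_norm r)\<^sup>2 \<le> cmod (\<integral>x. cnj (g x) * r x \<partial>lborel) + cmod (\<integral>x. cnj (v x) * r x \<partial>lborel)"
        using norm_triangle_ineq4 by metis
      also have "\<dots> \<le> \<delta> * Q" using 1 2 by (simp add: Q_def algebra_simps)
      finally show "d \<le> \<delta> * Q" using dv[OF v(1)] by (simp add: r_def)
    qed
    have Q0: "0 < Q" using dQ[of 1] d0 by simp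
    \<comment> \<open>This \<open>\<delta>\<close> is at most 1 and brings the bound down to
      \<open>d / 2\<close>, below the positive \<open>d\<close>.\<close>
    have "d \<le> min 1 (d / (2 * Q)) * Q" using d0 Q0 by (intro dQ) auto
    also have "\<dots> \<le> d / (2 * Q) * Q" using Q0 by (intro mult_right_mono) auto
    also have "\<dots> = d / 2" using Q0 by simp
    finally show False using d0 by simp
  qed
qed

section \<open>The analytic continuation\<close>

lemma has_bochner_integral_exp_halfline:
  fixes q :: complex
  assumes q: "Re q < 0"
  shows "has_bochner_integral lborel (\<lambda>s. indicator {0<..} s *\<^sub>R exp (q * of_real s)) (- 1 / q)"
proof -
  have int: "set_integrable lborel {0<..} (\<lambda>s. exp (q * of_real s))"
  proof -
    have "set_integrable lborel {0<..} (\<lambda>s. exp (- (s * (- Re q))))"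
      by (rule integrable_I0i_exp_mscale) (use q in simp)
    then have 1: "integrable lborel (\<lambda>s. indicator {0<..} s *\<^sub>R exp (- (s * (- Re q))))"
      by (simp add: set_integrable_def)
    show ?thesis
      unfolding set_integrable_def
      by (rule Bochner_Integration.integrable_bound[OF 1])
         (auto simp: norm_exp_eq_Re indicator_def mult.commute)
  qed
  have deriv: "((\<lambda>s. exp (q * of_real s) / q) has_vector_derivative exp (q * of_real s)) (at s)" for s
  proof -
    have "((\<lambda>z. exp (q * z) / q) has_field_derivative exp (q * of_real s)) (at (of_real s))"
      using q by (auto intro!: derivative_eq_intros)
    from has_vector_derivative_real_field[OF this] show ?thesis by simp
  qed
  have "(LBINT s=ereal 0..\<infinity>. exp (q * of_real s)) = 0 - 1 / q"
  proof (rule interval_integral_FTC_integrable[where F = "\<lambda>s. exp (q * of_real s) / q"])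
    show "set_integrable lborel (einterval (ereal 0) \<infinity>) (\<lambda>s. exp (q * of_real s))"
      using int by (simp add: einterval_def greaterThan_def)
    show "(((\<lambda>s. exp (q * of_real s) / q) \<circ> real_of_ereal) \<longlongrightarrow> 1 / q) (at_right (ereal 0))"
    proof -
      have "((\<lambda>s. exp (q * of_real s) / q) \<longlongrightarrow> exp (q * of_real 0) / q) (at_right 0)"
        using q by (intro tendsto_intros) auto
      then show ?thesis by (simp add: ereal_tendsto_simps1)
    qed
    show "(((\<lambda>s. exp (q * of_real s) / q) \<circ> real_of_ereal) \<longlongrightarrow> 0) (at_left \<infinity>)"
    proof -
      have "((\<lambda>s. exp (q * of_real s) / q) \<longlongrightarrow> 0) at_top"
      proof (rule tendsto_norm_zero_cancel)
        have "((\<lambda>s. exp (- (r * s))) \<longlongrightarrow> 0) at_top" if "0 < r" for r :: real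
          using that by real_asymp
        from tendsto_divide_zero[OF this[of "- Re q"], of "cmod q"] q show "((\<lambda>s. cmod (exp (q * of_real s) / q)) \<longlongrightarrow> 0) at_top"
          by (simp add: norm_divide norm_exp_eq_Re)
      qed
      then show ?thesis by (simp add: ereal_tendsto_simps1)
    qed
  qed (use deriv in \<open>auto intro!: continuous_intros\<close>)
  then show ?thesis
    using int by (simp add: has_bochner_integral_iff set_integrable_def interval_lebesgue_integral_def
      einterval_def greaterThan_def set_lebesgue_integral_def)
qed

text \<open>For nonnegative functions gauge integrability is absolute integrability; Borel
  measurability brings the result from the completed measure down to \<open>lborel\<close>.\<close>

lemma integrable_lborel_of_has_integral:
  fixes f :: "real \<Rightarrow> real"
  assumes "(f has_integral I) S" "\<And>x. x \<in> S \<Longrightarrow> 0 \<le> f x" "f \<in> borel_measurable borel" "S \<in> sets borel"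
  shows "integrable lborel (\<lambda>x. indicator S x * f x)"
proof -
  have "f absolutely_integrable_on S"
    using assms by (intro nonnegative_absolutely_integrable_1) (auto simp: integrable_on_def)
  then have "integrable (completion lborel) (\<lambda>x. indicator S x *\<^sub>R f x)"
    by (simp add: set_integrable_def)
  moreover have "(\<lambda>x. indicator S x *\<^sub>R f x) \<in> borel_measurable lborel"
    using assms by simp
  ultimately show ?thesis by (simp add: integrable_completion)
qed

text \<open>One majorant for both signs of \<open>a\<close>: the power covers the singularity at 0
  for \<open>a < 0\<close> and the growth for \<open>a > 0\<close>. The summand 1 is for
  \<open>a > 0\<close>, where \<open>cmod z powr a\<close> does not vanish as \<open>Re z\<close>
  tends to 0 at a fixed height. Values are complex so that this can be an element of
  \<open>L2\<close>.\<close>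

definition majorant :: "real \<Rightarrow> real \<Rightarrow> complex" where
  "majorant a x = of_real ((1 + \<bar>x\<bar> powr a) / cmod (of_real x + \<i>))"

lemma cmod_majorant: "cmod (majorant a x) = (1 + \<bar>x\<bar> powr a) / cmod (of_real x + \<i>)"
  unfolding majorant_def norm_of_real by (intro abs_of_nonneg divide_nonneg_nonneg add_nonneg_nonneg) auto

lemma cmod_x_plus_i: "(cmod (of_real x + \<i>))\<^sup>2 = x\<^sup>2 + 1"
  by (simp add: cmod_power2)

lemma integrable_powr_weight:
  fixes c :: real
  assumes "-1 < c" "c < 1"
  shows "integrable lborel (\<lambda>x. \<bar>x\<bar> powr c / (x\<^sup>2 + 1))"
proof -
  \<comment> \<open>A comparison function on the half-line: exponent \<open>c > -1\<close> for
    integrability at 0, exponent \<open>c - 2 < -1\<close> for integrability at infinity.\<close>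
  define p where "p = (\<lambda>x::real. indicator {0..1} x * x powr c + indicator {1..} x * x powr (c - 2))"
  have p0: "0 \<le> p x" for x by (simp add: p_def)
  have p: "integrable lborel p"
    unfolding p_def
  proof (rule Bochner_Integration.integrable_add)
    show "integrable lborel (\<lambda>x::real. indicator {0..1} x * x powr c)"
      by (rule integrable_lborel_of_has_integral[OF has_integral_powr_from_0]) (use assms in auto)
    show "integrable lborel (\<lambda>x::real. indicator {1..} x * x powr (c - 2))"
      by (rule integrable_lborel_of_has_integral[OF has_integral_powr_to_inf]) (use assms in auto)
  qed
  have p': "integrable lborel (\<lambda>x. p (- x))"
    using lborel_integrable_real_affine[OF p, of "-1" 0] by simp
  have pos: "x powr c / (x\<^sup>2 + 1) \<le> p x" if "0 \<le> x" for x
  proof (cases "x \<le> 1")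
    case True
    have "x powr c / (x\<^sup>2 + 1) \<le> x powr c / 1"
      by (intro divide_left_mono mult_pos_pos add_nonneg_pos) auto
    then show ?thesis using True that by (auto simp: p_def indicator_def)
  next
    case False
    have "x powr c / (x\<^sup>2 + 1) \<le> x powr c / x\<^sup>2"
      using False by (intro divide_left_mono mult_pos_pos add_nonneg_pos) auto
    also have "\<dots> = x powr (c - 2)" using False by (simp add: powr_diff powr_numeral)
    finally show ?thesis using False by (auto simp: p_def indicator_def)
  qed
  show ?thesis
  proof (rule Bochner_Integration.integrable_bound[OF Bochner_Integration.integrable_add[OF p p']])
    show "AE x in lborel. norm (\<bar>x\<bar> powr c / (x\<^sup>2 + 1)) \<le> norm (p x + p (- x))"
    proof (rule AE_I2)
      fix x :: real
      have "\<bar>x\<bar> powr c / (x\<^sup>2 + 1) \<le> p \<bar>x\<bar>" using pos[of "\<bar>x\<bar>"] by simp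
      also have "\<dots> \<le> p x + p (- x)" using p0[of x] p0[of "-x"] by (auto simp: abs_if)
      finally show "norm (\<bar>x\<bar> powr c / (x\<^sup>2 + 1)) \<le> norm (p x + p (- x))"
        using p0[of x] p0[of "-x"] by (simp add: add_nonneg_pos)
    qed
  qed measurable
qed

text \<open>Squaring doubles the exponent, and \<open>integrable_powr_weight\<close> needs
  \<open>2 * a\<close> strictly between -1 and 1; for \<open>a = 1 / 2 - H\<close> this is where
  \<open>0 < H < 1\<close> enters.\<close>

lemma L2_majorant:
  assumes "-1/2 < a" "a < 1/2"
  shows "majorant a \<in> L2"
proof -
  have 1: "(\<lambda>x. of_real (1 / cmod (of_real x + \<i>))) \<in> L2"
    using integrable_powr_weight[of 0] 
      Bochner_Integration.integrable_cong[of lborel lborel] L2_cauchy_kernel(1)[of "-\<i>"]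
    by (simp add: L2_iff norm_divide)
  have 2: "(\<lambda>x. of_real (\<bar>x\<bar> powr a / cmod (of_real x + \<i>))) \<in> L2"
  proof -
    have "(cmod (of_real (\<bar>x\<bar> powr a / cmod (of_real x + \<i>))))\<^sup>2 = \<bar>x\<bar> powr (2 * a) / (x\<^sup>2 + 1)" for x
      unfolding norm_of_real power2_abs power_divide cmod_x_plus_i
      by (simp add: power2_eq_square powr_add[symmetric])
    then show ?thesis
      using integrable_powr_weight[of "2 * a"] assms unfolding L2_iff by simp
  qed
  show ?thesis
    using L2_add[OF 1 2] by (simp add: majorant_def[abs_def] add_divide_distrib)
qed

text \<open>
  The analytic continuation of the function in the theorem, with \<open>a = 1 / 2 - H\<close>: for real \<open>x \<noteq> 0\<close> the principal
  argument of \<open>- \<i> * x\<close> is \<open>- sgn x * pi / 2\<close>, and \<open>(\<i> - x) / (1 + x\<^sup>2) = - 1 / (x + \<i>)\<close>.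
\<close>

definition fbm_ext :: "real \<Rightarrow> real \<Rightarrow> complex \<Rightarrow> complex" where
  "fbm_ext b a z = - of_real b * ((- (\<i> * z)) powr of_real a) / (z + \<i>)"

text \<open>\<open>- (\<i> * z)\<close> has real part \<open>Im z\<close> and imaginary part
  \<open>- Re z\<close>: the rotation moves the branch cut of the power to the negative imaginary
  axis.\<close>

lemma minus_ii_mult_notin_nonpos_Reals:
  assumes "0 < Im z \<or> (Im z = 0 \<and> Re z \<noteq> 0)"
  shows "- (\<i> * z) \<notin> \<real>\<^sub>\<le>\<^sub>0"
  using assms by (auto simp: complex_nonpos_Reals_iff)

lemma plus_ii_nonzero: "0 \<le> Im z \<Longrightarrow> z + \<i> \<noteq> 0"
  by (auto simp: complex_eq_iff)

lemma fbm_ext_holomorphic: "fbm_ext b a holomorphic_on {z. 0 < Im z}"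
proof -
  have "(\<lambda>z. - (\<i> * z)) ` {z. 0 < Im z} \<inter> \<real>\<^sub>\<le>\<^sub>0 = {}"
    using minus_ii_mult_notin_nonpos_Reals by auto
  then show ?thesis unfolding fbm_ext_def
    using minus_ii_mult_notin_nonpos_Reals plus_ii_nonzero
    by (intro holomorphic_intros) auto
qed

lemma fbm_ext_isCont_real: "x \<noteq> 0 \<Longrightarrow> isCont (fbm_ext b a) (of_real x)"
  unfolding fbm_ext_def using minus_ii_mult_notin_nonpos_Reals[of "of_real x"] plus_ii_nonzero[of "of_real x"]
  by (intro continuous_intros isCont_powr_complex) auto

lemma cmod_powr_real: "w \<noteq> 0 \<Longrightarrow> cmod (w powr of_real a) = cmod w powr a"
  by (simp add: powr_def norm_exp_eq_Re)

lemma cmod_fbm_ext: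
  assumes "0 \<le> b" "z \<noteq> 0"
  shows "cmod (fbm_ext b a z) = b * cmod z powr a / cmod (z + \<i>)"
  using assms cmod_powr_real[of "- (\<i> * z)" a] by (simp add: fbm_ext_def norm_mult norm_divide)

lemma fbm_ext_nonzero:
  assumes "0 < b" "z \<noteq> 0" "0 \<le> Im z"
  shows "fbm_ext b a z \<noteq> 0"
  using assms plus_ii_nonzero[OF assms(3)] by (simp add: fbm_ext_def)

lemma fbm_ext_of_real:
  "fbm_ext b a (of_real x) = of_real b * exp (\<i> * of_real pi * of_real (- a / 2) * of_real (sgn x))
          * ((\<i> - of_real x) / of_real (1 + x\<^sup>2)) * of_real (\<bar>x\<bar> powr a)"
proof -
  have 1: "- 1 / (of_real x + \<i>) = (\<i> - of_real x) / of_real (1 + x\<^sup>2)"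
  proof -
    have "of_real (1 + x\<^sup>2) = - ((\<i> - of_real x) * (of_real x + \<i>))"
      by (simp add: complex_eq_iff power2_eq_square)
    moreover have "of_real x + \<i> \<noteq> 0" "\<i> - of_real x \<noteq> 0" by (auto simp: complex_eq_iff)
    ultimately show ?thesis by (simp add: divide_simps)
  qed
  have 2: "(- (\<i> * of_real x)) powr of_real a = exp (\<i> * of_real pi * of_real (- a / 2) * of_real (sgn x)) * of_real (\<bar>x\<bar> powr a)"
  proof -
    \<comment> \<open>\<open>Ln\<close> splits off positive real factors, which leaves
      \<open>Ln (- \<i>)\<close> or \<open>Ln \<i>\<close> according to the sign of
      \<open>x\<close>; at 0 both sides vanish because powers of 0 are 0.\<close>
    consider "x = 0" | "0 < x" | "x < 0" by linarith
    then show ?thesis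
    proof cases
      case 2
      have "Ln (of_real x * (- \<i>)) = of_real (ln x) + Ln (- \<i>)"
        using 2 Ln_times_of_real[of x "- \<i>"] by (simp add: Ln_of_real)
      then have A: "Ln (- (\<i> * of_real x)) = of_real (ln x) - \<i> * of_real pi / 2"
        by (simp add: mult.commute)
      have "(- (\<i> * of_real x)) powr of_real a = exp (of_real a * (of_real (ln x) - \<i> * of_real pi / 2))"
        using 2 by (simp add: powr_def A)
      also have "of_real a * (of_real (ln x) - \<i> * of_real pi / 2) =
          \<i> * of_real pi * of_real (- a / 2) * of_real (sgn x) + of_real (a * ln x)"
        using 2 by (simp add: algebra_simps)
      also have "exp \<dots> = exp (\<i> * of_real pi * of_real (- a / 2) * of_real (sgn x)) * of_real (\<bar>x\<bar> powr a)"
        unfolding exp_add exp_of_real using 2 by (simp add: powr_def)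
      finally show ?thesis .
    next
      case 3
      have "Ln (of_real (- x) * \<i>) = of_real (ln (- x)) + Ln \<i>"
        using 3 Ln_times_of_real[of "- x" \<i>] Ln_of_real[of "- x"] by simp
      then have A: "Ln (- (\<i> * of_real x)) = of_real (ln (- x)) + \<i> * of_real pi / 2"
        by (simp add: mult.commute)
      have "(- (\<i> * of_real x)) powr of_real a = exp (of_real a * (of_real (ln (- x)) + \<i> * of_real pi / 2))"
        using 3 by (simp add: powr_def A)
      also have "of_real a * (of_real (ln (- x)) + \<i> * of_real pi / 2) =
          \<i> * of_real pi * of_real (- a / 2) * of_real (sgn x) + of_real (a * ln (- x))"
        using 3 by (simp add: algebra_simps)
      also have "exp \<dots> = exp (\<i> * of_real pi * of_real (- a / 2) * of_real (sgn x)) * of_real (\<bar>x\<bar> powr a)"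
        unfolding exp_add exp_of_real using 3 by (simp add: powr_def)
      finally show ?thesis .
    qed simp
  qed
  have "fbm_ext b a (of_real x) = of_real b * (- (\<i> * of_real x)) powr of_real a * (- 1 / (of_real x + \<i>))"
    by (simp add: fbm_ext_def)
  then show ?thesis unfolding 1 2 by (simp only: mult_ac)
qed

lemma cmod_Complex_mono:
  assumes "0 \<le> y" "y \<le> y'"
  shows "cmod (Complex x y) \<le> cmod (Complex x y')"
  using assms by (simp add: cmod_def power_mono)

text \<open>For \<open>a \<ge> 0\<close> the quotient is at most
  \<open>cmod (z + \<i>) powr (a - 1)\<close>, which decreases with the height because
  \<open>a < 1\<close>; the factor 2 absorbs \<open>2 powr a\<close>. For \<open>a < 0\<close> the
  power itself decreases with the height, so \<open>\<bar>x\<bar> powr a\<close> bounds it.\<close>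

lemma fbm_ext_le_majorant:
  assumes "0 \<le> b" "-1 < a" "a < 1" "x \<noteq> 0" "0 < y"
  shows "cmod (fbm_ext b a (Complex x y)) \<le> cmod (of_real (2 * b) * majorant a x)"
proof -
  define z where "z = Complex x y"
  have z0: "z \<noteq> 0" using assms by (auto simp: z_def complex_eq_iff)
  have zi: "z + \<i> = Complex x (y + 1)" "of_real x + \<i> = Complex x 1"
    by (auto simp: z_def complex_eq_iff)
  define u where "u = cmod (of_real x + \<i>)"
  have u1: "1 \<le> u" using abs_Im_le_cmod[of "of_real x + \<i>"] by (simp add: u_def)
  have uz: "u \<le> cmod (z + \<i>)" unfolding u_def zi using assms by (intro cmod_Complex_mono) auto
  have "cmod z powr a / cmod (z + \<i>) \<le> 2 * (1 + \<bar>x\<bar> powr a) / u"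
  proof (cases "0 \<le> a")
    case True
    have "cmod z powr a \<le> cmod (z + \<i>) powr a"
      unfolding zi unfolding z_def using assms True by (intro powr_mono2 cmod_Complex_mono) auto
    then have "cmod z powr a / cmod (z + \<i>) \<le> cmod (z + \<i>) powr a / cmod (z + \<i>)"
      by (intro divide_right_mono) auto
    also have "\<dots> = cmod (z + \<i>) powr (a - 1)"
      using u1 uz by (simp add: powr_diff)
    also have "\<dots> \<le> u powr (a - 1)"
      using u1 uz assms by (intro powr_mono2') auto
    also have "\<dots> = u powr a / u" using u1 by (simp add: powr_diff)
    also have "u powr a \<le> (\<bar>x\<bar> + 1) powr a"
      using norm_triangle_ineq[of "of_real x" \<i>] u1 True by (intro powr_mono2) (auto simp: u_def)
    also have "(\<bar>x\<bar> + 1) powr a \<le> (2 * max \<bar>x\<bar> 1) powr a"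
      using True by (intro powr_mono2) auto
    also have "\<dots> = 2 powr a * max \<bar>x\<bar> 1 powr a" by (simp add: powr_mult)
    also have "\<dots> \<le> 2 powr 1 * (1 + \<bar>x\<bar> powr a)"
      using assms by (intro mult_mono powr_mono) (auto simp: max_def)
    finally show ?thesis using u1 by (simp add: divide_right_mono)
  next
    case False
    have "\<bar>x\<bar> \<le> cmod z" using abs_Re_le_cmod[of z] by (simp add: z_def)
    then have "cmod z powr a \<le> \<bar>x\<bar> powr a"
      using False assms by (intro powr_mono2') auto
    also have "\<dots> \<le> 2 * (1 + \<bar>x\<bar> powr a)" by simp
    finally show ?thesis
      using u1 uz by (intro frac_le) auto
  qed
  then have "b * (cmod z powr a / cmod (z + \<i>)) \<le> b * (2 * (1 + \<bar>x\<bar> powr a) / u)"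
    using assms by (intro mult_left_mono) auto
  then show ?thesis
    using assms z0 by (simp add: cmod_fbm_ext z_def[symmetric] cmod_majorant norm_mult u_def[symmetric] mult_ac)
qed

lemma tendsto_vertical:
  assumes "isCont F (of_real x)"
  shows "((\<lambda>y. F (Complex x y)) \<longlongrightarrow> F (of_real x)) (at_right 0)"
proof -
  have "((\<lambda>y. of_real x + \<i> * of_real y) \<longlongrightarrow> of_real x + \<i> * of_real 0) (at_right 0)"
    by (intro tendsto_intros)
  then have "((\<lambda>y. F (of_real x + \<i> * of_real y)) \<longlongrightarrow> F (of_real x)) (at_right 0)"
    using isCont_tendsto_compose[OF assms] by simp
  then show ?thesis by (simp add: Complex_eq)
qed

lemma AE_lborel_nonzero: "AE x in lborel. x \<noteq> (0::real)"
  by (rule AE_lborel_singleton)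

lemma fbm_ext_of_real_measurable: "(\<lambda>x. fbm_ext b a (of_real x)) \<in> borel_measurable lborel"
  unfolding fbm_ext_of_real by measurable

text \<open>\<open>P = 1\<close> places \<open>h\<close> itself in the Hardy space; sums of
  exponentials as \<open>P\<close> place the combinations of its shifts there.\<close>

lemma fbm_ext_mult_H2_plus:
  assumes "0 \<le> b" "-1/2 < a" "a < 1/2"
    and P: "P holomorphic_on {z. 0 < Im z}" "\<And>x. isCont P (of_real x)"
      "(\<lambda>x. P (of_real x)) \<in> borel_measurable lborel"
    and bd: "\<And>z. 0 < Im z \<Longrightarrow> cmod (P z) \<le> M"
  shows "(\<lambda>x. P (of_real x) * fbm_ext b a (of_real x)) \<in> H2_plus"
proof (rule H2_plus_dominated[where F = "\<lambda>z. P z * fbm_ext b a z" and K = "\<lambda>x. of_real (M * (2 * b)) * majorant a x"])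
  have M: "0 \<le> M" by (rule order_trans[OF norm_ge_zero bd[of \<i>]]) simp
  show "(\<lambda>z. P z * fbm_ext b a z) holomorphic_on {z. 0 < Im z}"
    by (intro holomorphic_intros P fbm_ext_holomorphic)
  show "(\<lambda>x. of_real (M * (2 * b)) * majorant a x) \<in> L2"
    by (intro L2_scale L2_majorant assms)
  show "(\<lambda>x. P (of_real x) * fbm_ext b a (of_real x)) \<in> borel_measurable lborel"
    using P(3) fbm_ext_of_real_measurable by measurable
  show "AE x in lborel. \<forall>y>0. cmod (P (Complex x y) * fbm_ext b a (Complex x y)) \<le> cmod (of_real (M * (2 * b)) * majorant a x)"
    using AE_lborel_nonzero
  proof eventually_elim
    case (elim x)
    show ?case
    proof (intro allI impI)
      fix y :: real assume "0 < y"
      have "cmod (P (Complex x y)) * cmod (fbm_ext b a (Complex x y)) \<le> M * cmod (of_real (2 * b) * majorant a x)"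
        using \<open>0 < y\<close> elim assms M by (intro mult_mono bd fbm_ext_le_majorant) auto
      then show "cmod (P (Complex x y) * fbm_ext b a (Complex x y)) \<le> cmod (of_real (M * (2 * b)) * majorant a x)"
        using M \<open>0 \<le> b\<close> by (simp add: norm_mult mult.assoc)
    qed
  qed
  show "AE x in lborel. ((\<lambda>y. P (Complex x y) * fbm_ext b a (Complex x y)) \<longlongrightarrow> P (of_real x) * fbm_ext b a (of_real x)) (at_right 0)"
    using AE_lborel_nonzero
  proof eventually_elim
    case (elim x)
    show ?case by (intro tendsto_mult tendsto_vertical P fbm_ext_isCont_real elim)
  qed
qed

section \<open>Density of the shifts\<close>

lemma L2_closed_span_cnj:
  "f \<in> L2_closed_span I e \<longleftrightarrow> (\<lambda>x. cnj (f x)) \<in> L2_closed_span I (\<lambda>t x. cnj (e t x))"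
proof -
  have imp: "(\<lambda>x. cnj (f x)) \<in> L2_closed_span I (\<lambda>t x. cnj (e t x))" if f: "f \<in> L2_closed_span I e" for f e
    unfolding L2_closed_span_def
  proof (intro CollectI conjI allI impI)
    show "(\<lambda>x. cnj (f x)) \<in> L2" using f by (simp add: L2_closed_span_def L2_cnj)
    fix \<epsilon> :: ennreal assume "0 < \<epsilon>"
    then obtain T c where T: "finite T" "T \<subseteq> I" "L2_norm_sq (\<lambda>x. f x - (\<Sum>t\<in>T. c t * e t x)) < \<epsilon>"
      using f unfolding L2_closed_span_def by blast
    have "(\<lambda>x. cnj (f x) - (\<Sum>t\<in>T. cnj (c t) * cnj (e t x))) = (\<lambda>x. cnj (f x - (\<Sum>t\<in>T. c t * e t x)))"
      by (simp add: cnj_sum)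
    then have "L2_norm_sq (\<lambda>x. cnj (f x) - (\<Sum>t\<in>T. cnj (c t) * cnj (e t x))) < \<epsilon>"
      using T(3) by (simp only: L2_norm_sq_cnj)
    then show "\<exists>T c. finite T \<and> T \<subseteq> I \<and> L2_norm_sq (\<lambda>x. cnj (f x) - (\<Sum>t\<in>T. c t * cnj (e t x))) < \<epsilon>"
      using T by (intro exI[of _ T] exI[of _ "\<lambda>t. cnj (c t)"]) auto
  qed
  show ?thesis
    using imp[of f e] imp[of "\<lambda>x. cnj (f x)" "\<lambda>t x. cnj (e t x)"] by auto
qed

text \<open>Laplace transform in \<open>t\<close> of the shifts of \<open>h\<close>.\<close>

lemma cauchy_multiple_in_closed_subspace:
  assumes S: "closed_subspace S" and h: "h \<in> L2"
    and e: "\<And>t. t < 0 \<Longrightarrow> (\<lambda>x. exp (- (\<i> * of_real x * of_real t)) * h x) \<in> S"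
    and w: "Im w < 0"
  shows "(\<lambda>x. h x / (of_real x - w)) \<in> S"
proof -
  \<comment> \<open>With \<open>s = - t\<close> the shifts are indexed by \<open>s > 0\<close>;
    \<open>closed_subspace_integral\<close> asks for a member at every real index, so the family is
    continued by zero.\<close>
  define E where "E s x = (if 0 < s then exp (\<i> * of_real x * of_real s) * h x else 0)" for s x :: real
  \<comment> \<open>The real part of \<open>- (\<i> * w)\<close> is \<open>Im w\<close>, so this
    weight decays because the pole lies in the lower half-plane.\<close>
  define c where "c s = indicator {0<..} s *\<^sub>R exp (- (\<i> * w) * of_real s)" for s :: real
  have [measurable]: "h \<in> borel_measurable lborel" using h by (simp add: L2_iff)
  have "(\<lambda>x. \<integral>s. c s * E s x \<partial>lborel) \<in> S"
  proof (rule closed_subspace_integral[OF S _ h])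
    show "E t \<in> S" for t
    proof (cases "0 < t")
      case True
      then show ?thesis using e[of "- t"] by (simp add: E_def[abs_def])
    next
      case False
      then show ?thesis using S by (simp add: E_def[abs_def] closed_subspace_def)
    qed
    show "cmod (E t x) \<le> cmod (h x)" for t x
      by (simp add: E_def norm_mult norm_exp_eq_Re)
    show "case_prod E \<in> borel_measurable (lborel \<Otimes>\<^sub>M lborel)"
      unfolding E_def by measurable
    show "integrable lborel c"
      unfolding c_def using has_bochner_integral_exp_halfline[of "- (\<i> * w)"] w
      by (simp add: has_bochner_integral_iff)
  qed
  moreover have "(\<integral>s. c s * E s x \<partial>lborel) = \<i> * (h x / (of_real x - w))" for x
  proof -
    have "(\<integral>s. c s * E s x \<partial>lborel) = (\<integral>s. (indicator {0<..} s *\<^sub>R exp (\<i> * (of_real x - w) * of_real s)) * h x \<partial>lborel)"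
      by (intro Bochner_Integration.integral_cong)
         (auto simp: c_def E_def indicator_def exp_add[symmetric] algebra_simps)
    also have "\<dots> = (\<integral>s. indicator {0<..} s *\<^sub>R exp (\<i> * (of_real x - w) * of_real s) \<partial>lborel) * h x"
      by (rule integral_mult_left_zero)
    also have "(\<integral>s. indicator {0<..} s *\<^sub>R exp (\<i> * (of_real x - w) * of_real s) \<partial>lborel) = - 1 / (\<i> * (of_real x - w))"
      using has_bochner_integral_exp_halfline[of "\<i> * (of_real x - w)"] w
      by (simp add: has_bochner_integral_iff)
    also have "\<dots> * h x = \<i> * (h x / (of_real x - w))"
    proof -
      have d: "of_real x - w \<noteq> 0" using w by (auto simp: complex_eq_iff)
      have "- 1 / (\<i> * d) * u = \<i> * (u / d)" if "d \<noteq> 0" for d u :: complex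
        using that by (simp add: divide_inverse)
      from this[OF d] show ?thesis .
    qed
    finally show ?thesis .
  qed
  ultimately have "(\<lambda>x. \<i> * (h x / (of_real x - w))) \<in> S" by simp
  from closed_subspaceD(3)[OF S this, of "- \<i>"] show ?thesis by (simp add: mult.assoc[symmetric])
qed

text \<open>Cauchy's formula on the line at height \<open>\<epsilon> / 2\<close> writes \<open>\<psi>\<close> at height \<open>\<epsilon>\<close> as an integral of Cauchy kernels.\<close>

lemma holomorphic_multiple_in_closed_subspace:
  assumes S: "closed_subspace S" and h: "h \<in> L2"
    and e: "\<And>w. Im w < 0 \<Longrightarrow> (\<lambda>x. h x / (of_real x - w)) \<in> S"
    and \<psi>: "\<psi> holomorphic_on {z. 0 < Im z}" and "0 < \<epsilon>"
    and k: "\<And>z. \<epsilon> / 2 \<le> Im z \<Longrightarrow> cmod (\<psi> z) \<le> k / (cmod (z + \<i>))\<^sup>2" and "0 \<le> k"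
  shows "(\<lambda>x. h x * \<psi> (Complex x \<epsilon>)) \<in> S"
proof -
  have [measurable]: "h \<in> borel_measurable lborel" using h by (simp add: L2_iff)
  define \<delta> where "\<delta> = \<epsilon> / 2"
  have \<delta>: "0 < \<delta>" using \<open>0 < \<epsilon>\<close> by (simp add: \<delta>_def)
  have low: "cmod (of_real x + \<i>) \<le> cmod (Complex x y + \<i>)" "1 \<le> cmod (Complex x y + \<i>)" if "0 < y" for x y
  proof -
    have "of_real x + \<i> = Complex x 1" "Complex x y + \<i> = Complex x (y + 1)" by (auto simp: complex_eq_iff)
    then show "cmod (of_real x + \<i>) \<le> cmod (Complex x y + \<i>)"
      using that by (simp add: cmod_Complex_mono)
    show "1 \<le> cmod (Complex x y + \<i>)"
      using abs_Im_le_cmod[of "Complex x y + \<i>"] that by simp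
  qed
  have pos: "0 < cmod (of_real x + \<i>)" for x by (simp add: complex_eq_iff)
  define c where "c t = \<psi> (Complex t \<delta>) / (2 * pi * \<i>)" for t
  \<comment> \<open>Up to sign this is \<open>h x\<close> times the Cauchy kernel with pole
    \<open>Complex t (- \<delta>)\<close>, a point of the lower half-plane, so \<open>e\<close>
    applies.\<close>
  define E where "E t x = h x / (of_real t - Complex x \<delta>)" for t x
  have "(\<lambda>x. \<integral>t. c t * E t x \<partial>lborel) \<in> S"
  proof (rule closed_subspace_integral[OF S _ L2_scale(1)[OF h, of "of_real (1 / \<delta>)"]])
    show "E t \<in> S" for t
    proof -
      have "(\<lambda>x. - 1 * (h x / (of_real x - Complex t (- \<delta>)))) \<in> S"
        using closed_subspaceD(3)[OF S e, of "Complex t (- \<delta>)" "- 1"] \<delta> by simp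
      moreover have "- 1 * (h x / (of_real x - Complex t (- \<delta>))) = E t x" for x
      proof -
        have "of_real x - Complex t (- \<delta>) = - (of_real t - Complex x \<delta>)" by (simp add: complex_eq_iff)
        then show ?thesis unfolding E_def by (simp only: divide_minus_right) simp
      qed
      ultimately show ?thesis by simp
    qed
    show "cmod (E t x) \<le> cmod (of_real (1 / \<delta>) * h x)" for t x
    proof -
      have "\<delta> \<le> cmod (of_real t - Complex x \<delta>)"
        using abs_Im_le_cmod[of "of_real t - Complex x \<delta>"] \<delta> by simp
      then have "cmod (h x) / cmod (of_real t - Complex x \<delta>) \<le> cmod (h x) / \<delta>"
        using \<delta> by (intro divide_left_mono mult_pos_pos) auto
      then show ?thesis using \<delta> by (simp add: E_def norm_divide norm_mult)
    qed
    show "case_prod E \<in> borel_measurable (lborel \<Otimes>\<^sub>M lborel)"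
      unfolding E_def Complex_eq by measurable
    show "integrable lborel c"
    proof (rule Bochner_Integration.integrable_bound[where f = "\<lambda>x. k * (1 / (cmod (of_real x - (- \<i>)))\<^sup>2)"])
      show "integrable lborel (\<lambda>x. k * (1 / (cmod (of_real x - (- \<i>)))\<^sup>2))"
        using has_bochner_integral_poisson_kernel[of "- \<i>"]
        by (intro integrable_mult_right) (auto simp: has_bochner_integral_iff)
      show "c \<in> borel_measurable lborel"
        unfolding c_def using holomorphic_upper_measurable(2)[OF \<psi> \<delta>] by measurable
      show "AE x in lborel. norm (c x) \<le> norm (k * (1 / (cmod (of_real x - (- \<i>)))\<^sup>2))"
      proof (rule AE_I2)
        fix x
        have "cmod (c x) \<le> cmod (\<psi> (Complex x \<delta>))"
          using pi_ge_two by (simp add: c_def norm_divide norm_mult divide_le_eq mult_le_cancel_left1)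
        also have "\<dots> \<le> k / (cmod (Complex x \<delta> + \<i>))\<^sup>2" by (rule k) (simp add: \<delta>_def)
        also have "\<dots> \<le> k / (cmod (of_real x + \<i>))\<^sup>2"
          using low(1)[OF \<delta>, of x] low(2)[OF \<delta>, of x] pos[of x] \<open>0 \<le> k\<close>
          by (intro divide_left_mono mult_pos_pos power_mono zero_less_power) (auto intro: less_le_trans)
        finally show "norm (c x) \<le> norm (k * (1 / (cmod (of_real x - (- \<i>)))\<^sup>2))"
          using \<open>0 \<le> k\<close> by simp
      qed
    qed
  qed
  moreover have "(\<integral>t. c t * E t x \<partial>lborel) = h x * \<psi> (Complex x \<epsilon>)" for x
  proof -
    let ?M = "(l2_norm (\<lambda>x. of_real k * (1 / (of_real x - (- \<i>)))))\<^sup>2"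
    \<comment> \<open>A line at height \<open>\<delta>\<close> and a pole at height
      \<open>\<delta>\<close> above it evaluate \<open>\<psi>\<close> at height
      \<open>2 * \<delta> = \<epsilon>\<close>.\<close>
    have "(\<integral>t. \<psi> (Complex t \<delta>) / (of_real t - Complex x \<delta>) \<partial>lborel) =
      (if 0 < Im (Complex x \<delta>) then 2 * pi * \<i> * \<psi> (Complex x \<delta> + \<i> * of_real \<delta>) else 0)"
    proof (rule cauchy_formula_line[OF \<psi> \<delta>, of ?M])
      fix y assume y: "\<delta> \<le> y"
      then have y0: "0 < y" using \<delta> by simp
      have KL: "(\<lambda>x. of_real k * (1 / (of_real x - (- \<i>)))) \<in> L2"
        by (intro L2_scale L2_cauchy_kernel) simp
      have ae: "AE x in lborel. cmod (\<psi> (Complex x y)) \<le> cmod (of_real k * (1 / (of_real x - (- \<i>))))"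
      proof (rule AE_I2)
        fix x
        have "cmod (\<psi> (Complex x y)) \<le> k / (cmod (Complex x y + \<i>))\<^sup>2"
          by (rule k) (use y in \<open>simp add: \<delta>_def\<close>)
        \<comment> \<open>Since \<open>cmod (z + \<i>) \<ge> 1\<close>, one power can be given up;
          what remains is square integrable and common to all lines.\<close>
        also have "\<dots> \<le> k / cmod (of_real x + \<i>)"
        proof (intro divide_left_mono mult_pos_pos)
          have "cmod (of_real x + \<i>) \<le> cmod (Complex x y + \<i>) * 1" using low[OF y0] by simp
          also have "\<dots> \<le> cmod (Complex x y + \<i>) * cmod (Complex x y + \<i>)"
            using low(2)[OF y0] by (intro mult_left_mono) auto
          finally show "cmod (of_real x + \<i>) \<le> (cmod (Complex x y + \<i>))\<^sup>2" by (simp add: power2_eq_square)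
          show "0 < (cmod (Complex x y + \<i>))\<^sup>2"
            using low(2)[OF y0, of x] by (intro zero_less_power) linarith
        qed (use pos \<open>0 \<le> k\<close> in auto)
        finally show "cmod (\<psi> (Complex x y)) \<le> cmod (of_real k * (1 / (of_real x - (- \<i>))))"
          using \<open>0 \<le> k\<close> by (simp add: norm_mult norm_divide)
      qed
      note d = L2_dominated[OF KL holomorphic_upper_measurable(2)[OF \<psi> y0] ae]
      show "L2_norm_sq (\<lambda>x. \<psi> (Complex x y)) \<le> ennreal ?M"
        by (subst L2_norm_sq_le_iff[OF d(1)]) (use d(2) in auto)
    qed (use \<delta> in auto)
    moreover have "Complex x \<delta> + \<i> * of_real \<delta> = Complex x \<epsilon>" by (simp add: complex_eq_iff \<delta>_def)
    ultimately have I: "(\<integral>t. \<psi> (Complex t \<delta>) / (of_real t - Complex x \<delta>) \<partial>lborel) = 2 * pi * \<i> * \<psi> (Complex x \<epsilon>)"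
      using \<delta> by simp
    have "(\<integral>t. c t * E t x \<partial>lborel) = (\<integral>t. (h x / (2 * pi * \<i>)) * (\<psi> (Complex t \<delta>) / (of_real t - Complex x \<delta>)) \<partial>lborel)"
      by (intro Bochner_Integration.integral_cong) (auto simp: c_def E_def)
    also have "\<dots> = (h x / (2 * pi * \<i>)) * (2 * pi * \<i> * \<psi> (Complex x \<epsilon>))"
      unfolding integral_mult_right_zero I ..
    also have "\<dots> = h x * \<psi> (Complex x \<epsilon>)"
    proof -
      have "u / d * (d * v) = u * v" if "d \<noteq> 0" for u d v :: complex
        using that by simp
      note this[of "2 * pi * \<i>" "h x" "\<psi> (Complex x \<epsilon>)"]
      moreover have "2 * pi * \<i> \<noteq> 0" by simp
      ultimately show ?thesis by blast
    qed
    finally show ?thesis .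
  qed
  ultimately show ?thesis by simp
qed

text \<open>
  A boundary function \<open>f\<close> with extension \<open>F\<close> is the limit, as first \<open>\<epsilon>\<close>, then \<open>\<eta>\<close>, then \<open>y\<close> tend to \<open>0\<close>, of
  \<open>h(x) \<psi>(x + \<i> \<epsilon>)\<close> with \<open>\<psi>(z) = F(z + \<i> y) (1 - \<i> \<eta> z)\<^bsup>-4\<^esup> / h(z)\<close>: the shift by \<open>y\<close> makes \<open>F\<close> bounded, the
  power \<open>-4\<close> makes \<open>\<psi>\<close> decay, and the shift by \<open>\<epsilon>\<close> avoids the singularity of \<open>1 / h\<close> at \<open>0\<close>.
\<close>

lemma H2_plus_subset_closed_subspace:
  assumes S: "closed_subspace S" and b: "0 < b" and a: "-1/2 < a" "a < 1/2"
    and e: "\<And>t. t < 0 \<Longrightarrow> (\<lambda>x. exp (- (\<i> * of_real x * of_real t)) * fbm_ext b a (of_real x)) \<in> S"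
    and h: "(\<lambda>x. fbm_ext b a (of_real x)) \<in> L2"
  shows "H2_plus \<subseteq> S"
proof
  fix f assume "f \<in> H2_plus"
  then obtain F M where F: "hardy_ext F M f" by (auto simp: H2_plus_iff)
  have holF: "F holomorphic_on {z. 0 < Im z}" using F by (simp add: hardy_ext_def)
  have cau: "(\<lambda>x. fbm_ext b a (of_real x) / (of_real x - w)) \<in> S" if "Im w < 0" for w
    by (rule cauchy_multiple_in_closed_subspace[OF S h e that])
  show "f \<in> S"
  proof (rule closed_subspace_limit[OF S hardy_ext_L2(1)[OF F] hardy_ext_tendsto[OF F]])
    fix y :: real assume y: "0 < y" "y < 1"
    define g where "g x = F (Complex x y)" for x
    have gL: "g \<in> L2" unfolding g_def by (rule hardy_ext_L2(2)[OF F y(1)])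
    then have gm: "g \<in> borel_measurable lborel" by (simp add: L2_iff)
    define B where "B = l2_norm f * sqrt (pi / y)"
    have B: "cmod (F (z + \<i> * of_real y)) \<le> B" if "0 \<le> Im z" for z
    proof -
      have "cmod (F (z + \<i> * of_real y)) \<le> l2_norm f * sqrt (pi / Im (z + \<i> * of_real y))"
        by (rule hardy_bound[OF F]) (use that y in simp)
      also have "\<dots> \<le> B" unfolding B_def
        using that y by (intro mult_left_mono real_sqrt_le_mono divide_left_mono mult_pos_pos) auto
      finally show ?thesis .
    qed
    have B0: "0 \<le> B" by (rule order_trans[OF norm_ge_zero B[of 0]]) simp
    \<comment> \<open>Division by \<open>h\<close> costs one factor \<open>cmod (z + \<i>)\<close>,
      and \<open>cmod z powr (- a)\<close> costs at most another up to a constant once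
      \<open>Im z\<close> is bounded below; the exponent 4 leaves the decay of order 2 that
      \<open>holomorphic_multiple_in_closed_subspace\<close> asks for.\<close>
    define \<rho> where "\<rho> \<eta> z = 1 / (1 - \<i> * of_real \<eta> * z) ^ 4" for \<eta> :: real and z :: complex
    have den: "1 \<le> cmod (1 - \<i> * of_real \<eta> * z)" if "0 < \<eta>" "0 \<le> Im z" for \<eta> z
    proof -
      have "0 \<le> \<eta> * Im z" using that by simp
      then show ?thesis using abs_Re_le_cmod[of "1 - \<i> * of_real \<eta> * z"] by simp
    qed
    have rho1: "cmod (\<rho> \<eta> z) \<le> 1" if "0 < \<eta>" "0 \<le> Im z" for \<eta> z
      using den[OF that] by (simp add: \<rho>_def norm_divide norm_power divide_le_eq)
    have "(\<lambda>x. F (Complex x y)) = g" by (simp add: g_def fun_eq_iff)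
    moreover have "g \<in> S"
    proof (rule closed_subspace_limit[OF S gL, where F = "\<lambda>\<eta> x. g x * \<rho> \<eta> (of_real x)" and b = 1])
      show "((\<lambda>\<eta>. l2_norm (\<lambda>x. g x * \<rho> \<eta> (of_real x) - g x)) \<longlongrightarrow> 0) (at_right 0)"
      proof (rule L2_dominated_convergence(2)[OF gm gL, where b = 1])
        show "(\<lambda>x. g x * \<rho> \<eta> (of_real x)) \<in> borel_measurable lborel" for \<eta>
          unfolding \<rho>_def using gm by measurable
        show "AE x in lborel. ((\<lambda>\<eta>. g x * \<rho> \<eta> (of_real x)) \<longlongrightarrow> g x) (at_right 0)"
        proof (rule AE_I2)
          fix x
          have "((\<lambda>\<eta>. g x * \<rho> \<eta> (of_real x)) \<longlongrightarrow> g x * (1 / (1 - \<i> * of_real 0 * of_real x) ^ 4)) (at_right 0)"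
            unfolding \<rho>_def by (intro tendsto_intros) auto
          then show "((\<lambda>\<eta>. g x * \<rho> \<eta> (of_real x)) \<longlongrightarrow> g x) (at_right 0)" by simp
        qed
        show "AE x in lborel. \<forall>\<eta>. 0 < \<eta> \<longrightarrow> \<eta> < 1 \<longrightarrow> cmod (g x * \<rho> \<eta> (of_real x)) \<le> cmod (g x)"
          using rho1 by (auto simp: norm_mult mult_left_le)
      qed auto
      fix \<eta> :: real assume \<eta>: "0 < \<eta>" "\<eta> < 1"
      have rho2: "cmod (\<rho> \<eta> z) \<le> 1 / (\<eta> * cmod (z + \<i>)) ^ 4" if z: "0 \<le> Im z" for z
      proof -
        \<comment> \<open>\<open>1 - \<i> * \<eta> * z\<close> is
          \<open>- \<i> * \<eta> * (z + \<i> / \<eta>)\<close>, and raising the shift from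
          \<open>\<i>\<close> to \<open>\<i> / \<eta>\<close> increases the modulus because
          \<open>\<eta> < 1\<close>.\<close>
        have "\<eta> * cmod (z + \<i>) \<le> cmod (1 - \<i> * of_real \<eta> * z)"
        proof -
          have "(\<eta> * cmod (z + \<i>))\<^sup>2 = (\<eta> * Re z)\<^sup>2 + (\<eta> * Im z + \<eta>)\<^sup>2"
            unfolding power_mult_distrib cmod_power2 by (simp add: algebra_simps power2_eq_square)
          also have "\<dots> \<le> (\<eta> * Re z)\<^sup>2 + (\<eta> * Im z + 1)\<^sup>2"
            using \<eta> z by (intro add_left_mono power_mono) auto
          also have "\<dots> = (cmod (1 - \<i> * of_real \<eta> * z))\<^sup>2"
            unfolding cmod_power2 by (simp add: algebra_simps power2_eq_square)
          finally show ?thesis by (rule power2_le_imp_le) simp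
        qed
        moreover have "0 < \<eta> * cmod (z + \<i>)" using \<eta> plus_ii_nonzero[OF z] by simp
        ultimately show ?thesis
          unfolding \<rho>_def norm_divide norm_power norm_one
          using \<eta> plus_ii_nonzero[OF z] less_le_trans[OF zero_less_one den[OF \<eta>(1) z]]
          by (intro divide_left_mono power_mono mult_pos_pos zero_less_power)
             (simp_all add: zero_less_norm_iff[THEN iffD2] del: zero_less_norm_iff)
      qed
      define \<psi> where "\<psi> z = F (z + \<i> * of_real y) * \<rho> \<eta> z / fbm_ext b a z" for z
      have hol: "\<psi> holomorphic_on {z. 0 < Im z}"
        unfolding \<psi>_def
      proof (intro holomorphic_on_divide holomorphic_on_mult fbm_ext_holomorphic)
        have "(F \<circ> (\<lambda>z. z + \<i> * of_real y)) holomorphic_on {z. 0 < Im z}"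
          by (rule holomorphic_on_compose_gen[OF _ holF]) (use y in \<open>auto intro!: holomorphic_intros\<close>)
        then show "(\<lambda>z. F (z + \<i> * of_real y)) holomorphic_on {z. 0 < Im z}" by (simp add: o_def)
        have "1 - \<i> * of_real \<eta> * z \<noteq> 0" if "0 < Im z" for z
          using den[of \<eta> z] \<eta> that by auto
        then show "\<rho> \<eta> holomorphic_on {z. 0 < Im z}"
          unfolding \<rho>_def by (intro holomorphic_intros) auto
        show "fbm_ext b a z \<noteq> 0" if "z \<in> {z. 0 < Im z}" for z
          using that by (intro fbm_ext_nonzero b) auto
      qed
      \<comment> \<open>\<open>B\<close> bounds the shifted \<open>F\<close>, \<open>b\<close> comes
        from \<open>1 / h\<close>, and \<open>\<eta> ^ 4\<close> from \<open>rho2\<close>.\<close>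
      define k where "k = B / (b * \<eta> ^ 4)"
      have k0: "0 \<le> k" using B0 b \<eta> by (simp add: k_def)
      have main: "cmod (\<psi> z) \<le> k * cmod z powr (- a) / cmod (z + \<i>) ^ 3" if z: "0 < Im z" for z
      proof -
        have zn: "z \<noteq> 0" "0 < cmod (z + \<i>)" using z plus_ii_nonzero[of z] by auto
        have "cmod (\<psi> z) = cmod (F (z + \<i> * of_real y)) * cmod (\<rho> \<eta> z) / (b * cmod z powr a / cmod (z + \<i>))"
          using b zn by (simp add: \<psi>_def norm_divide norm_mult cmod_fbm_ext)
        also have "\<dots> \<le> B * (1 / (\<eta> * cmod (z + \<i>)) ^ 4) / (b * cmod z powr a / cmod (z + \<i>))"
          using z b B0 by (intro divide_right_mono mult_mono B rho2) auto
        also have "\<dots> = k * cmod z powr (- a) / cmod (z + \<i>) ^ 3"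
          using zn b \<eta> by (simp add: k_def powr_minus field_simps power_mult_distrib power_Suc numeral_eq_Suc)
        finally show ?thesis .
      qed
      have zi: "1 \<le> cmod (z + \<i>)" "cmod z \<le> cmod (z + \<i>)" if "0 < Im z" for z
      proof -
        show "1 \<le> cmod (z + \<i>)" using abs_Im_le_cmod[of "z + \<i>"] that by simp
        have "cmod (Complex (Re z) (Im z)) \<le> cmod (Complex (Re z) (Im z + 1))"
          using that by (intro cmod_Complex_mono) auto
        moreover have "Complex (Re z) (Im z + 1) = z + \<i>" by (simp add: complex_eq_iff)
        ultimately show "cmod z \<le> cmod (z + \<i>)" by simp
      qed
      have pw: "cmod z powr (- a) \<le> cmod (z + \<i>)" if "a < 0" "0 < Im z" for z
      proof -
        have "cmod z powr (- a) \<le> cmod (z + \<i>) powr (- a)"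
          using that zi by (intro powr_mono2) auto
        also have "\<dots> \<le> cmod (z + \<i>) powr 1"
          using that zi a by (intro powr_mono) auto
        finally show ?thesis using zi[OF that(2)] by simp
      qed
      define f1 where "f1 x = g x * \<rho> \<eta> (of_real x)" for x
      have f1L: "f1 \<in> L2"
      proof (rule L2_dominated(1)[OF gL])
        show "f1 \<in> borel_measurable lborel" unfolding f1_def \<rho>_def using gm by measurable
        show "AE x in lborel. cmod (f1 x) \<le> cmod (g x)"
          using rho1 \<eta> by (auto simp: f1_def norm_mult mult_left_le)
      qed
      have "f1 \<in> S"
      proof (rule closed_subspace_limit[OF S f1L, where F = "\<lambda>\<epsilon> x. fbm_ext b a (of_real x) * \<psi> (Complex x \<epsilon>)" and b = 1])
        show "((\<lambda>\<epsilon>. l2_norm (\<lambda>x. fbm_ext b a (of_real x) * \<psi> (Complex x \<epsilon>) - f1 x)) \<longlongrightarrow> 0) (at_right 0)"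
        proof (rule L2_dominated_convergence(2)[where b = 1])
          show "f1 \<in> borel_measurable lborel" using f1L by (simp add: L2_iff)
          show "(\<lambda>x. of_real (b * k) * majorant a x) \<in> L2"
            by (intro L2_scale L2_majorant a)
          show "(\<lambda>x. fbm_ext b a (of_real x) * \<psi> (Complex x \<epsilon>)) \<in> borel_measurable lborel" if "0 < \<epsilon>" for \<epsilon>
            using holomorphic_upper_measurable(2)[OF hol that] fbm_ext_of_real_measurable by measurable
          show "AE x in lborel. ((\<lambda>\<epsilon>. fbm_ext b a (of_real x) * \<psi> (Complex x \<epsilon>)) \<longlongrightarrow> f1 x) (at_right 0)"
            using AE_lborel_nonzero
          proof eventually_elim
            case (elim x)
            have hx: "fbm_ext b a (of_real x) \<noteq> 0" using elim by (intro fbm_ext_nonzero b) auto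
            have cF: "isCont F (of_real x + \<i> * of_real y)"
              using holomorphic_on_imp_continuous_on[OF holF] y open_halfspace_Im_gt[of 0]
              by (simp add: continuous_on_eq_continuous_at)
            have "isCont (\<lambda>z. z + \<i> * of_real y) (of_real x)"
              by (intro continuous_intros)
            from isCont_o2[OF this cF] have "isCont (\<lambda>z. F (z + \<i> * of_real y)) (of_real x)" .
            moreover have "1 - \<i> * of_real \<eta> * of_real x \<noteq> 0"
              using den[of \<eta> "of_real x"] \<eta> by auto
            then have "isCont (\<rho> \<eta>) (of_real x)"
              unfolding \<rho>_def by (intro continuous_intros) auto
            ultimately have "isCont \<psi> (of_real x)"
              unfolding \<psi>_def using hx by (intro continuous_intros fbm_ext_isCont_real elim) auto
            from tendsto_mult[OF tendsto_const tendsto_vertical[OF this]]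
            have "((\<lambda>\<epsilon>. fbm_ext b a (of_real x) * \<psi> (Complex x \<epsilon>)) \<longlongrightarrow> fbm_ext b a (of_real x) * \<psi> (of_real x)) (at_right 0)" .
            moreover have "fbm_ext b a (of_real x) * \<psi> (of_real x) = f1 x"
              using hx by (simp add: \<psi>_def f1_def g_def Complex_eq)
            ultimately show ?case by simp
          qed
          show "AE x in lborel. \<forall>\<epsilon>. 0 < \<epsilon> \<longrightarrow> \<epsilon> < 1 \<longrightarrow>
             cmod (fbm_ext b a (of_real x) * \<psi> (Complex x \<epsilon>)) \<le> cmod (of_real (b * k) * majorant a x)"
            using AE_lborel_nonzero
          proof eventually_elim
            case (elim x)
            show ?case
            proof (intro allI impI)
              fix \<epsilon> :: real assume \<epsilon>: "0 < \<epsilon>" "\<epsilon> < 1"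
              let ?z = "Complex x \<epsilon>"
              have z: "0 < Im ?z" using \<epsilon> by simp
              have xz: "\<bar>x\<bar> \<le> cmod ?z" using abs_Re_le_cmod[of ?z] by simp
              \<comment> \<open>For \<open>a > 0\<close> the singularity sits in
                \<open>1 / h\<close> and is cancelled by \<open>h\<close>, because
                \<open>\<bar>x\<bar> \<le> cmod ?z\<close>; for \<open>a < 0\<close> it sits in
                \<open>h\<close> and is left to the majorant.\<close>
              have "\<bar>x\<bar> powr a * cmod ?z powr (- a) \<le> (1 + \<bar>x\<bar> powr a) * cmod (?z + \<i>)"
              proof (cases "0 \<le> a")
                case True
                have "\<bar>x\<bar> powr a * cmod ?z powr (- a) \<le> cmod ?z powr a * cmod ?z powr (- a)"
                  using True xz by (intro mult_right_mono powr_mono2) auto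
                also have "\<dots> = 1" using z by (auto simp: powr_add[symmetric] complex_eq_iff)
                also have "\<dots> \<le> (1 + \<bar>x\<bar> powr a) * cmod (?z + \<i>)"
                  using zi[OF z] mult_mono[of 1 "1 + \<bar>x\<bar> powr a" 1 "cmod (?z + \<i>)"] by simp
                finally show ?thesis .
              next
                case False
                then show ?thesis using pw[OF _ z] by (intro mult_mono) auto
              qed
              then have 1: "\<bar>x\<bar> powr a * cmod ?z powr (- a) / cmod (?z + \<i>) ^ 3 \<le> (1 + \<bar>x\<bar> powr a) * cmod (?z + \<i>) / cmod (?z + \<i>) ^ 3"
                by (intro divide_right_mono) auto
              also have "\<dots> \<le> 1 + \<bar>x\<bar> powr a"
              proof -
                have "cmod (?z + \<i>) ^ 1 \<le> cmod (?z + \<i>) ^ 3" using zi[OF z] by (intro power_increasing) auto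
                then have "cmod (?z + \<i>) / cmod (?z + \<i>) ^ 3 \<le> 1" using zi[OF z] by (simp add: divide_le_eq)
                then have "(1 + \<bar>x\<bar> powr a) * (cmod (?z + \<i>) / cmod (?z + \<i>) ^ 3) \<le> (1 + \<bar>x\<bar> powr a) * 1"
                  by (intro mult_left_mono) (auto simp: add_nonneg_nonneg)
                then show ?thesis by simp
              qed
              finally have 2: "\<bar>x\<bar> powr a * cmod ?z powr (- a) / cmod (?z + \<i>) ^ 3 \<le> 1 + \<bar>x\<bar> powr a" .
              have "cmod (fbm_ext b a (of_real x) * \<psi> ?z) \<le> (b * \<bar>x\<bar> powr a / cmod (of_real x + \<i>)) * (k * cmod ?z powr (- a) / cmod (?z + \<i>) ^ 3)"
              proof -
                have "cmod (fbm_ext b a (of_real x)) = b * \<bar>x\<bar> powr a / cmod (of_real x + \<i>)"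
                  using b elim by (simp add: cmod_fbm_ext)
                then show ?thesis
                  unfolding norm_mult using b by (simp only:) (intro mult_left_mono main[OF z], simp)
              qed
              also have "\<dots> = b * k / cmod (of_real x + \<i>) * (\<bar>x\<bar> powr a * cmod ?z powr (- a) / cmod (?z + \<i>) ^ 3)"
                by (simp add: field_simps)
              also have "\<dots> \<le> b * k / cmod (of_real x + \<i>) * (1 + \<bar>x\<bar> powr a)"
                using b k0 by (intro mult_left_mono 2) auto
              also have "\<dots> = cmod (of_real (b * k) * majorant a x)"
                using b k0 by (simp add: norm_mult cmod_majorant)
              finally show "cmod (fbm_ext b a (of_real x) * \<psi> ?z) \<le> cmod (of_real (b * k) * majorant a x)" .
            qed
          qed
        qed auto
        fix \<epsilon> :: real assume \<epsilon>: "0 < \<epsilon>" "\<epsilon> < 1"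
        show "(\<lambda>x. fbm_ext b a (of_real x) * \<psi> (Complex x \<epsilon>)) \<in> S"
        proof (rule holomorphic_multiple_in_closed_subspace[OF S h cau hol \<epsilon>(1)])
          \<comment> \<open>The power serves \<open>a \<ge> 0\<close>, where
            \<open>cmod z \<ge> \<epsilon> / 2\<close> keeps away from the singularity; the summand
            1 serves \<open>a < 0\<close> through \<open>pw\<close>.\<close>
          let ?q = "(\<epsilon> / 2) powr (- a) + 1"
          show "0 \<le> k * ?q" using k0 by simp
          fix z assume z: "\<epsilon> / 2 \<le> Im z"
          then have z0: "0 < Im z" using \<epsilon> by simp
          have "cmod z powr (- a) \<le> ?q * cmod (z + \<i>)"
          proof (cases "0 \<le> a")
            case True
            have "\<epsilon> / 2 \<le> cmod z" using abs_Im_le_cmod[of z] z by linarith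
            then have "cmod z powr (- a) \<le> (\<epsilon> / 2) powr (- a)"
              using \<epsilon> True by (intro powr_mono2') auto
            also have "\<dots> \<le> ?q * cmod (z + \<i>)"
              using zi[OF z0] mult_mono[of "(\<epsilon> / 2) powr (- a)" ?q 1 "cmod (z + \<i>)"] by simp
            finally show ?thesis .
          next
            case False
            then have "cmod z powr (- a) \<le> 1 * cmod (z + \<i>)" using pw[of z] z0 by simp
            also have "\<dots> \<le> ?q * cmod (z + \<i>)" by (intro mult_right_mono) auto
            finally show ?thesis .
          qed
          then have "k * cmod z powr (- a) / cmod (z + \<i>) ^ 3 \<le> k * (?q * cmod (z + \<i>)) / cmod (z + \<i>) ^ 3"
            using k0 by (intro divide_right_mono mult_left_mono) auto
          also have "\<dots> = k * ?q / (cmod (z + \<i>))\<^sup>2"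
            using zi[OF z0] by (simp add: power2_eq_square power3_eq_cube)
          finally show "cmod (\<psi> z) \<le> k * ?q / (cmod (z + \<i>))\<^sup>2"
            using main[OF z0] by linarith
        qed
      qed auto
      then show "(\<lambda>x. g x * \<rho> \<eta> (of_real x)) \<in> S" by (simp add: f1_def[abs_def])
    qed auto
    ultimately show "(\<lambda>x. F (Complex x y)) \<in> S" by simp
  qed auto
qed

lemma fbm_ext_outer:
  assumes b: "0 < b" and a: "-1/2 < a" "a < 1/2"
  shows "outer (\<lambda>x. fbm_ext b a (of_real x))"
proof -
  let ?h = "\<lambda>x. fbm_ext b a (of_real x)"
  let ?I = "{t. t < (0::real)}"
  define e where "e t x = exp (- (\<i> * of_real x * of_real t)) * ?h x" for t x :: real
  have hH: "?h \<in> H2_plus"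
    using fbm_ext_mult_H2_plus[of b a "\<lambda>_. 1" 1] a b by simp
  then have hL: "?h \<in> L2" by (simp add: H2_plus_def)
  have [measurable]: "?h \<in> borel_measurable lborel" by (rule fbm_ext_of_real_measurable)
  have eL: "e t \<in> L2" for t
    by (rule L2_dominated(1)[OF hL]) (auto simp: e_def[abs_def] norm_mult norm_exp_eq_Re)
  note sp = closed_subspace_span[of ?I e, OF eL]
  let ?V = "L2_closed_span ?I e"
  have "?V = H2_plus"
  proof
    show "H2_plus \<subseteq> ?V"
      by (rule H2_plus_subset_closed_subspace[OF sp(1) b a _ hL])
         (use sp(2) in \<open>simp add: e_def[abs_def]\<close>)
    show "?V \<subseteq> H2_plus"
    proof
      fix f assume "f \<in> ?V"
      then have f: "f \<in> L2" "\<And>\<epsilon>. 0 < \<epsilon> \<Longrightarrow> \<exists>T c. finite T \<and> T \<subseteq> ?I \<and> l2_norm (\<lambda>x. f x - (\<Sum>t\<in>T. c t * e t x)) < \<epsilon>"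
        using L2_closed_span_iff[of ?I e f] eL by blast+
      show "f \<in> H2_plus"
      proof (rule H2_plus_closed[OF f(1)])
        fix \<epsilon> :: real assume "0 < \<epsilon>"
        then obtain T c where T: "finite T" "T \<subseteq> ?I" "l2_norm (\<lambda>x. f x - (\<Sum>t\<in>T. c t * e t x)) < \<epsilon>"
          using f(2) by blast
        \<comment> \<open>For \<open>t < 0\<close> the modulus of
          \<open>exp (- (\<i> * z * t))\<close> is \<open>exp (t * Im z) \<le> 1\<close> in the
          upper half-plane, so the sum is a bounded multiplier of \<open>h\<close>.\<close>
        have "(\<lambda>x. (\<Sum>t\<in>T. c t * exp (- (\<i> * of_real x * of_real t))) * ?h x) \<in> H2_plus"
        proof (rule fbm_ext_mult_H2_plus[where M = "\<Sum>t\<in>T. cmod (c t)"])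
          show "(\<lambda>z. \<Sum>t\<in>T. c t * exp (- (\<i> * z * of_real t))) holomorphic_on {z. 0 < Im z}"
            by (intro holomorphic_intros)
          show "isCont (\<lambda>z. \<Sum>t\<in>T. c t * exp (- (\<i> * z * of_real t))) (of_real x)" for x
            by (intro continuous_intros)
          fix z assume z: "0 < Im z"
          have "cmod (\<Sum>t\<in>T. c t * exp (- (\<i> * z * of_real t))) \<le> (\<Sum>t\<in>T. cmod (c t * exp (- (\<i> * z * of_real t))))"
            by (rule norm_sum)
          also have "\<dots> \<le> (\<Sum>t\<in>T. cmod (c t))"
            using T(2) z by (intro sum_mono) (auto simp: norm_mult norm_exp_eq_Re mult_left_le mult_nonneg_nonpos)
          finally show "cmod (\<Sum>t\<in>T. c t * exp (- (\<i> * z * of_real t))) \<le> (\<Sum>t\<in>T. cmod (c t))" .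
        qed (use a b in auto)
        then have "(\<lambda>x. \<Sum>t\<in>T. c t * e t x) \<in> H2_plus"
          by (simp add: e_def sum_distrib_right mult.assoc)
        then show "\<exists>g\<in>H2_plus. l2_norm (\<lambda>x. f x - g x) < \<epsilon>"
          using T(3) by (intro bexI[where x = "\<lambda>x. \<Sum>t\<in>T. c t * e t x"])
      qed
    qed
  qed
  \<comment> \<open>Conjugation carries the generators in the definition of \<open>outer\<close> to
    the functions \<open>e t\<close>, and \<open>H2_minus\<close> to \<open>H2_plus\<close>.\<close>
  moreover have "f \<in> L2_closed_span ?I (\<lambda>t \<gamma>. exp (\<i> * of_real \<gamma> * of_real t) * cnj (?h \<gamma>))
     \<longleftrightarrow> (\<lambda>x. cnj (f x)) \<in> ?V" for f
    unfolding L2_closed_span_cnj[of f] by (simp add: e_def[abs_def] exp_cnj)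
  ultimately have "L2_closed_span ?I (\<lambda>t \<gamma>. exp (\<i> * of_real \<gamma> * of_real t) * cnj (?h \<gamma>)) = H2_minus"
    by (auto simp: H2_minus_iff)
  then show ?thesis using hH by (simp add: outer_def)
qed

section \<open>Uniqueness\<close>

text \<open>A square-integrable function at distance 0 from a member belongs to the closed set
  \<open>H2_plus\<close>.\<close>

lemma H2_plus_cong_AE:
  assumes "f \<in> H2_plus" "AE x in lborel. g x = f x" "g \<in> borel_measurable lborel"
  shows "g \<in> H2_plus"
proof -
  have f: "f \<in> L2" using assms(1) by (simp add: H2_plus_def)
  have g: "g \<in> L2"
    by (rule L2_dominated(1)[OF f assms(3)]) (use assms(2) in \<open>auto elim: eventually_mono\<close>)
  show ?thesis
  proof (rule H2_plus_closed[OF g])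
    fix \<epsilon> :: real assume "0 < \<epsilon>"
    have "l2_norm (\<lambda>x. g x - f x) = l2_norm (\<lambda>x. 0)"
      using assms(2,3) f by (intro l2_norm_cong_AE) (auto elim: eventually_mono simp: L2_iff)
    then have "l2_norm (\<lambda>x. g x - f x) < \<epsilon>" using \<open>0 < \<epsilon>\<close> by (simp add: l2_norm_def)
    then show "\<exists>f\<in>H2_plus. l2_norm (\<lambda>x. g x - f x) < \<epsilon>" using assms(1) by blast
  qed
qed

text \<open>The second clause identifies the boundary values of an extension that is known to equal
  \<open>c / (z + \<i>)\<close> inside the half-plane.\<close>

lemma cauchy_shift_L2_limit:
  "(\<lambda>x. c / (of_real x + \<i>)) \<in> H2_plus"
  "((\<lambda>y. l2_norm (\<lambda>x. c / (Complex x y + \<i>) - c / (of_real x + \<i>))) \<longlongrightarrow> 0) (at_right 0)"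
proof -
  define F where "F z = c / (z + \<i>)" for z
  have K: "(\<lambda>x. c * (1 / (of_real x - (- \<i>)))) \<in> L2"
    by (intro L2_scale L2_cauchy_kernel) simp
  have hol: "F holomorphic_on {z. 0 < Im z}"
    unfolding F_def using plus_ii_nonzero by (intro holomorphic_intros) auto
  have meas: "(\<lambda>x. F (of_real x)) \<in> borel_measurable lborel"
    unfolding F_def by measurable
  have bd: "cmod (F (Complex x y)) \<le> cmod (c * (1 / (of_real x - (- \<i>))))" if "0 < y" for x y
  proof -
    have "of_real x + \<i> = Complex x 1" "Complex x y + \<i> = Complex x (y + 1)" by (auto simp: complex_eq_iff)
    then have "cmod (of_real x + \<i>) \<le> cmod (Complex x y + \<i>)"
      using cmod_Complex_mono[of 1 "y + 1" x] that by (simp only:)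
    moreover have "0 < cmod (of_real x + \<i>)" by (simp add: complex_eq_iff)
    ultimately have "cmod c / cmod (Complex x y + \<i>) \<le> cmod c / cmod (of_real x + \<i>)"
      by (intro divide_left_mono mult_pos_pos) auto
    then show ?thesis by (simp add: F_def norm_divide norm_mult)
  qed
  have lim: "((\<lambda>y. F (Complex x y)) \<longlongrightarrow> F (of_real x)) (at_right 0)" for x
    using plus_ii_nonzero[of "of_real x"] unfolding F_def
    by (intro tendsto_vertical continuous_intros) auto
  have "(\<lambda>x. F (of_real x)) \<in> H2_plus"
    by (rule H2_plus_dominated[OF hol K meas]) (use bd lim in auto)
  then show "(\<lambda>x. c / (of_real x + \<i>)) \<in> H2_plus" by (simp add: F_def)
  have "((\<lambda>y. l2_norm (\<lambda>x. F (Complex x y) - F (of_real x))) \<longlongrightarrow> 0) (at_right 0)"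
    by (rule L2_dominated_convergence(2)[OF meas K, where b = 1])
       (use bd lim holomorphic_upper_measurable(2)[OF hol] in auto)
  then show "((\<lambda>y. l2_norm (\<lambda>x. c / (Complex x y + \<i>) - c / (of_real x + \<i>))) \<longlongrightarrow> 0) (at_right 0)"
    by (simp add: F_def)
qed

text \<open>
  The Cauchy integral of \<open>u / (x + \<i>)\<close> is evaluated by subtracting the multiple
  \<open>(w - \<i>) / (w + \<i>)\<close> of the vanishing Cauchy integral of \<open>u / (x - \<i>)\<close>, which cancels the
  factor \<open>x - w\<close> in the denominator.
\<close>

lemma H2_plus_multiplier_constant:
  assumes 1: "(\<lambda>x. u x / (of_real x + \<i>)) \<in> H2_plus"
    and 2: "(\<lambda>x. cnj (u x) / (of_real x + \<i>)) \<in> H2_plus"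
  shows "\<exists>c. AE x in lborel. u x = c"
proof -
  obtain F M where F: "hardy_ext F M (\<lambda>x. u x / (of_real x + \<i>))" using 1 by (auto simp: H2_plus_iff)
  obtain G N where G: "hardy_ext G N (\<lambda>x. cnj (u x) / (of_real x + \<i>))" using 2 by (auto simp: H2_plus_iff)
  define g where "g = (\<lambda>x. u x / (of_real x + \<i>))"
  have gL: "g \<in> L2" using hardy_ext_L2(1)[OF F] by (simp add: g_def)
  define m where "m = (\<integral>x. u x / (of_real (x\<^sup>2) + 1) \<partial>lborel)"
  have Fw: "F w = m / pi / (w + \<i>)" if w: "0 < Im w" for w
  proof -
    have wi: "w + \<i> \<noteq> 0" using plus_ii_nonzero[of w] w by simp
    let ?f = "\<lambda>x. g x / (of_real x - w)"
    \<comment> \<open>The Cauchy integral for the conjugate of \<open>u\<close> is taken at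
      \<open>cnj w\<close>, in the lower half-plane, where it vanishes; conjugating it restores
      \<open>u\<close> and the pole \<open>w\<close>.\<close>
    let ?g = "\<lambda>x. cnj (u x) / (of_real x + \<i>) / (of_real x - cnj w)"
    define k where "k x = cnj (?g x)" for x
    have f: "integrable lborel ?f" "(\<integral>x. ?f x \<partial>lborel) = 2 * pi * \<i> * F w"
      using cauchy_integrable[OF gL, of w] hardy_cauchy_formula[OF F, of w] w by (auto simp: g_def)
    have "integrable lborel ?g" "(\<integral>x. ?g x \<partial>lborel) = 0"
      using cauchy_integrable[OF hardy_ext_L2(1)[OF G], of "cnj w"] hardy_cauchy_formula[OF G, of "cnj w"] w by auto
    then have k: "integrable lborel k" "(\<integral>x. k x \<partial>lborel) = 0"
      unfolding k_def by (auto simp only: integrable_cnj Bochner_Integration.integral_cnj complex_cnj_zero)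
    have "?f x - (w - \<i>) / (w + \<i>) * k x = 2 * \<i> / (w + \<i>) * (u x / (of_real (x\<^sup>2) + 1))" for x
    proof -
      have nz: "of_real x - w \<noteq> 0" "of_real x + \<i> \<noteq> 0" "of_real x - \<i> \<noteq> 0"
        using w by (auto simp: complex_eq_iff)
      have sq: "of_real (x\<^sup>2) + 1 = (of_real x + \<i>) * (of_real x - \<i>)"
        by (simp add: complex_eq_iff power2_eq_square)
      have kx: "k x = u x / (of_real x - \<i>) / (of_real x - w)"
        by (simp add: k_def)
      \<comment> \<open>With the values inserted, the last condition reads \<open>(x - \<i>) * (w +
        \<i>) - (w - \<i>) * (x + \<i>) = 2 * \<i> * (x - w)\<close>.\<close>
      have gen: "v / p / d - q / s * (v / r / d) = t / s * (v / (p * r))"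
        if "p \<noteq> 0" "d \<noteq> 0" "r \<noteq> 0" "s \<noteq> 0" "r * s - q * p = t * d" for v p d q s r t :: complex
      proof -
        have "v / p / d - q / s * (v / r / d) = v * (r * s - q * p) / (p * d * r * s)"
          using that(1-4) by (simp add: field_simps)
        also have "\<dots> = t / s * (v / (p * r))" unfolding that(5) using that(1-4) by (simp add: field_simps)
        finally show ?thesis .
      qed
      show ?thesis
        unfolding kx sq g_def
        by (rule gen[OF nz(2,1,3) wi]) (simp add: algebra_simps)
    qed
    then have "(\<integral>x. ?f x - (w - \<i>) / (w + \<i>) * k x \<partial>lborel) = 2 * \<i> / (w + \<i>) * m"
      unfolding m_def by (simp only: integral_mult_right_zero)
    moreover have "(\<integral>x. ?f x - (w - \<i>) / (w + \<i>) * k x \<partial>lborel) = 2 * pi * \<i> * F w"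
      using f k by (subst Bochner_Integration.integral_diff) auto
    ultimately have "2 * pi * \<i> * F w = 2 * \<i> / (w + \<i>) * m" by simp
    moreover have "X = y / p / d" if "2 * p * \<i> * X = 2 * \<i> / d * y" "p \<noteq> 0" for X y p d :: complex
    proof -
      have "2 * \<i> * (p * X) = 2 * \<i> * (y / d)" using that(1) by (simp add: mult_ac)
      from iffD1[OF mult_left_cancel, OF _ this] have "p * X = y / d" by simp
      then have "X = y / d / p" using nonzero_mult_div_cancel_left[OF that(2), of X] by (simp only:)
      then show ?thesis by (simp add: mult.commute)
    qed
    ultimately show ?thesis by simp
  qed
  define c where "c = m / pi"
  have kL: "(\<lambda>x. c / (of_real x + \<i>)) \<in> L2"
    using cauchy_shift_L2_limit(1)[of c] by (simp add: H2_plus_def)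
  \<comment> \<open>On each line \<open>F\<close> equals \<open>c / (z + \<i>)\<close>; its
    \<open>L2\<close> limits \<open>g\<close> and \<open>c / (x + \<i>)\<close> are therefore at
    distance 0.\<close>
  have "((\<lambda>y. l2_norm (\<lambda>x. F (Complex x y) - g x) + l2_norm (\<lambda>x. c / (Complex x y + \<i>) - c / (of_real x + \<i>))) \<longlongrightarrow> 0 + 0) (at_right 0)"
    using hardy_ext_tendsto[OF F] cauchy_shift_L2_limit(2) unfolding g_def by (rule tendsto_add)
  moreover have "\<forall>\<^sub>F y in at_right 0. l2_norm (\<lambda>x. g x - c / (of_real x + \<i>)) \<le>
     l2_norm (\<lambda>x. F (Complex x y) - g x) + l2_norm (\<lambda>x. c / (Complex x y + \<i>) - c / (of_real x + \<i>))"
  proof (rule eventually_at_right_0I)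
    fix y :: real assume y: "0 < y"
    have eq: "F (Complex x y) = c / (Complex x y + \<i>)" for x using Fw[of "Complex x y"] y by (simp add: c_def)
    have "l2_norm (\<lambda>x. g x - c / (of_real x + \<i>)) \<le> l2_norm (\<lambda>x. g x - F (Complex x y)) + l2_norm (\<lambda>x. F (Complex x y) - c / (of_real x + \<i>))"
      by (rule l2_norm_triangle_diff[OF gL hardy_ext_L2(2)[OF F y] kL])
    then show "l2_norm (\<lambda>x. g x - c / (of_real x + \<i>)) \<le>
       l2_norm (\<lambda>x. F (Complex x y) - g x) + l2_norm (\<lambda>x. c / (Complex x y + \<i>) - c / (of_real x + \<i>))"
      by (simp add: l2_norm_minus[of g] eq)
  qed
  ultimately have "l2_norm (\<lambda>x. g x - c / (of_real x + \<i>)) \<le> 0"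
    using tendsto_lowerbound[OF _ _ trivial_limit_at_right_real] by fastforce
  then have "l2_norm (\<lambda>x. g x - c / (of_real x + \<i>)) = 0" using l2_norm_nonneg by (simp add: order_antisym)
  then have "AE x in lborel. g x - c / (of_real x + \<i>) = 0"
    by (rule l2_norm_eq_0_AE[OF L2_diff[OF gL kL]])
  then have "AE x in lborel. u x = c"
  proof eventually_elim
    case (elim x)
    have "of_real x + \<i> \<noteq> 0" by (simp add: complex_eq_iff)
    then show ?case using elim by (simp add: g_def divide_eq_eq)
  qed
  then show ?thesis by blast
qed

text \<open>Multiplication by \<open>cnj g / cnj h\<close> is an isometry that maps the generators of the span of \<open>h\<close> to those of \<open>g\<close>.\<close>

lemma outer_quotient_multiplier:
  assumes h: "outer h" and g: "outer g"
    and eq: "AE x in lborel. cmod (g x) = cmod (h x)" and nz: "AE x in lborel. h x \<noteq> 0"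
    and f: "f \<in> H2_minus"
  shows "(\<lambda>x. cnj (g x) / cnj (h x) * f x) \<in> H2_minus"
proof -
  let ?u = "\<lambda>x. cnj (g x) / cnj (h x)"
  have [measurable]: "h \<in> borel_measurable lborel" "g \<in> borel_measurable lborel" "f \<in> borel_measurable lborel"
    using h g f by (auto simp: outer_def H2_plus_def H2_minus_def L2_iff)
  have [measurable]: "(\<lambda>x. cnj (g x)) \<in> borel_measurable lborel" "(\<lambda>x. cnj (h x)) \<in> borel_measurable lborel"
    by (rule borel_measurable_cnj; measurable)+
  have fL: "f \<in> L2" using f by (simp add: H2_minus_def)
  have u1: "AE x in lborel. cmod (?u x) = 1"
    using eq nz by eventually_elim (simp add: norm_divide)
  have fh: "f \<in> L2_closed_span {t. t < 0} (\<lambda>t \<gamma>. exp (\<i> * of_real \<gamma> * of_real t) * cnj (h \<gamma>))"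
    using h f by (simp add: outer_def)
  have "(\<lambda>x. ?u x * f x) \<in> L2_closed_span {t. t < 0} (\<lambda>t \<gamma>. exp (\<i> * of_real \<gamma> * of_real t) * cnj (g \<gamma>))"
    unfolding L2_closed_span_def
  proof (intro CollectI conjI allI impI)
    show "(\<lambda>x. ?u x * f x) \<in> L2"
    proof (rule L2_dominated(1)[OF fL])
      show "AE x in lborel. cmod (?u x * f x) \<le> cmod (f x)"
        using u1 by eventually_elim (simp only: norm_mult mult_1 order_refl)
    qed measurable
    fix \<epsilon> :: ennreal assume "0 < \<epsilon>"
    then obtain T c where T: "finite T" "T \<subseteq> {t. t < 0}"
      "L2_norm_sq (\<lambda>x. f x - (\<Sum>t\<in>T. c t * (exp (\<i> * of_real x * of_real t) * cnj (h x)))) < \<epsilon>"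
      using fh unfolding L2_closed_span_def by blast
    have "L2_norm_sq (\<lambda>x. ?u x * f x - (\<Sum>t\<in>T. c t * (exp (\<i> * of_real x * of_real t) * cnj (g x))))
       = L2_norm_sq (\<lambda>x. f x - (\<Sum>t\<in>T. c t * (exp (\<i> * of_real x * of_real t) * cnj (h x))))"
      unfolding L2_norm_sq_def
    proof (rule nn_integral_cong_AE)
      show "AE x in lborel. ennreal ((cmod (?u x * f x - (\<Sum>t\<in>T. c t * (exp (\<i> * of_real x * of_real t) * cnj (g x)))))\<^sup>2)
        = ennreal ((cmod (f x - (\<Sum>t\<in>T. c t * (exp (\<i> * of_real x * of_real t) * cnj (h x)))))\<^sup>2)"
        using u1 nz
      proof eventually_elim
        case (elim x)
        have "cnj (g x) = ?u x * cnj (h x)" using elim by simp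
        then have "(\<Sum>t\<in>T. c t * (exp (\<i> * of_real x * of_real t) * cnj (g x))) =
            ?u x * (\<Sum>t\<in>T. c t * (exp (\<i> * of_real x * of_real t) * cnj (h x)))"
          unfolding sum_distrib_left by (intro sum.cong) (auto simp: mult_ac)
        then have "?u x * f x - (\<Sum>t\<in>T. c t * (exp (\<i> * of_real x * of_real t) * cnj (g x))) =
          ?u x * (f x - (\<Sum>t\<in>T. c t * (exp (\<i> * of_real x * of_real t) * cnj (h x))))"
          by (simp only: right_diff_distrib)
        then show ?case by (simp only: norm_mult elim mult_1)
      qed
    qed
    then show "\<exists>T c. finite T \<and> T \<subseteq> {t. t < 0} \<and>
       L2_norm_sq (\<lambda>x. ?u x * f x - (\<Sum>t\<in>T. c t * (exp (\<i> * of_real x * of_real t) * cnj (g x)))) < \<epsilon>"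
      using T by (intro exI[of _ T] exI[of _ c]) simp
  qed
  then show ?thesis using g by (simp add: outer_def)
qed

text \<open>The hypotheses are symmetric in \<open>g\<close> and \<open>h\<close>. Applied to
  \<open>1 / (x - \<i>)\<close> in both orders, the quotient lemma gives membership for
  \<open>g / h = u\<close> and for \<open>h / g\<close>, which is \<open>cnj u\<close> because the
  moduli agree.\<close>

lemma outer_unique:
  assumes h: "outer h" and g: "outer g"
    and eq: "AE x in lborel. cmod (g x) = cmod (h x)" and nz: "AE x in lborel. h x \<noteq> 0"
  shows "\<exists>c. AE x in lborel. g x = c * h x"
proof -
  have [measurable]: "h \<in> borel_measurable lborel" "g \<in> borel_measurable lborel"
    using h g by (auto simp: outer_def H2_plus_def L2_iff)
  have nz': "AE x in lborel. g x \<noteq> 0"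
    using eq nz by eventually_elim auto
  have eq': "AE x in lborel. cmod (h x) = cmod (g x)"
    using eq by eventually_elim simp
  define k where "k x = 1 / (complex_of_real x - \<i>)" for x :: real
  have k: "k \<in> H2_minus"
    unfolding H2_minus_iff k_def using cauchy_shift_L2_limit(1)[of 1] by simp
  define u where "u x = g x / h x" for x
  have [measurable]: "u \<in> borel_measurable lborel" unfolding u_def by measurable
  have "(\<lambda>x. u x / (of_real x + \<i>)) \<in> H2_plus"
    using outer_quotient_multiplier[OF h g eq nz k] unfolding H2_minus_iff
    by (simp add: u_def k_def)
  moreover have "(\<lambda>x. cnj (u x) / (of_real x + \<i>)) \<in> H2_plus"
  proof (rule H2_plus_cong_AE)
    show "(\<lambda>x. h x / g x / (of_real x + \<i>)) \<in> H2_plus"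
      using outer_quotient_multiplier[OF g h eq' nz' k] unfolding H2_minus_iff
      by (simp add: k_def)
    show "AE x in lborel. cnj (u x) / (of_real x + \<i>) = h x / g x / (of_real x + \<i>)"
      using eq nz nz'
    proof eventually_elim
      case (elim x)
      have "cnj (g x) * g x = h x * cnj (h x)"
        using complex_norm_square[of "g x"] complex_norm_square[of "h x"] elim(1) by (simp add: mult.commute)
      then have "cnj (u x) = h x / g x" using elim(2,3) by (simp add: u_def frac_eq_eq)
      then show ?case by (simp only:)
    qed
    have "(\<lambda>x. cnj (u x)) \<in> borel_measurable lborel" by (rule borel_measurable_cnj) measurable
    then show "(\<lambda>x. cnj (u x) / (of_real x + \<i>)) \<in> borel_measurable lborel" by measurable
  qed
  ultimately obtain c where "AE x in lborel. u x = c"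
    using H2_plus_multiplier_constant by blast
  then have "AE x in lborel. g x = c * h x"
    using nz by eventually_elim (auto simp: u_def)
  then show ?thesis by blast
qed

section \<open>Normalisation: the constant factor and its sign\<close>

lemma AE_lborel_uminus:
  assumes "AE x in lborel. P (x :: real)"
  shows "AE x in lborel. P (- x)"
  by (rule AE_distrD[of uminus lborel borel]) (use assms in \<open>simp_all only: lborel_distr_uminus, simp\<close>)

lemma AE_lborel_ex:
  assumes "AE x in lborel. P (x :: real)"
  shows "\<exists>x. P x"
proof -
  have "ae_filter (lborel :: real measure) \<noteq> bot" by (simp add: ae_filter_eq_bot_iff)
  then show ?thesis using assms eventually_happens' by blast
qed

lemma C_H_pos:
  assumes "0 < H" "H < 1"
  shows "0 < C_H H"
proof -
  have "0 < sin (pi * H)" using assms pi_gt_zero by (intro sin_gt_zero) (auto simp: mult_less_cancel_left2 simp del: pi_gt_zero)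
  moreover have "0 < Gamma (1 + 2 * H)" using assms by (intro Gamma_real_pos) auto
  ultimately show ?thesis by (simp add: C_H_def)
qed

text \<open>\<open>- h\<close> has the same span, modulus and symmetry as \<open>h\<close>, so a
  sign is the freedom that the three conditions leave.\<close>

theorem theorem6p1:
  fixes H :: real and h :: "real \<Rightarrow> complex"
  assumes "0 < H" and "H < 1"
    and h_def: "h = (\<lambda>\<gamma>. of_real (sqrt (C_H H))
          * exp (\<i> * of_real pi * of_real ((2 * H - 1) / 4) * of_real (sgn \<gamma>))
          * ((\<i> - of_real \<gamma>) / of_real (1 + \<gamma>\<^sup>2))
          * of_real (\<bar>\<gamma>\<bar> powr (1 / 2 - H)))"
  shows "outer h \<and> wiener_hopf_factor (fbm_density H) h \<and> reality_condition h \<and>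
    (\<forall>g. outer g \<and> wiener_hopf_factor (fbm_density H) g \<and> reality_condition g \<longrightarrow>
       (AE \<gamma> in lborel. g \<gamma> = h \<gamma>) \<or> (AE \<gamma> in lborel. g \<gamma> = - h \<gamma>))"
proof -
  define b where "b = sqrt (C_H H)"
  define a where "a = 1 / 2 - H"
  have b: "0 < b" "b\<^sup>2 = C_H H" using C_H_pos[OF assms(1,2)] by (auto simp: b_def)
  have a: "- 1 / 2 < a" "a < 1 / 2" "(2 * H - 1) / 4 = - a / 2" using assms by (auto simp: a_def)
  have h_ext_eq: "h = (\<lambda>x. fbm_ext b a (of_real x))"
    unfolding h_def fbm_ext_of_real a(3) b_def[symmetric] a_def[symmetric] ..
  have nz: "h x \<noteq> 0" if "x \<noteq> 0" for x
    unfolding h_ext_eq using that by (intro fbm_ext_nonzero b) auto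
  have outer_h: "outer h"
    unfolding h_ext_eq by (rule fbm_ext_outer[OF b(1) a(1,2)])
  have wh: "of_real (fbm_density H x / (1 + x\<^sup>2)) = complex_of_real ((cmod (h x))\<^sup>2)" if "x \<noteq> 0" for x
  proof -
    have "cmod (h x) = b * \<bar>x\<bar> powr a / cmod (of_real x + \<i>)"
      unfolding h_ext_eq using b that by (simp add: cmod_fbm_ext)
    then have "(cmod (h x))\<^sup>2 = b\<^sup>2 * (\<bar>x\<bar> powr a)\<^sup>2 / (x\<^sup>2 + 1)"
      by (simp only: power_divide power_mult_distrib cmod_x_plus_i)
    also have "(\<bar>x\<bar> powr a)\<^sup>2 = \<bar>x\<bar> powr (1 - 2 * H)"
      unfolding power2_eq_square powr_add[symmetric] by (simp add: a_def)
    finally show ?thesis by (simp only: b fbm_density_def add.commute)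
  qed
  have wh_h: "wiener_hopf_factor (fbm_density H) h"
    unfolding wiener_hopf_factor_def using AE_lborel_nonzero
    by eventually_elim (use wh complex_norm_square in metis)
  have real_h: "(- of_real x - \<i>) * h (- x) = (of_real x + \<i>) * cnj (h x)" for x
    unfolding h_def by (simp add: exp_cnj algebra_simps sgn_minus)
  have rc_h: "reality_condition h"
    unfolding reality_condition_def using real_h by simp
  have "(AE \<gamma> in lborel. g \<gamma> = h \<gamma>) \<or> (AE \<gamma> in lborel. g \<gamma> = - h \<gamma>)"
    if g: "outer g" "wiener_hopf_factor (fbm_density H) g" "reality_condition g" for g
  proof -
    have eq: "AE x in lborel. cmod (g x) = cmod (h x)"
      using AE_lborel_nonzero g(2)[unfolded wiener_hopf_factor_def]
    proof eventually_elim
      case (elim x)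
      have "complex_of_real ((cmod (g x))\<^sup>2) = complex_of_real ((cmod (h x))\<^sup>2)"
        using elim(2) wh[OF elim(1)] complex_norm_square[of "g x"] by simp
      then have "(cmod (g x))\<^sup>2 = (cmod (h x))\<^sup>2" by (simp only: of_real_eq_iff)
      then show ?case by simp
    qed
    have nz_AE: "AE x in lborel. h x \<noteq> 0" using AE_lborel_nonzero by eventually_elim (rule nz)
    obtain c where c: "AE x in lborel. g x = c * h x"
      using outer_unique[OF outer_h g(1) eq nz_AE] by blast
    \<comment> \<open>The factor \<open>c\<close> is a single number, so one point off the null sets
      determines it; \<open>- x\<close> is included because the reality condition links the two
      points.\<close>
    have "AE x in lborel. g x = c * h x \<and> g (- x) = c * h (- x) \<and> cmod (g x) = cmod (h x) \<and>
        (- of_real x - \<i>) * g (- x) = (of_real x + \<i>) * cnj (g x) \<and> x \<noteq> 0"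
      using c AE_lborel_uminus[OF c] eq g(3)[unfolded reality_condition_def] AE_lborel_nonzero
      by eventually_elim blast
    then obtain x where x: "g x = c * h x" "g (- x) = c * h (- x)" "cmod (g x) = cmod (h x)"
        "(- of_real x - \<i>) * g (- x) = (of_real x + \<i>) * cnj (g x)" "x \<noteq> 0"
      using AE_lborel_ex by blast
    have hx: "h x \<noteq> 0" "h (- x) \<noteq> 0" using nz[of x] nz[of "- x"] x(5) by auto
    have "cmod c = 1" using x(1,3) hx by (simp add: norm_mult)
    moreover have "c = cnj c"
    proof -
      \<comment> \<open>Both functions obey the reality condition at \<open>x\<close>; comparing the
        two instances multiplies one nonzero number by \<open>c\<close> and by
        \<open>cnj c\<close>.\<close>
      have "c * ((- of_real x - \<i>) * h (- x)) = (- of_real x - \<i>) * g (- x)"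
        unfolding x(2) by (simp only: mult_ac)
      also have "\<dots> = cnj c * ((of_real x + \<i>) * cnj (h x))"
        unfolding x(4) x(1) by (simp add: mult_ac)
      finally have "c * ((- of_real x - \<i>) * h (- x)) = cnj c * ((- of_real x - \<i>) * h (- x))"
        unfolding real_h[symmetric] .
      moreover have "- of_real x - \<i> \<noteq> 0" by (simp add: complex_eq_iff)
      ultimately show ?thesis using hx by simp
    qed
    ultimately have "Im c = 0" "(Re c)\<^sup>2 = 1"
      by (auto simp: complex_eq_iff cmod_def)
    then have "c = 1 \<or> c = -1"
      by (auto simp: complex_eq_iff power2_eq_1_iff)
    then show ?thesis
    proof
      assume "c = 1"
      with c show ?thesis by simp
    next
      assume "c = - 1"
      with c have "AE x in lborel. g x = - h x" by simp
      then show ?thesis ..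
    qed
  qed
  then show ?thesis using outer_h wh_h rc_h by blast
qed

end
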